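(* Assume the OMv conjecture. Then for every constant $\epsilon>0$ there do not exist data structures with $O(n^{1-\epsilon})$ update and query time, subject to (retroactive) edge insertions/deletions, for any of the following problems: fully retroactive connectivity; fully retroactive maximal matching; fully retroactive minimum spanning forest; fully retroactive maximum density; incremental fully retroactive maximum degree. This holds even when all edges are unweighted.
   Context: Setting: a graph on a fixed vertex set with $n$ vertices, initially empty. A retroactive data structure maintains a sequence $S$ of updates (edge insertions and deletions), each with a distinct real time; operations $\textsf{Create}(\text{update},t)$ add an update at time $t$ and $\textsf{Cancel}(t)$ remove the update at time $t$ (all operations legal). $G_t$ is the graph obtained by applying the updates with time at most $t$ in time order. Fully retroactive: queries may be asked at any time $t$ and are answered on $G_t$. Incremental: creation of deletions is not allowed (only $\textsf{Create}(\textsf{Insert}(e),t)$ and $\textsf{Cancel}(t)$). For maximal matching the query asks for the size of a maximal matching of $G_t$; for the minimum spanning forest, the size of the forest; the maximum density of a graph is $\max_{\emptyset\ne U\subseteq V}|E(U)|/|U|$, where $E(U)$ is the set of edges with both endpoints in $U$. OMv problem: given an $n\times n$ Boolean matrix $M$, then $n$ Boolean vectors $v_1,\dots,v_n$ arriving online, output the Boolean product $Mv_i$ before $v_{i+1}$ is revealed. OMv conjecture: for every constant $\epsilon>0$ no algorithm solves OMv in $O(n^{3-\epsilon})$ time. *)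

theory Defs
  imports Complex_Main "HOL-Library.Landau_Symbols"
begin

section \<open>Machine model\<close>

text \<open>
  A word RAM, presented as a structured imperative language.  A program is a fixed finite piece of
  syntax that uses finitely many registers and zero-initialised arrays of words.  Words are natural
  numbers, and a computation is only valid as long as every number that it computes is at most a
  bound \<open>B\<close>; below, \<open>B\<close> is always polynomial in the size of the instance, i.e. words have
  logarithmically many bits.  An overflow is a fault: the semantics then has no derivation.

  Real numbers (the times of retroactive operations) live in separate registers and arrays. They
  can be copied, compared, and converted from and to words (rounding down), but there is no
  arithmetic on them.
\<close>

datatype binop =
  Add | Sub | Mul | Div | Mod | And | Or | Xor | ShiftL | ShiftR | Less | Equal

fun binop_val :: "binop \<Rightarrow> nat \<Rightarrow> nat \<Rightarrow> nat" where
  "binop_val Add x y = x + y"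
| "binop_val Sub x y = x - y"
| "binop_val Mul x y = x * y"
| "binop_val Div x y = x div y"
| "binop_val Mod x y = x mod y"
| "binop_val And x y = Bit_Operations.and x y"
| "binop_val Or x y = Bit_Operations.or x y"
| "binop_val Xor x y = Bit_Operations.xor x y"
| "binop_val ShiftL x y = push_bit y x"
| "binop_val ShiftR x y = drop_bit y x"
| "binop_val Less x y = of_bool (x < y)"
| "binop_val Equal x y = of_bool (x = y)"

datatype exp =
    Const nat
  | Reg nat
  | Arr nat exp
  | Bin binop exp exp
  | Before texp texp
  | Floor texp
and texp =
    TReg nat
  | TArr nat exp
  | OfWord exp

record state =
  reg :: "nat \<Rightarrow> nat"
  arr :: "nat \<Rightarrow> nat \<Rightarrow> nat"
  treg :: "nat \<Rightarrow> real"
  tarr :: "nat \<Rightarrow> nat \<Rightarrow> real"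

definition blank :: state where
  "blank = \<lparr>reg = (\<lambda>_. 0), arr = (\<lambda>_ _. 0), treg = (\<lambda>_. 0), tarr = (\<lambda>_ _. 0)\<rparr>"

primrec val :: "state \<Rightarrow> exp \<Rightarrow> nat" and tval :: "state \<Rightarrow> texp \<Rightarrow> real" where
  "val s (Const k) = k"
| "val s (Reg x) = reg s x"
| "val s (Arr a e) = arr s a (val s e)"
| "val s (Bin f e e') = binop_val f (val s e) (val s e')"
| "val s (Before t t') = of_bool (tval s t < tval s t')"
| "val s (Floor t) = nat \<lfloor>tval s t\<rfloor>"
| "tval s (TReg x) = treg s x"
| "tval s (TArr a e) = tarr s a (val s e)"
| "tval s (OfWord e) = real (val s e)"

text \<open>
  \<open>fits B s e\<close>: no number computed while evaluating \<open>e\<close> exceeds \<open>B\<close>.  Contents of memory need not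
  be checked again, since only numbers that fit are ever stored.
\<close>

primrec fits :: "nat \<Rightarrow> state \<Rightarrow> exp \<Rightarrow> bool" and tfits :: "nat \<Rightarrow> state \<Rightarrow> texp \<Rightarrow> bool" where
  "fits B s (Const k) \<longleftrightarrow> k \<le> B"
| "fits B s (Reg x) \<longleftrightarrow> True"
| "fits B s (Arr a e) \<longleftrightarrow> fits B s e"
| "fits B s (Bin f e e') \<longleftrightarrow>
     fits B s e \<and> fits B s e' \<and> binop_val f (val s e) (val s e') \<le> B"
| "fits B s (Before t t') \<longleftrightarrow> tfits B s t \<and> tfits B s t'"
| "fits B s (Floor t) \<longleftrightarrow> tfits B s t \<and> nat \<lfloor>tval s t\<rfloor> \<le> B"
| "tfits B s (TReg x) \<longleftrightarrow> True"
| "tfits B s (TArr a e) \<longleftrightarrow> fits B s e"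
| "tfits B s (OfWord e) \<longleftrightarrow> fits B s e"

datatype com =
    Skip
  | Assign nat exp
  | Store nat exp exp
  | TAssign nat texp
  | TStore nat exp texp
  | Seq com com
  | If exp com com
  | While exp com

text \<open>
  \<open>exec B c s k s'\<close>: program \<open>c\<close>, started in \<open>s\<close>, stops in \<open>s'\<close> after \<open>k\<close> steps without a fault.
  An expression is charged one step; its size is a constant that depends on the program only.
\<close>

inductive exec :: "nat \<Rightarrow> com \<Rightarrow> state \<Rightarrow> nat \<Rightarrow> state \<Rightarrow> bool" for B :: nat where
  Skip: "exec B Skip s 1 s"
| Assign: "fits B s e \<Longrightarrow>
    exec B (Assign x e) s 1 (s\<lparr>reg := (reg s)(x := val s e)\<rparr>)"
| Store: "fits B s i \<Longrightarrow> fits B s e \<Longrightarrow>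
    exec B (Store a i e) s 1 (s\<lparr>arr := (arr s)(a := (arr s a)(val s i := val s e))\<rparr>)"
| TAssign: "tfits B s t \<Longrightarrow>
    exec B (TAssign x t) s 1 (s\<lparr>treg := (treg s)(x := tval s t)\<rparr>)"
| TStore: "fits B s i \<Longrightarrow> tfits B s t \<Longrightarrow>
    exec B (TStore a i t) s 1 (s\<lparr>tarr := (tarr s)(a := (tarr s a)(val s i := tval s t))\<rparr>)"
| Seq: "exec B c s k s' \<Longrightarrow> exec B c' s' k' s'' \<Longrightarrow> exec B (Seq c c') s (k + k') s''"
| IfTrue: "fits B s e \<Longrightarrow> val s e \<noteq> 0 \<Longrightarrow> exec B c s k s' \<Longrightarrow> exec B (If e c c') s (1 + k) s'"
| IfFalse: "fits B s e \<Longrightarrow> val s e = 0 \<Longrightarrow> exec B c' s k s' \<Longrightarrow> exec B (If e c c') s (1 + k) s'"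
| WhileFalse: "fits B s e \<Longrightarrow> val s e = 0 \<Longrightarrow> exec B (While e c) s 1 s"
| WhileTrue: "fits B s e \<Longrightarrow> val s e \<noteq> 0 \<Longrightarrow> exec B c s k s' \<Longrightarrow> exec B (While e c) s' k' s'' \<Longrightarrow>
    exec B (While e c) s (1 + k + k') s''"


section \<open>Online Boolean matrix-vector multiplication\<close>

text \<open>
  An algorithm consists of a program that preprocesses the matrix and a program that is run once
  for each vector.  The memory is kept in between; a vector is written into the memory only after
  the previous product has been read off, so the algorithm is online by construction.
  Register 0 initially holds \<open>n\<close>, array 0 the matrix in row-major order; vectors are
  delivered in array 1 and products are returned in array 2.
\<close>

record omv_algorithm =
  preprocess :: com
  multiply :: com

definition omv_input :: "nat \<Rightarrow> (nat \<Rightarrow> nat \<Rightarrow> bool) \<Rightarrow> state" where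
  "omv_input n M = blank\<lparr>reg := (reg blank)(0 := n),
     arr := (arr blank)(0 := (\<lambda>p. if p < n * n then of_bool (M (p div n) (p mod n)) else 0))\<rparr>"

definition load_vector :: "nat \<Rightarrow> (nat \<Rightarrow> bool) \<Rightarrow> state \<Rightarrow> state" where
  "load_vector n v s =
     s\<lparr>arr := (arr s)(1 := (\<lambda>j. if j < n then of_bool (v j) else arr s 1 j))\<rparr>"

definition bool_product :: "nat \<Rightarrow> (nat \<Rightarrow> nat \<Rightarrow> bool) \<Rightarrow> (nat \<Rightarrow> bool) \<Rightarrow> nat \<Rightarrow> bool" where
  "bool_product n M v i \<longleftrightarrow> (\<exists>j<n. M i j \<and> v j)"

inductive omv_rounds ::
  "nat \<Rightarrow> com \<Rightarrow> nat \<Rightarrow> (nat \<Rightarrow> nat \<Rightarrow> bool) \<Rightarrow> state \<Rightarrow> (nat \<Rightarrow> bool) list \<Rightarrow> nat \<Rightarrow> bool"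
  for B :: nat and c :: com and n :: nat and M :: "nat \<Rightarrow> nat \<Rightarrow> bool" where
  Nil: "omv_rounds B c n M s [] 0"
| Cons: "exec B c (load_vector n v s) k s' \<Longrightarrow>
    (\<forall>i<n. arr s' 2 i = of_bool (bool_product n M v i)) \<Longrightarrow>
    omv_rounds B c n M s' vs k' \<Longrightarrow>
    omv_rounds B c n M s (v # vs) (k + k')"

definition solves_omv :: "omv_algorithm \<Rightarrow> (nat \<Rightarrow> real) \<Rightarrow> bool" where
  "solves_omv A T \<longleftrightarrow> (\<exists>c. \<forall>n\<ge>1. \<forall>M vs. length vs = n \<longrightarrow>
     (\<exists>k s k'. exec ((n + 2) ^ c) (preprocess A) (omv_input n M) k s \<and>
        omv_rounds ((n + 2) ^ c) (multiply A) n M s vs k' \<and>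
        real (k + k') \<le> T n))"

definition OMv_conjecture :: bool where
  "OMv_conjecture \<longleftrightarrow>
     (\<forall>\<epsilon>>0. \<nexists>A T. T \<in> O(\<lambda>n. real n powr (3 - \<epsilon>)) \<and> solves_omv A T)"


section \<open>Retroactive update sequences\<close>

text \<open>Graphs have the vertex set \<open>{..<n}\<close>; edges are two-element sets of vertices.\<close>

datatype update = Insert nat nat | Delete nat nat

fun apply_update :: "update \<Rightarrow> nat set set \<Rightarrow> nat set set" where
  "apply_update (Insert u v) E = E \<union> {{u, v}}"
| "apply_update (Delete u v) E = E - {{u, v}}"

fun legal_update :: "nat \<Rightarrow> update \<Rightarrow> nat set set \<Rightarrow> bool" where
  "legal_update n (Insert u v) E \<longleftrightarrow> u < n \<and> v < n \<and> u \<noteq> v \<and> {u, v} \<notin> E"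
| "legal_update n (Delete u v) E \<longleftrightarrow> {u, v} \<in> E"

text \<open>The sequence \<open>S\<close>, as a finite map from times to updates.\<close>

type_synonym timeline = "real \<Rightarrow> update option"

definition replay :: "timeline \<Rightarrow> real set \<Rightarrow> nat set set" where
  "replay S R = fold (\<lambda>t. apply_update (the (S t))) (sorted_list_of_set (dom S \<inter> R)) {}"

abbreviation graph_at :: "timeline \<Rightarrow> real \<Rightarrow> nat set set" where
  "graph_at S t \<equiv> replay S {..t}"

definition legal_timeline :: "nat \<Rightarrow> timeline \<Rightarrow> bool" where
  "legal_timeline n S \<longleftrightarrow> finite (dom S) \<and>
     (\<forall>t\<in>dom S. legal_update n (the (S t)) (replay S {..<t}))"

text \<open>The list in a query holds its arguments other than the time.\<close>

datatype operation =
    Create update real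
  | Cancel real
  | Query "nat list" real

fun perform :: "operation \<Rightarrow> timeline \<Rightarrow> timeline" where
  "perform (Create a t) S = S(t \<mapsto> a)"
| "perform (Cancel t) S = S(t := None)"
| "perform (Query as t) S = S"

text \<open>
  \<open>answers P n E as x y\<close>: on the graph with vertices \<open>{..<n}\<close> and edges \<open>E\<close>, the pair of words
  \<open>(x, y)\<close> is an acceptable answer to a query with arguments \<open>as\<close>.
\<close>

record problem =
  deletions_allowed :: bool
  arguments :: "nat \<Rightarrow> nat list set"
  answers :: "nat \<Rightarrow> nat set set \<Rightarrow> nat list \<Rightarrow> nat \<Rightarrow> nat \<Rightarrow> bool"

fun legal_operation :: "problem \<Rightarrow> nat \<Rightarrow> timeline \<Rightarrow> operation \<Rightarrow> bool" where
  "legal_operation P n S (Create a t) \<longleftrightarrow> S t = None \<and> legal_timeline n (S(t \<mapsto> a)) \<and>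
     (deletions_allowed P \<or> (\<exists>u v. a = Insert u v))"
| "legal_operation P n S (Cancel t) \<longleftrightarrow> S t \<noteq> None \<and> legal_timeline n (S(t := None))"
| "legal_operation P n S (Query as t) \<longleftrightarrow> as \<in> arguments P n"

fun legal_operations :: "problem \<Rightarrow> nat \<Rightarrow> timeline \<Rightarrow> operation list \<Rightarrow> bool" where
  "legal_operations P n S [] \<longleftrightarrow> True"
| "legal_operations P n S (opn # ops) \<longleftrightarrow>
     legal_operation P n S opn \<and> legal_operations P n (perform opn S) ops"


section \<open>Retroactive data structures\<close>

text \<open>
  One program per operation, sharing the memory.  Initially register 0 holds \<open>n\<close>.  The
  vertices of an edge, or the arguments of a query, are passed in registers 0, 1, and so on, and the time in
  real register 0; the answer to a query is returned in registers 0 and 1.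
\<close>

record data_structure =
  initialise :: com
  create_insertion :: com
  create_deletion :: com
  cancel :: com
  answer_query :: com

definition initial_state :: "nat \<Rightarrow> state" where
  "initial_state n = blank\<lparr>reg := (reg blank)(0 := n)\<rparr>"

definition pass :: "nat list \<Rightarrow> real \<Rightarrow> state \<Rightarrow> state" where
  "pass as t s = s\<lparr>reg := (\<lambda>x. if x < length as then as ! x else reg s x),
                   treg := (treg s)(0 := t)\<rparr>"

fun run_operation :: "nat \<Rightarrow> data_structure \<Rightarrow> operation \<Rightarrow> state \<Rightarrow> nat \<Rightarrow> state \<Rightarrow> bool" where
  "run_operation B D (Create (Insert u v) t) s k s' \<longleftrightarrow>
     exec B (create_insertion D) (pass [u, v] t s) k s'"
| "run_operation B D (Create (Delete u v) t) s k s' \<longleftrightarrow>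
     exec B (create_deletion D) (pass [u, v] t s) k s'"
| "run_operation B D (Cancel t) s k s' \<longleftrightarrow> exec B (cancel D) (pass [] t s) k s'"
| "run_operation B D (Query as t) s k s' \<longleftrightarrow> exec B (answer_query D) (pass as t s) k s'"

fun correct_response :: "problem \<Rightarrow> nat \<Rightarrow> timeline \<Rightarrow> operation \<Rightarrow> state \<Rightarrow> bool" where
  "correct_response P n S (Query as t) s \<longleftrightarrow> answers P n (graph_at S t) as (reg s 0) (reg s 1)"
| "correct_response P n S _ s \<longleftrightarrow> True"

inductive run_operations ::
  "nat \<Rightarrow> data_structure \<Rightarrow> problem \<Rightarrow> nat \<Rightarrow> timeline \<Rightarrow> state \<Rightarrow> operation list \<Rightarrow> nat \<Rightarrow> bool"
  for B :: nat and D :: data_structure and P :: problem and n :: nat where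
  Nil: "run_operations B D P n S s [] 0"
| Cons: "run_operation B D opn s k s' \<Longrightarrow> correct_response P n S opn s' \<Longrightarrow>
    run_operations B D P n (perform opn S) s' ops k' \<Longrightarrow>
    run_operations B D P n S s (opn # ops) (k + k')"

text \<open>
  \<open>has_data_structure P \<tau>\<close>: there is a data structure for \<open>P\<close> with amortised update and query time
  \<open>O(\<tau> n)\<close>, \<open>n\<close> being the number of vertices.  The length of the operation sequence is not bounded
  in terms of \<open>n\<close>, so the word size depends on it as well, and the time bound is only
  required for sequences of polynomial length (with a constant that may depend on the polynomial).
  The start-up on the empty graph gets a separate, truly subcubic allowance.
\<close>

definition has_data_structure :: "problem \<Rightarrow> (nat \<Rightarrow> real) \<Rightarrow> bool" where
  "has_data_structure P \<tau> \<longleftrightarrow> (\<exists>D c \<delta>. \<delta> > 0 \<and> (\<forall>d. \<exists>I T.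
     I \<in> O(\<lambda>n. real n powr (3 - \<delta>)) \<and> T \<in> O(\<tau>) \<and>
     (\<forall>n\<ge>1. \<forall>ops. legal_operations P n Map.empty ops \<and> length ops \<le> n ^ d \<longrightarrow>
        (\<exists>k s k'. exec ((n + length ops + 2) ^ c) (initialise D) (initial_state n) k s \<and>
           run_operations ((n + length ops + 2) ^ c) D P n Map.empty s ops k' \<and>
           real (k + k') \<le> I n + real (length ops) * T n))))"


section \<open>The graph problems\<close>

definition connected_in :: "nat set set \<Rightarrow> nat \<Rightarrow> nat \<Rightarrow> bool" where
  "connected_in E u v \<longleftrightarrow> (u, v) \<in> {(x, y). {x, y} \<in> E}\<^sup>*"

text \<open>
  The two usual forms of connectivity queries: whether two given vertices are connected, and
  whether the whole graph is connected.
\<close>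

definition pairwise_connectivity :: problem where
  "pairwise_connectivity = \<lparr>deletions_allowed = True,
     arguments = (\<lambda>n. {[u, v] | u v. u < n \<and> v < n}),
     answers = (\<lambda>n E as x y. x = of_bool (connected_in E (as ! 0) (as ! 1)))\<rparr>"

definition global_connectivity :: problem where
  "global_connectivity = \<lparr>deletions_allowed = True,
     arguments = (\<lambda>n. {[]}),
     answers = (\<lambda>n E as x y. x = of_bool (\<forall>u<n. \<forall>v<n. connected_in E u v))\<rparr>"

definition matching :: "nat set set \<Rightarrow> bool" where
  "matching M \<longleftrightarrow> (\<forall>e\<in>M. \<forall>f\<in>M. e \<noteq> f \<longrightarrow> e \<inter> f = {})"

definition maximal_matching_in :: "nat set set \<Rightarrow> nat set set \<Rightarrow> bool" where
  "maximal_matching_in E M \<longleftrightarrow> M \<subseteq> E \<and> matching M \<and>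
     (\<forall>M'. M \<subset> M' \<and> M' \<subseteq> E \<longrightarrow> \<not> matching M')"

definition maximal_matching :: problem where
  "maximal_matching = \<lparr>deletions_allowed = True,
     arguments = (\<lambda>n. {[]}),
     answers = (\<lambda>n E as x y. \<exists>M. maximal_matching_in E M \<and> x = card M)\<rparr>"

definition forest :: "nat set set \<Rightarrow> bool" where
  "forest F \<longleftrightarrow> (\<forall>u v. {u, v} \<in> F \<longrightarrow> \<not> connected_in (F - {{u, v}}) u v)"

definition spanning_forest :: "nat set set \<Rightarrow> nat set set \<Rightarrow> bool" where
  "spanning_forest E F \<longleftrightarrow> F \<subseteq> E \<and> forest F \<and>
     (\<forall>u v. connected_in E u v \<longrightarrow> connected_in F u v)"

text \<open>Without weights, i.e. with every edge of weight 1.\<close>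

definition minimum_spanning_forest_of :: "nat set set \<Rightarrow> nat set set \<Rightarrow> bool" where
  "minimum_spanning_forest_of E F \<longleftrightarrow> spanning_forest E F \<and>
     (\<forall>F'. spanning_forest E F' \<longrightarrow> card F \<le> card F')"

definition minimum_spanning_forest :: problem where
  "minimum_spanning_forest = \<lparr>deletions_allowed = True,
     arguments = (\<lambda>n. {[]}),
     answers = (\<lambda>n E as x y. \<exists>F. minimum_spanning_forest_of E F \<and> x = card F)\<rparr>"

definition max_density :: "nat \<Rightarrow> nat set set \<Rightarrow> real" where
  "max_density n E =
     Max ((\<lambda>U. real (card {e \<in> E. e \<subseteq> U}) / real (card U)) ` {U. U \<noteq> {} \<and> U \<subseteq> {..<n}})"

text \<open>The density is returned as a fraction, not necessarily in lowest terms.\<close>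

definition maximum_density :: problem where
  "maximum_density = \<lparr>deletions_allowed = True,
     arguments = (\<lambda>n. {[]}),
     answers = (\<lambda>n E as x y. y \<noteq> 0 \<and> real x / real y = max_density n E)\<rparr>"

definition max_degree :: "nat \<Rightarrow> nat set set \<Rightarrow> nat" where
  "max_degree n E = Max ((\<lambda>v. card {e \<in> E. v \<in> e}) ` {..<n})"

definition incremental_maximum_degree :: problem where
  "incremental_maximum_degree = \<lparr>deletions_allowed = False,
     arguments = (\<lambda>n. {[]}),
     answers = (\<lambda>n E as x y. x = max_degree n E)\<rparr>"

end

theory Submission
  imports Defs
begin

text \<open>
  The matrix is stored in time: each row owns an interval of times, and the edges of row \<open>i\<close> exist
  only during its interval.  A vector \<open>v\<close> is then presented by \<open>O(n)\<close> edges inserted before all rows,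
  so that one query inside the interval of row \<open>i\<close> sees \<open>v\<close> together with row \<open>i\<close> and decides
  whether they have a common 1; afterwards these edges are cancelled.  This multiplies with \<open>O(n\<^sup>2)\<close>
  operations altogether.  Where deletions may not be created, the edges of a row are completed
  after its interval in such a way that all columns get the same degree, and a common 1 shows up
  as a degree that exceeds the number of previous rows by 2.
\<close>

text \<open>The time of the data structure is amortised, so nothing is known about a single
  operation: a bound exists only for a run on a complete sequence. Since the operations issued for a
  matrix and its vectors do not depend on any answer, such a run can be fixed for all
  \<open>n\<close> rounds before the analysis starts; the online program is then shown to consume it
  piece by piece. The matrix costs at most \<open>2 * (n * n)\<close> operations and a vector at
  most \<open>3 * n + 2\<close>, in total at most \<open>7 * (n * n)\<close>, on a graph with at
  most \<open>3 * n + 3\<close> vertices. Disjoint intervals let all rows share the same edges if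
  they are deleted in time. Without deletions the cells of all rows need different edges, and these
  must be spread so that no other vertex overtakes the columns in degree; hence the cyclic shift
  \<open>(i + j) mod n\<close>. The additional column \<open>n\<close> has the constant bit
  \<open>False\<close>. It ties the vertex \<open>n\<close> to a hub in the connectivity graph and
  makes \<open>n + 1\<close> the reference size of a matching. Words are bounded, so the simulation
  must also know that an answer can be processed without overflow.\<close>

section \<open>Embedding a program into a larger memory\<close>

text \<open>
  Registers and arrays 0 to 3 are reserved for the simulating program: register 0 holds \<open>n\<close>, 1 the
  time slot, 2 the row and 3 the column, and arrays 0 to 2 are those of the OMv interface.  It
  needs no memory for real numbers, so that part is not shifted.
\<close>

primrec shift_exp :: "exp \<Rightarrow> exp" and shift_texp :: "texp \<Rightarrow> texp" where
  "shift_exp (Const k) = Const k"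
| "shift_exp (Reg x) = Reg (x + 4)"
| "shift_exp (Arr a e) = Arr (a + 4) (shift_exp e)"
| "shift_exp (Bin f e e') = Bin f (shift_exp e) (shift_exp e')"
| "shift_exp (Before t t') = Before (shift_texp t) (shift_texp t')"
| "shift_exp (Floor t) = Floor (shift_texp t)"
| "shift_texp (TReg x) = TReg x"
| "shift_texp (TArr a e) = TArr a (shift_exp e)"
| "shift_texp (OfWord e) = OfWord (shift_exp e)"

primrec shift_com :: "com \<Rightarrow> com" where
  "shift_com Skip = Skip"
| "shift_com (Assign x e) = Assign (x + 4) (shift_exp e)"
| "shift_com (Store a i e) = Store (a + 4) (shift_exp i) (shift_exp e)"
| "shift_com (TAssign x t) = TAssign x (shift_texp t)"
| "shift_com (TStore a i t) = TStore a (shift_exp i) (shift_texp t)"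
| "shift_com (Seq c c') = Seq (shift_com c) (shift_com c')"
| "shift_com (If e c c') = If (shift_exp e) (shift_com c) (shift_com c')"
| "shift_com (While e c) = While (shift_exp e) (shift_com c)"

definition embed :: "(nat \<Rightarrow> nat) \<Rightarrow> (nat \<Rightarrow> nat \<Rightarrow> nat) \<Rightarrow> state \<Rightarrow> state" where
  "embed r a s = \<lparr>reg = (\<lambda>x. if x < 4 then r x else reg s (x - 4)),
     arr = (\<lambda>x. if x < 4 then a x else arr s (x - 4)), treg = treg s, tarr = tarr s\<rparr>"

lemma embed_sel [simp]:
  "reg (embed r a s) x = (if x < 4 then r x else reg s (x - 4))"
  "arr (embed r a s) x = (if x < 4 then a x else arr s (x - 4))"
  "treg (embed r a s) = treg s" "tarr (embed r a s) = tarr s"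
  by (simp_all add: embed_def)

lemma embed_reg_own:
  "x < 4 \<Longrightarrow> (embed r a s)\<lparr>reg := (reg (embed r a s))(x := w)\<rparr> = embed (r(x := w)) a s"
  by (auto simp: embed_def fun_eq_iff)

lemma embed_reg_shift:
  "(embed r a s)\<lparr>reg := (reg (embed r a s))(x + 4 := w)\<rparr> = embed r a (s\<lparr>reg := (reg s)(x := w)\<rparr>)"
  by (auto simp: embed_def fun_eq_iff)

lemma embed_arr_own:
  "x < 4 \<Longrightarrow> (embed r a s)\<lparr>arr := (arr (embed r a s))(x := w)\<rparr> = embed r (a(x := w)) s"
  by (auto simp: embed_def fun_eq_iff)

lemma embed_arr_shift:
  "(embed r a s)\<lparr>arr := (arr (embed r a s))(x + 4 := w)\<rparr> = embed r a (s\<lparr>arr := (arr s)(x := w)\<rparr>)"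
  by (auto simp: embed_def fun_eq_iff)

lemma embed_treg: "(embed r a s)\<lparr>treg := f\<rparr> = embed r a (s\<lparr>treg := f\<rparr>)"
  and embed_tarr: "(embed r a s)\<lparr>tarr := g\<rparr> = embed r a (s\<lparr>tarr := g\<rparr>)"
  by (auto simp: embed_def)

lemma val_shift [simp]:
  "val (embed r a s) (shift_exp e) = val s e"
  "tval (embed r a s) (shift_texp t) = tval s t"
  by (induction e and t) auto

lemma fits_shift [simp]:
  "fits B (embed r a s) (shift_exp e) = fits B s e"
  "tfits B (embed r a s) (shift_texp t) = tfits B s t"
  by (induction e and t) auto

text \<open>Shifted code neither reads nor writes a register or word array below index 4, and the
  memory for reals stays in place, so the simulated program runs undisturbed and with the same
  number of steps inside any \<open>r\<close> and \<open>a\<close>.\<close>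

lemma exec_shift:
  assumes "exec B c s k s'"
  shows "exec B (shift_com c) (embed r a s) k (embed r a s')"
  using assms
proof (induction rule: exec.induct)
  case (Skip s)
  show ?case unfolding shift_com.simps by (rule exec.Skip)
next
  case (Assign s e x)
  then show ?case
    using exec.Assign[of B "embed r a s" "shift_exp e" "x + 4"]
    by (simp add: embed_reg_shift del: embed_sel)
next
  case (Store s i e b)
  have "arr (embed r a s) (b + 4) = arr s b" by simp
  with Store show ?case
    using exec.Store[of B "embed r a s" "shift_exp i" "shift_exp e" "b + 4"]
    by (simp add: embed_arr_shift del: embed_sel)
next
  case (TAssign s t x)
  then show ?case
    using exec.TAssign[of B "embed r a s" "shift_texp t" x] by (simp add: embed_treg)
next
  case (TStore s i t b)
  then show ?case
    using exec.TStore[of B "embed r a s" "shift_exp i" "shift_texp t" b] by (simp add: embed_tarr)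
next
  case (Seq c s k s' c' k' s'')
  then show ?case unfolding shift_com.simps by (intro exec.Seq) simp_all
next
  case (IfTrue s e c k s' c')
  then show ?case unfolding shift_com.simps by (intro exec.IfTrue) simp_all
next
  case (IfFalse s e c' k s' c)
  then show ?case unfolding shift_com.simps by (intro exec.IfFalse) simp_all
next
  case (WhileFalse s e c)
  then show ?case unfolding shift_com.simps by (intro exec.WhileFalse) simp_all
next
  case (WhileTrue s e c k s' k' s'')
  then show ?case unfolding shift_com.simps by (intro exec.WhileTrue) simp_all
qed

section \<open>Word bounds of executions and of answers\<close>

lemma fits_mono:
  "B \<le> B' \<Longrightarrow> fits B s e \<Longrightarrow> fits B' s e"
  "B \<le> B' \<Longrightarrow> tfits B s t \<Longrightarrow> tfits B' s t"
  by (induction e and t) auto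

lemma exec_mono: "exec B c s k s' \<Longrightarrow> B \<le> B' \<Longrightarrow> exec B' c s k s'"
  by (induction rule: exec.induct) (blast intro: exec.intros fits_mono)+

text \<open>Reading memory is not checked by \<open>fits\<close>, so the bound on its contents has
  to be carried along as an invariant.\<close>

definition words_le :: "nat \<Rightarrow> state \<Rightarrow> bool" where
  "words_le B s \<longleftrightarrow> (\<forall>x. reg s x \<le> B) \<and> (\<forall>a x. arr s a x \<le> B)"

lemma val_le: "words_le B s \<Longrightarrow> fits B s e \<Longrightarrow> 1 \<le> B \<Longrightarrow> val s e \<le> B"
  by (cases e) (auto simp: words_le_def)

lemma exec_words_le: "exec B c s k s' \<Longrightarrow> 1 \<le> B \<Longrightarrow> words_le B s \<Longrightarrow> words_le B s'"
proof (induction rule: exec.induct)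
  case (Assign s e x)
  with val_le[of B s e] show ?case by (auto simp: words_le_def)
next
  case (Store s i e a)
  with val_le[of B s e] show ?case by (auto simp: words_le_def)
qed (auto simp: words_le_def)

fun op_program :: "data_structure \<Rightarrow> operation \<Rightarrow> com" where
  "op_program D (Create (Insert u v) t) = create_insertion D"
| "op_program D (Create (Delete u v) t) = create_deletion D"
| "op_program D (Cancel t) = cancel D"
| "op_program D (Query as t) = answer_query D"

fun op_args :: "operation \<Rightarrow> nat list" where
  "op_args (Create (Insert u v) t) = [u, v]"
| "op_args (Create (Delete u v) t) = [u, v]"
| "op_args (Cancel t) = []"
| "op_args (Query as t) = as"

fun op_time :: "operation \<Rightarrow> real" where
  "op_time (Create u t) = t"
| "op_time (Cancel t) = t"
| "op_time (Query as t) = t"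

lemma run_operation_iff:
  "run_operation B D opn s k s' \<longleftrightarrow>
     exec B (op_program D opn) (pass (op_args opn) (op_time opn) s) k s'"
  by (cases opn rule: op_args.cases) simp_all

lemma run_operation_words_le:
  assumes "run_operation B D opn s k s'" "words_le B s" "1 \<le> B" "\<forall>w\<in>set (op_args opn). w \<le> B"
  shows "words_le B s'"
proof -
  have "words_le B (pass (op_args opn) (op_time opn) s)"
    using assms(2,4) by (auto simp: words_le_def pass_def)
  with assms(1,3) show ?thesis
    by (auto simp: run_operation_iff dest: exec_words_le)
qed

text \<open>Acceptable answers may be arbitrarily large (a density need not be in lowest terms), but
  the simulating program has to compute with them. So the size of the returned words is made a part
  of correctness.\<close>

definition bounded_answers :: "nat \<Rightarrow> problem \<Rightarrow> problem" where
  "bounded_answers B P = P\<lparr>answers := \<lambda>n E as x y. answers P n E as x y \<and> x \<le> B \<and> y \<le> B\<rparr>"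

text \<open>The memory starts below the bound, so do the arguments, and no program stores a larger
  number. Hence the returned words are bounded as well, and the same run solves the strengthened
  problem.\<close>

lemma run_operations_bounded_answers:
  assumes "run_operations B D P n S s ops k" "words_le B s" "1 \<le> B"
    "\<forall>opn\<in>set ops. \<forall>w\<in>set (op_args opn). w \<le> B"
  shows "run_operations B D (bounded_answers B P) n S s ops k"
  using assms(1,2,4)
proof (induction rule: run_operations.induct)
  case (Nil S s)
  show ?case by (rule run_operations.Nil)
next
  case (Cons opn s k s' S ops k')
  have bd: "words_le B s'"
    using run_operation_words_le[OF Cons.hyps(1)] Cons.prems \<open>1 \<le> B\<close> by simp
  show ?case
  proof (rule run_operations.Cons)
    show "correct_response (bounded_answers B P) n S opn s'"
      using Cons.hyps(2) bd by (cases opn) (auto simp: words_le_def bounded_answers_def)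
  qed (use Cons bd in auto)
qed

section \<open>Simulating a data structure\<close>

primrec load_args :: "nat \<Rightarrow> exp list \<Rightarrow> com" where
  "load_args k [] = Skip"
| "load_args k (e # es) = Seq (Assign (k + 4) e) (load_args (Suc k) es)"

text \<open>Registers 4, 5, ... are registers 0, 1, ... of the shifted program, and real register 0
  is not shifted; so the code before \<open>shift_com c\<close> has the effect of
  \<open>pass\<close>.\<close>

definition op_com :: "com \<Rightarrow> exp list \<Rightarrow> exp \<Rightarrow> com" where
  "op_com c es t = Seq (load_args 0 es) (Seq (TAssign 0 (OfWord t)) (shift_com c))"

definition for_com :: "nat \<Rightarrow> exp \<Rightarrow> com \<Rightarrow> com" where
  "for_com x bnd c = Seq (Assign x (Const 0))
     (While (Bin Less (Reg x) bnd) (Seq c (Assign x (Bin Add (Reg x) (Const 1)))))"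

text \<open>The value of \<open>e\<close> depends only on the part of the memory that the simulated program cannot see.\<close>

definition computes ::
  "nat \<Rightarrow> (nat \<Rightarrow> nat) \<Rightarrow> (nat \<Rightarrow> nat \<Rightarrow> nat) \<Rightarrow> exp \<Rightarrow> nat \<Rightarrow> bool" where
  "computes B r a e w \<longleftrightarrow> (\<forall>s. fits B (embed r a s) e \<and> val (embed r a s) e = w)"

locale simulation =
  fixes B Bd :: nat and D :: data_structure and P :: problem and N :: nat
  assumes Bd_le: "Bd \<le> B" and B_pos: "1 \<le> B"
begin

text \<open>Loading changes the simulated registers one after another. As \<open>computes\<close>
  quantifies over all simulated states, the expressions that are still to be loaded keep their
  values.\<close>

lemma exec_load_args:
  assumes "list_all2 (computes B r a) es ws"
  shows "exec B (load_args k es) (embed r a s) (length es + 1)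
    (embed r a (s\<lparr>reg := \<lambda>x. if k \<le> x \<and> x < k + length ws then ws ! (x - k) else reg s x\<rparr>))"
  using assms
proof (induction es ws arbitrary: k s rule: list_all2_induct)
  case Nil
  have "(\<lambda>x. if k \<le> x \<and> x < k + length [] then [] ! (x - k) else reg s x) = reg s" by auto
  then show ?case using exec.Skip[of B "embed r a s"] by simp
next
  case (Cons e es w ws)
  have e: "fits B (embed r a s) e" "val (embed r a s) e = w"
    using Cons.hyps(1) by (auto simp: computes_def)
  let ?s = "s\<lparr>reg := (reg s)(k := w)\<rparr>"
  have 1: "exec B (Assign (k + 4) e) (embed r a s) 1 (embed r a ?s)"
    using exec.Assign[OF e(1), of "k + 4"] by (simp only: e embed_reg_shift)
  have "(\<lambda>x. if Suc k \<le> x \<and> x < Suc k + length ws then ws ! (x - Suc k) else reg ?s x)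
     = (\<lambda>x. if k \<le> x \<and> x < k + length (w # ws) then (w # ws) ! (x - k) else reg s x)"
    by (auto simp: fun_eq_iff nth_Cons')
  then have eq: "?s\<lparr>reg := \<lambda>x. if Suc k \<le> x \<and> x < Suc k + length ws then ws ! (x - Suc k) else reg ?s x\<rparr>
     = s\<lparr>reg := \<lambda>x. if k \<le> x \<and> x < k + length (w # ws) then (w # ws) ! (x - k) else reg s x\<rparr>"
    by simp
  show ?case
    using exec.Seq[OF 1 Cons.IH[of "Suc k" ?s]] unfolding eq by simp
qed

lemma exec_op_com:
  assumes "list_all2 (computes B r a) es ws" "computes B r a t \<tau>"
    "exec Bd c (pass ws (real \<tau>) s) k s'"
  shows "exec B (op_com c es t) (embed r a s) (length es + 2 + k) (embed r a s')"
proof -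
  let ?s = "s\<lparr>reg := \<lambda>x. if 0 \<le> x \<and> x < 0 + length ws then ws ! (x - 0) else reg s x\<rparr>"
  have t: "tfits B (embed r a ?s) (OfWord t)" "tval (embed r a ?s) (OfWord t) = real \<tau>"
    using assms(2) by (auto simp: computes_def)
  have eq: "(embed r a ?s)\<lparr>treg := (treg (embed r a ?s))(0 := real \<tau>)\<rparr>
    = embed r a (pass ws (real \<tau>) s)"
    by (auto simp: embed_def pass_def fun_eq_iff)
  have 1: "exec B (TAssign 0 (OfWord t)) (embed r a ?s) 1 (embed r a (pass ws (real \<tau>) s))"
    using exec.TAssign[OF t(1), of 0] unfolding t(2) eq .
  have 2: "exec B (shift_com c) (embed r a (pass ws (real \<tau>) s)) k (embed r a s')"
    by (rule exec_shift[OF exec_mono[OF assms(3) Bd_le]])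
  show ?thesis
    using exec.Seq[OF exec_load_args[OF assms(1)] exec.Seq[OF 1 2]] by (simp add: op_com_def)
qed

text \<open>
  A Hoare triple with a ghost state, the timeline \<open>S\<close> and the remaining run of the data structure,
  from which \<open>c\<close> consumes the operations \<open>ops\<close>.  The time of the remaining run serves as
  potential, so that only the overhead \<open>C\<close> is charged.
\<close>

definition sim :: "com \<Rightarrow> ((nat \<Rightarrow> nat) \<Rightarrow> (nat \<Rightarrow> nat \<Rightarrow> nat) \<Rightarrow> timeline \<Rightarrow> bool) \<Rightarrow>
    operation list \<Rightarrow> nat \<Rightarrow> ((nat \<Rightarrow> nat) \<Rightarrow> (nat \<Rightarrow> nat \<Rightarrow> nat) \<Rightarrow> timeline \<Rightarrow> bool) \<Rightarrow> bool" where
  "sim c Pre ops C Post \<longleftrightarrow> (\<forall>r a S s rest q.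
     Pre r a S \<longrightarrow> run_operations Bd D P N S s (ops @ rest) q \<longrightarrow>
     (\<exists>k r' a' S' s' q'. exec B c (embed r a s) k (embed r' a' s') \<and> Post r' a' S' \<and>
        run_operations Bd D P N S' s' rest q' \<and> k + q' \<le> C + q))"

lemma simI:
  assumes "\<And>r a S s rest q. Pre r a S \<Longrightarrow> run_operations Bd D P N S s (ops @ rest) q \<Longrightarrow>
     \<exists>k r' a' S' s' q'. exec B c (embed r a s) k (embed r' a' s') \<and> Post r' a' S' \<and>
        run_operations Bd D P N S' s' rest q' \<and> k + q' \<le> C + q"
  shows "sim c Pre ops C Post"
  unfolding sim_def by (intro allI impI) (rule assms)

lemma simD:
  assumes "sim c Pre ops C Post" "Pre r a S" "run_operations Bd D P N S s (ops @ rest) q"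
  shows "\<exists>k r' a' S' s' q'. exec B c (embed r a s) k (embed r' a' s') \<and> Post r' a' S' \<and>
    run_operations Bd D P N S' s' rest q' \<and> k + q' \<le> C + q"
  using assms(1)[unfolded sim_def, rule_format, OF assms(2,3)] .

lemma sim_mono: "sim c Pre ops C Post \<Longrightarrow> C \<le> C' \<Longrightarrow> sim c Pre ops C' Post"
  unfolding sim_def by (meson add_le_mono1 le_trans)

lemma sim_skip: "(\<And>r a S. Pre r a S \<Longrightarrow> Post r a S) \<Longrightarrow> sim Skip Pre [] 1 Post"
proof (rule simI)
  fix r a S s rest q
  assume "\<And>r a S. Pre r a S \<Longrightarrow> Post r a S" "Pre r a S" "run_operations Bd D P N S s ([] @ rest) q"
  with exec.Skip[of B "embed r a s"]
  show "\<exists>k r' a' S' s' q'. exec B Skip (embed r a s) k (embed r' a' s') \<and> Post r' a' S' \<and>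
        run_operations Bd D P N S' s' rest q' \<and> k + q' \<le> 1 + q"
    unfolding append_Nil by blast
qed

lemma sim_seq:
  assumes "sim c Pre ops C Mid" "sim c' Mid ops' C' Post"
  shows "sim (Seq c c') Pre (ops @ ops') (C + C') Post"
proof (rule simI)
  fix r a S s rest q
  assume "Pre r a S" and "run_operations Bd D P N S s ((ops @ ops') @ rest) q"
  then have "run_operations Bd D P N S s (ops @ ops' @ rest) q" by simp
  from simD[OF assms(1), OF \<open>Pre r a S\<close> this] obtain k r' a' S' s' q' where 1:
    "exec B c (embed r a s) k (embed r' a' s')" "Mid r' a' S'"
    "run_operations Bd D P N S' s' (ops' @ rest) q'" "k + q' \<le> C + q" by blast
  from simD[OF assms(2), OF 1(2,3)] obtain l r'' a'' S'' s'' q'' where 2: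
    "exec B c' (embed r' a' s') l (embed r'' a'' s'')" "Post r'' a'' S''"
    "run_operations Bd D P N S'' s'' rest q''" "l + q'' \<le> C' + q'" by blast
  have "k + l + q'' \<le> C + C' + q" using 1(4) 2(4) by simp
  with exec.Seq[OF 1(1) 2(1)] 2(2,3)
  show "\<exists>k r' a' S' s' q'. exec B (Seq c c') (embed r a s) k (embed r' a' s') \<and> Post r' a' S' \<and>
        run_operations Bd D P N S' s' rest q' \<and> k + q' \<le> C + C' + q" by blast
qed

lemma sim_assign:
  assumes "x < 4" "\<And>r a S. Pre r a S \<Longrightarrow> \<exists>w. computes B r a e w \<and> Post (r(x := w)) a S"
  shows "sim (Assign x e) Pre [] 1 Post"
proof (rule simI)
  fix r a S s rest q
  assume "Pre r a S" and run: "run_operations Bd D P N S s ([] @ rest) q"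
  then obtain w where w: "computes B r a e w" "Post (r(x := w)) a S" using assms(2) by blast
  then have "exec B (Assign x e) (embed r a s) 1 (embed (r(x := w)) a s)"
    using exec.Assign[of B "embed r a s" e x] embed_reg_own[OF assms(1)]
    by (auto simp: computes_def simp del: embed_sel)
  with w run
  show "\<exists>k r' a' S' s' q'. exec B (Assign x e) (embed r a s) k (embed r' a' s') \<and> Post r' a' S' \<and>
        run_operations Bd D P N S' s' rest q' \<and> k + q' \<le> 1 + q"
    unfolding append_Nil by blast
qed

text \<open>The truth value \<open>b\<close> is fixed beforehand and is not a predicate on states,
  because the consumed operations have to form a definite list.\<close>

lemma sim_if:
  assumes "\<And>r a S. Pre r a S \<Longrightarrow> computes B r a e (of_bool b)"
    "b \<Longrightarrow> sim c Pre ops C Post" "\<not> b \<Longrightarrow> sim c' Pre ops' C Post"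
  shows "sim (If e c c') Pre (if b then ops else ops') (C + 1) Post"
proof (rule simI)
  fix r a S s rest q
  assume pre: "Pre r a S"
    and run: "run_operations Bd D P N S s ((if b then ops else ops') @ rest) q"
  have e: "fits B (embed r a s) e" "val (embed r a s) e = of_bool b"
    using assms(1)[OF pre] by (auto simp: computes_def)
  show "\<exists>k r' a' S' s' q'. exec B (If e c c') (embed r a s) k (embed r' a' s') \<and> Post r' a' S' \<and>
        run_operations Bd D P N S' s' rest q' \<and> k + q' \<le> C + 1 + q"
  proof (cases b)
    case True
    with run have "run_operations Bd D P N S s (ops @ rest) q" by simp
    from simD[OF assms(2)[OF True], OF pre this] obtain k r' a' S' s' q' where 1:
      "exec B c (embed r a s) k (embed r' a' s')" "Post r' a' S'"
      "run_operations Bd D P N S' s' rest q'" "k + q' \<le> C + q" by blast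
    have "exec B (If e c c') (embed r a s) (1 + k) (embed r' a' s')"
      using e True by (intro exec.IfTrue[OF _ _ 1(1)]) auto
    moreover have "1 + k + q' \<le> C + 1 + q" using 1(4) by simp
    ultimately show ?thesis using 1 by blast
  next
    case False
    with run have "run_operations Bd D P N S s (ops' @ rest) q" by simp
    from simD[OF assms(3)[OF False], OF pre this] obtain k r' a' S' s' q' where 1:
      "exec B c' (embed r a s) k (embed r' a' s')" "Post r' a' S'"
      "run_operations Bd D P N S' s' rest q'" "k + q' \<le> C + q" by blast
    have "exec B (If e c c') (embed r a s) (1 + k) (embed r' a' s')"
      using e False by (intro exec.IfFalse[OF _ _ 1(1)]) auto
    moreover have "1 + k + q' \<le> C + 1 + q" using 1(4) by simp
    ultimately show ?thesis using 1 by blast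
  qed
qed

text \<open>The steps of the operation itself are paid by the remaining run, which gets cheaper by
  exactly this number. Only the loading of arguments and time is charged.\<close>

lemma sim_op:
  assumes "\<And>r a S. Pre r a S \<Longrightarrow> list_all2 (computes B r a) es (op_args opn) \<and>
      computes B r a t \<tau> \<and> Post r a (perform opn S)"
    and "op_time opn = real \<tau>" "c = op_program D opn"
  shows "sim (op_com c es t) Pre [opn] (length es + 2) Post"
proof (rule simI)
  fix r a S s rest q
  assume pre: "Pre r a S" and "run_operations Bd D P N S s ([opn] @ rest) q"
  then have "run_operations Bd D P N S s (opn # rest) q" by simp
  then obtain k s' k' where 1: "run_operation Bd D opn s k s'"
    "run_operations Bd D P N (perform opn S) s' rest k'" "q = k + k'"
    by (cases rule: run_operations.cases) auto
  have "exec B (op_com c es t) (embed r a s) (length es + 2 + k) (embed r a s')"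
    using assms(1)[OF pre] 1(1) by (intro exec_op_com) (auto simp: run_operation_iff assms(2,3))
  moreover have "length es + 2 + k + k' \<le> length es + 2 + q" using 1(3) by simp
  ultimately show "\<exists>k r' a' S' s' q'. exec B (op_com c es t) (embed r a s) k (embed r' a' s') \<and>
      Post r' a' S' \<and> run_operations Bd D P N S' s' rest q' \<and> k + q' \<le> length es + 2 + q"
    using 1(2) assms(1)[OF pre] by blast
qed

text \<open>Answers need not be unique, so \<open>out\<close> must evaluate to the same
  \<open>w\<close> for all acceptable contents of the answer registers.\<close>

lemma sim_query:
  assumes "\<And>r a S. Pre r a S \<Longrightarrow> list_all2 (computes B r a) es as \<and>
      computes B r a t \<tau> \<and> computes B r a i j \<and>
      Post r (a(2 := (a 2)(j := w))) S \<and>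
      (\<forall>s. answers P N (graph_at S (real \<tau>)) as (reg s 0) (reg s 1) \<longrightarrow>
         fits B (embed r a s) out \<and> val (embed r a s) out = w)"
  shows "sim (Seq (op_com (answer_query D) es t) (Store 2 i out)) Pre [Query as (real \<tau>)]
    (length es + 3) Post"
proof (rule simI)
  fix r a S s rest q
  assume pre: "Pre r a S" and "run_operations Bd D P N S s ([Query as (real \<tau>)] @ rest) q"
  then have "run_operations Bd D P N S s (Query as (real \<tau>) # rest) q" by simp
  then obtain k s' k' where 1: "exec Bd (answer_query D) (pass as (real \<tau>) s) k s'"
    "answers P N (graph_at S (real \<tau>)) as (reg s' 0) (reg s' 1)"
    "run_operations Bd D P N S s' rest k'" "q = k + k'"
    by (cases rule: run_operations.cases) auto
  have 2: "exec B (op_com (answer_query D) es t) (embed r a s) (length es + 2 + k) (embed r a s')"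
    using assms[OF pre] 1(1) by (intro exec_op_com) auto
  have i: "fits B (embed r a s') i" "val (embed r a s') i = j"
    using assms[OF pre] by (auto simp: computes_def)
  have out: "fits B (embed r a s') out" "val (embed r a s') out = w"
    using assms[OF pre] 1(2) by auto
  have "arr (embed r a s') 2 = a 2" by (simp add: embed_def)
  then have 3: "exec B (Store 2 i out) (embed r a s') 1 (embed r (a(2 := (a 2)(j := w))) s')"
    using exec.Store[OF i(1) out(1), of 2] by (simp only: i out embed_arr_own)
  have "length es + 2 + k + 1 + k' \<le> length es + 3 + q" using 1(4) by simp
  with exec.Seq[OF 2 3] 1(3) assms[OF pre]
  show "\<exists>k r' a' S' s' q'. exec B (Seq (op_com (answer_query D) es t) (Store 2 i out))
       (embed r a s) k (embed r' a' s') \<and>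
      Post r' a' S' \<and> run_operations Bd D P N S' s' rest q' \<and> k + q' \<le> length es + 3 + q"
    by blast
qed

text \<open>A round costs the body, one test and one increment, hence \<open>C + 2\<close>; the
  final 2 pays for the initial assignment and the failing test. By \<open>stable\<close> the
  invariant is insensitive to the counter, whose value is tracked separately.\<close>

lemma sim_for:
  assumes body: "\<And>p. p < L \<Longrightarrow> sim c (\<lambda>r a S. Inv p r a S \<and> r x = p) (F p) C
      (\<lambda>r a S. Inv (Suc p) r a S \<and> r x = p)"
    and stable: "\<And>p r a S w. Inv p r a S \<Longrightarrow> Inv p (r(x := w)) a S"
    and bnd: "\<And>p r a S. Inv p r a S \<Longrightarrow> computes B r a bnd L"
    and "L \<le> B" "x < 4"
  shows "sim (for_com x bnd c) (Inv 0) (concat (map F [0..<L])) (L * (C + 2) + 2) (Inv L)"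
proof -
  let ?b = "Seq c (Assign x (Bin Add (Reg x) (Const 1)))"
  let ?w = "While (Bin Less (Reg x) bnd) ?b"
  have comp: "computes B r a (Bin Less (Reg x) bnd) (of_bool (r x < L))" if "Inv p r a S" for p r a S
    using bnd[OF that] \<open>x < 4\<close> B_pos by (auto simp: computes_def)
  have iter: "sim ?b (\<lambda>r a S. Inv p r a S \<and> r x = p) (F p) (C + 1)
      (\<lambda>r a S. Inv (Suc p) r a S \<and> r x = Suc p)" if "p < L" for p
  proof -
    have "sim (Assign x (Bin Add (Reg x) (Const 1))) (\<lambda>r a S. Inv (Suc p) r a S \<and> r x = p) [] 1
      (\<lambda>r a S. Inv (Suc p) r a S \<and> r x = Suc p)"
      using that \<open>L \<le> B\<close> \<open>x < 4\<close> stable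
      by (intro sim_assign) (auto simp: computes_def)
    from sim_seq[OF body[OF that] this] show ?thesis by simp
  qed
  have loop: "sim ?w (\<lambda>r a S. Inv p r a S \<and> r x = p) (concat (map F [p..<L])) ((L - p) * (C + 2) + 1)
      (Inv L)" if "p \<le> L" for p
    using that
  proof (induction p rule: inc_induct)
    case base
    show ?case
    proof (rule simI)
      fix r a S s rest q
      assume "Inv L r a S \<and> r x = L" and "run_operations Bd D P N S s (concat (map F [L..<L]) @ rest) q"
      moreover from this have "exec B ?w (embed r a s) 1 (embed r a s)"
        using comp[of L r a S] by (intro exec.WhileFalse) (auto simp: computes_def)
      ultimately show "\<exists>k r' a' S' s' q'. exec B ?w (embed r a s) k (embed r' a' s') \<and> Inv L r' a' S' \<and>
        run_operations Bd D P N S' s' rest q' \<and> k + q' \<le> (L - L) * (C + 2) + 1 + q"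
        unfolding upt_rec[of L L] by (simp del: One_nat_def) blast
    qed
  next
    case (step p)
    show ?case
    proof (rule simI)
      fix r a S s rest q
      assume pre: "Inv p r a S \<and> r x = p"
        and run: "run_operations Bd D P N S s (concat (map F [p..<L]) @ rest) q"
      have "concat (map F [p..<L]) = F p @ concat (map F [Suc p..<L])"
        using \<open>p < L\<close> by (simp add: upt_conv_Cons)
      with run have "run_operations Bd D P N S s (F p @ concat (map F [Suc p..<L]) @ rest) q" by simp
      from simD[OF iter[OF \<open>p < L\<close>], OF pre this] obtain k r' a' S' s' q' where 1:
        "exec B ?b (embed r a s) k (embed r' a' s')" "Inv (Suc p) r' a' S' \<and> r' x = Suc p"
        "run_operations Bd D P N S' s' (concat (map F [Suc p..<L]) @ rest) q'" "k + q' \<le> C + 1 + q"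
        by blast
      from simD[OF step.IH, OF 1(2,3)] obtain l r'' a'' S'' s'' q'' where 2:
        "exec B ?w (embed r' a' s') l (embed r'' a'' s'')" "Inv L r'' a'' S''"
        "run_operations Bd D P N S'' s'' rest q''"
        "l + q'' \<le> (L - Suc p) * (C + 2) + 1 + q'" by blast
      have "exec B ?w (embed r a s) (1 + k + l) (embed r'' a'' s'')"
        using comp[of p r a S] pre \<open>p < L\<close>
        by (intro exec.WhileTrue[OF _ _ 1(1) 2(1)]) (auto simp: computes_def)
      moreover have "L - p = Suc (L - Suc p)" using \<open>p < L\<close> by simp
      then have "1 + k + l + q'' \<le> (L - p) * (C + 2) + 1 + q" using 1(4) 2(4) by simp
      ultimately show "\<exists>k r' a' S' s' q'. exec B ?w (embed r a s) k (embed r' a' s') \<and> Inv L r' a' S' \<and>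
        run_operations Bd D P N S' s' rest q' \<and> k + q' \<le> (L - p) * (C + 2) + 1 + q"
        using 2(2,3) by blast
    qed
  qed
  have "sim (Assign x (Const 0)) (Inv 0) [] 1 (\<lambda>r a S. Inv 0 r a S \<and> r x = 0)"
    using stable \<open>x < 4\<close> by (intro sim_assign) (auto simp: computes_def)
  from sim_seq[OF this loop[of 0]] show ?thesis
    unfolding for_com_def by (simp add: add.commute)
qed

end

section \<open>Timelines with integral times\<close>

definition of_slots :: "(nat \<Rightarrow> update option) \<Rightarrow> timeline" where
  "of_slots f t = (if t \<in> \<nat> then f (nat \<lfloor>t\<rfloor>) else None)"

primrec graph_before :: "(nat \<Rightarrow> update option) \<Rightarrow> nat \<Rightarrow> nat set set" where
  "graph_before f 0 = {}"
| "graph_before f (Suc k) = (case f k of None \<Rightarrow> graph_before f k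
     | Some u \<Rightarrow> apply_update u (graph_before f k))"

lemma of_slots_real [simp]: "of_slots f (real k) = f k"
  by (simp add: of_slots_def)

lemma of_slots_upd: "(of_slots f)(real k := x) = of_slots (f(k := x))"
  by (auto simp: of_slots_def fun_eq_iff elim!: Nats_cases)

lemma dom_of_slots: "dom (of_slots f) = real ` {k. f k \<noteq> None}"
  by (auto simp: of_slots_def dom_def elim!: Nats_cases split: if_splits)

text \<open>By induction on time: the next slot appends at most one element to the end of the sorted
  list of times.\<close>

lemma replay_of_slots: "replay (of_slots f) {..<real k} = graph_before f k"
proof (induction k)
  case 0
  have "dom (of_slots f) \<inter> {..<real 0} = {}" by (auto simp: dom_of_slots)
  then show ?case by (simp add: replay_def)
next
  case (Suc k)
  let ?A = "\<lambda>k. dom (of_slots f) \<inter> {..<real k}"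
  have fin: "finite (?A k)" for k
    by (rule finite_subset[of _ "real ` {..<k}"]) (auto simp: dom_of_slots)
  have step: "?A (Suc k) = ?A k \<union> (if f k = None then {} else {real k})"
    by (auto simp: dom_of_slots less_Suc_eq simp del: of_nat_Suc)
  have "sorted_list_of_set (?A (Suc k)) = sorted_list_of_set (?A k) @ (if f k = None then [] else [real k])"
  proof (rule sorted_distinct_set_unique)
    show "set (sorted_list_of_set (?A (Suc k)))
        = set (sorted_list_of_set (?A k) @ (if f k = None then [] else [real k]))"
      unfolding set_append set_sorted_list_of_set[OF fin] by (subst step) simp
  qed (use fin in \<open>auto simp: sorted_append simp del: lessThan_Suc\<close>)
  with Suc show ?case by (auto simp: replay_def)
qed

lemma graph_at_of_slots: "graph_at (of_slots f) (real k) = graph_before f (Suc k)"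
proof -
  have "dom (of_slots f) \<inter> {..real k} = dom (of_slots f) \<inter> {..<real (Suc k)}"
    by (auto simp: dom_of_slots)
  then show ?thesis using replay_of_slots[of f "Suc k"] by (simp only: replay_def)
qed

lemma legal_of_slots:
  assumes "\<And>k. L \<le> k \<Longrightarrow> f k = None"
    "\<And>k u. f k = Some u \<Longrightarrow> legal_update n u (graph_before f k)"
  shows "legal_timeline n (of_slots f)"
proof -
  have "{k. f k \<noteq> None} \<subseteq> {..<L}"
  proof
    fix k assume "k \<in> {k. f k \<noteq> None}"
    then show "k \<in> {..<L}" using assms(1)[of k] by (cases "k < L") simp_all
  qed
  then have "finite {k. f k \<noteq> None}" by (rule finite_subset) simp
  then have "finite (dom (of_slots f))" by (simp add: dom_of_slots)
  moreover have "legal_update n (the (of_slots f t)) (replay (of_slots f) {..<t})"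
    if "t \<in> dom (of_slots f)" for t
  proof -
    from that obtain k u where "t = real k" "f k = Some u" by (auto simp: dom_of_slots)
    with assms(2)[of k u] show ?thesis by (simp add: replay_of_slots)
  qed
  ultimately show ?thesis by (simp add: legal_timeline_def)
qed

lemma legal_operations_append:
  "legal_operations P n S (xs @ ys) \<longleftrightarrow>
     legal_operations P n S xs \<and> legal_operations P n (fold perform xs S) ys"
  by (induction xs arbitrary: S) auto

lemma legal_operations_concat:
  assumes "\<And>k. k < L \<Longrightarrow> legal_operations P n (S k) (F k) \<and> fold perform (F k) (S k) = S (Suc k)"
  shows "legal_operations P n (S 0) (concat (map F [0..<L])) \<and>
    fold perform (concat (map F [0..<L])) (S 0) = S L"
  using assms by (induction L) (auto simp: legal_operations_append)

section \<open>Encoding a matrix in a timeline\<close>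

text \<open>
  The vertices of the edge of column \<open>j\<close> are \<open>va b j\<close> and \<open>vb b j\<close>, where \<open>b\<close> is the bit of the
  vector, and this edge is inserted at time \<open>j\<close> if \<open>gv b\<close>.  Column \<open>n\<close> always has the bit \<open>False\<close>.
  Row \<open>i\<close> of the matrix takes up \<open>2 * n\<close> time slots: the \<open>j\<close>-th one inserts the edge of
  \<open>(i, j)\<close> if \<open>gr (M i j)\<close>.  The \<open>(n + j)\<close>-th one deletes this edge again,
  or, if \<open>inc\<close> holds, inserts it if this has not been done before.
\<close>

locale layout =
  fixes n N :: nat and M :: "nat \<Rightarrow> nat \<Rightarrow> bool"
    and ra rb :: "nat \<Rightarrow> nat \<Rightarrow> nat" and va vb :: "bool \<Rightarrow> nat \<Rightarrow> nat"
    and gr gv :: "bool \<Rightarrow> bool" and inc :: bool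
begin

definition vbit :: "(nat \<Rightarrow> bool) \<Rightarrow> nat \<Rightarrow> bool" where
  "vbit v j \<longleftrightarrow> j < n \<and> v j"

definition col_edge :: "(nat \<Rightarrow> bool) \<Rightarrow> nat \<Rightarrow> nat set" where
  "col_edge v j = {va (vbit v j) j, vb (vbit v j) j}"

definition cell_edge :: "nat \<Rightarrow> nat \<Rightarrow> nat set" where
  "cell_edge i j = {ra i j, rb i j}"

definition query_graph :: "(nat \<Rightarrow> bool) \<Rightarrow> nat \<Rightarrow> nat set set" where
  "query_graph v i = {col_edge v j | j. j \<le> n \<and> gv (vbit v j)} \<union>
     {cell_edge i' j | i' j. j < n \<and> (i' = i \<and> gr (M i j) \<or> inc \<and> i' < i)}"

definition row_slot :: "nat \<Rightarrow> update option" where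
  "row_slot q = (let i = q div (2 * n); j = q mod n in
     if even (q div n) then (if gr (M i j) then Some (Insert (ra i j) (rb i j)) else None)
     else if inc then (if gr (M i j) then None else Some (Insert (ra i j) (rb i j)))
     else (if gr (M i j) then Some (Delete (ra i j) (rb i j)) else None))"

text \<open>\<open>J\<close> is the set of columns currently present and \<open>p\<close> the number
  of row slots treated so far. Every timeline that occurs during the algorithm has this form, so
  legality needs to be proved only once. Columns use the times up to \<open>n\<close>, rows start at
  \<open>n + 1\<close>.\<close>

definition slot :: "(nat \<Rightarrow> bool) \<Rightarrow> nat set \<Rightarrow> nat \<Rightarrow> nat \<Rightarrow> update option" where
  "slot v J p k =
     (if k \<le> n then
        (if k \<in> J \<and> gv (vbit v k) then Some (Insert (va (vbit v k) k) (vb (vbit v k) k)) else None)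
      else if k - Suc n < p then row_slot (k - Suc n) else None)"

text \<open>The argument \<open>q\<close> means that exactly the row slots below \<open>q\<close>
  have been replayed; hence the insertion slot is compared strictly and the deletion slot
  weakly.\<close>

definition alive :: "nat \<Rightarrow> nat \<Rightarrow> nat \<Rightarrow> bool" where
  "alive i j q \<longleftrightarrow>
     (if inc then (if gr (M i j) then 2 * n * i + j < q else 2 * n * i + n + j < q)
      else gr (M i j) \<and> 2 * n * i + j < q \<and> q \<le> 2 * n * i + n + j)"

definition slot_timeline :: "(nat \<Rightarrow> bool) \<Rightarrow> nat set \<Rightarrow> nat \<Rightarrow> timeline" where
  "slot_timeline v J p = of_slots (slot v J p)"

definition cells :: "nat \<Rightarrow> nat set set" where
  "cells q = {cell_edge i j | i j. i < n \<and> j < n \<and> alive i j q}"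

definition cols :: "(nat \<Rightarrow> bool) \<Rightarrow> nat set \<Rightarrow> nat \<Rightarrow> nat set set" where
  "cols v J k = {col_edge v j | j. j < k \<and> j \<in> J \<and> gv (vbit v j)}"

end

text \<open>Where a row is deleted at the end of its interval, other rows may reuse its edges;
  therefore \<open>cell_inj\<close> compares different rows only if \<open>inc\<close> holds. Column
  edges, in contrast, coexist with all rows.\<close>

locale legal_layout = layout +
  assumes n_pos: "1 \<le> n"
    and cell_vertex: "\<And>i j. i < n \<Longrightarrow> j < n \<Longrightarrow> ra i j < N \<and> rb i j < N \<and> ra i j \<noteq> rb i j"
    and col_vertex: "\<And>b j. j \<le> n \<Longrightarrow> va b j < N \<and> vb b j < N \<and> va b j \<noteq> vb b j"
    and cell_inj: "\<And>i j i' j'. i < n \<Longrightarrow> j < n \<Longrightarrow> i' < n \<Longrightarrow> j' < n \<Longrightarrow> inc \<or> i = i' \<Longrightarrow>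
       {ra i j, rb i j} = {ra i' j', rb i' j'} \<Longrightarrow> i = i' \<and> j = j'"
    and col_inj: "\<And>b j b' j'. j \<le> n \<Longrightarrow> j' \<le> n \<Longrightarrow> {va b j, vb b j} = {va b' j', vb b' j'} \<Longrightarrow> j = j'"
    and col_cell: "\<And>b l i j. l \<le> n \<Longrightarrow> i < n \<Longrightarrow> j < n \<Longrightarrow> {va b l, vb b l} \<noteq> {ra i j, rb i j}"
begin

lemma slot_coordinates:
  assumes "q < 2 * (n * n)"
  obtains i h j where "i < n" "j < n" "h < 2" "q = 2 * n * i + n * h + j"
    "q div (2 * n) = i" "q div n mod 2 = h" "q mod n = j"
proof
  show "q div (2 * n) < n" using assms n_pos by (simp add: less_mult_imp_div_less mult.assoc)
  show "q mod n < n" "q div n mod 2 < 2" using n_pos by auto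
  have "q = n * (q div n) + q mod n" by simp
  also have "q div n = 2 * (q div (2 * n)) + q div n mod 2"
    by (metis mult_div_mod_eq div_mult2_eq mult.commute)
  finally show "q = 2 * n * (q div (2 * n)) + n * (q div n mod 2) + q mod n"
    by (simp add: algebra_simps)
qed auto

lemma slot_unique:
  assumes "2 * n * i + n * h + j = 2 * n * i' + n * h' + j'" "j < n" "j' < n" "h < 2" "h' < 2"
  shows "i = i' \<and> h = h' \<and> j = j'"
proof -
  have 1: "2 * n * i + n * h + j = n * (2 * i + h) + j" "2 * n * i' + n * h' + j' = n * (2 * i' + h') + j'"
    by (simp_all add: algebra_simps)
  have j: "j = j'" using arg_cong[OF assms(1), of "\<lambda>x. x mod n"] assms(2,3) unfolding 1 by simp
  have "2 * i + h = 2 * i' + h'" using assms(1) j n_pos unfolding 1 by simp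
  with assms(4,5) j show ?thesis by presburger
qed

text \<open>A slot number determines its cell, so passing slot \<open>q\<close> can change the
  status of one cell only.\<close>

lemma alive_other:
  assumes "q = 2 * n * i + n * h + j" "j < n" "h < 2" "j' < n" "(i', j') \<noteq> (i, j)"
  shows "alive i' j' (Suc q) = alive i' j' q"
proof -
  have "q \<noteq> 2 * n * i' + n * 0 + j'" "q \<noteq> 2 * n * i' + n * 1 + j'"
    using slot_unique[of i h j i' 0 j'] slot_unique[of i h j i' 1 j'] assms by auto
  then show ?thesis by (auto simp: alive_def less_Suc_eq Suc_le_eq)
qed

text \<open>With deletions a cell is alive only within the \<open>2 * n\<close> slots of its own
  row, so an edge alive at a slot of row \<open>i\<close> belongs to row \<open>i\<close>. Within a
  row, and with \<open>inc\<close> throughout, different cells have different edges.\<close>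

lemma alive_same_edge:
  assumes "q = 2 * n * i + n * h + j" "i < n" "j < n" "h < 2" "i' < n" "j' < n"
    "alive i' j' q" "cell_edge i' j' = cell_edge i j"
  shows "(i', j') = (i, j)"
proof -
  have "inc \<or> i' = i"
  proof (rule disjCI)
    assume "i' \<noteq> i"
    show inc
    proof (rule ccontr)
      assume "\<not> inc"
      then have *: "2 * n * i' + j' < q" "q \<le> 2 * n * i' + n + j'" using assms(7) unfolding alive_def by simp_all
      have q: "2 * n * i \<le> q" "q < 2 * n * Suc i"
      proof -
        have "n * h + j < 2 * n" using assms(3,4) by (cases h) auto
        then show "2 * n * i \<le> q" "q < 2 * n * Suc i" using assms(1) by auto
      qed
      have "2 * n * i' < 2 * n * Suc i" "2 * n * i < 2 * n * Suc i'" using * q assms(6) by auto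
      then have "i' < Suc i" "i < Suc i'" using n_pos by (simp_all only: nat_mult_less_cancel1) 
      with \<open>i' \<noteq> i\<close> show False by simp
    qed
  qed
  then show ?thesis using cell_inj[of i' j' i j] assms(2,3,5,6,8) by (auto simp: cell_edge_def)
qed

text \<open>Slot \<open>q\<close> affects a single cell, whose edge is carried by no other living
  cell, so inserting or deleting the edge is legal and has no side effect. \<open>V\<close> stands
  for the column edges.\<close>

lemma cells_step:
  assumes "q < 2 * (n * n)" "\<And>i j. i < n \<Longrightarrow> j < n \<Longrightarrow> cell_edge i j \<notin> V"
  shows "case row_slot q of None \<Rightarrow> cells (Suc q) = cells q
    | Some u \<Rightarrow> legal_update N u (V \<union> cells q) \<and> V \<union> cells (Suc q) = apply_update u (V \<union> cells q)"
proof -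
  obtain i h j where c: "i < n" "j < n" "h < 2" "q = 2 * n * i + n * h + j"
    "q div (2 * n) = i" "q div n mod 2 = h" "q mod n = j"
    using slot_coordinates[OF assms(1)] by metis
  have h: "even (q div n) \<longleftrightarrow> h = 0" using c(6) by (simp add: even_iff_mod_2_eq_zero)
  have slot: "row_slot q = (if h = 0 then (if gr (M i j) then Some (Insert (ra i j) (rb i j)) else None)
     else if inc then (if gr (M i j) then None else Some (Insert (ra i j) (rb i j)))
     else (if gr (M i j) then Some (Delete (ra i j) (rb i j)) else None))"
    by (simp add: row_slot_def h c(5,7))
  let ?A = "\<lambda>q. {(i', j'). i' < n \<and> j' < n \<and> alive i' j' q}"
  let ?O = "case_prod cell_edge ` (?A q - {(i, j)})"
  have split: "cells q' = ?O \<union> (if alive i j q' then {cell_edge i j} else {})" if "q' \<in> {q, Suc q}" for q'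
  proof -
    have same: "alive i' j' q' = alive i' j' q" if "j' < n" "(i', j') \<noteq> (i, j)" for i' j'
      using alive_other[OF c(4,2,3) that] \<open>q' \<in> {q, Suc q}\<close> by auto
    have "?A q' = (?A q - {(i, j)}) \<union> (if alive i j q' then {(i, j)} else {})"
    proof (rule set_eqI)
      fix x :: "nat \<times> nat"
      obtain i' j' where x: "x = (i', j')" by fastforce
      show "x \<in> ?A q' \<longleftrightarrow> x \<in> (?A q - {(i, j)}) \<union> (if alive i j q' then {(i, j)} else {})"
        using same[of j' i'] c(1,2) unfolding x by (cases "(i', j') = (i, j)") auto
    qed
    moreover have "cells q' = case_prod cell_edge ` ?A q'" by (auto simp: cells_def)
    ultimately show ?thesis by (simp only: image_Un) simp
  qed
  have notin: "cell_edge i j \<notin> ?O"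
  proof
    assume "cell_edge i j \<in> ?O"
    then obtain i' j' where "i' < n" "j' < n" "alive i' j' q" "(i', j') \<noteq> (i, j)"
      "cell_edge i' j' = cell_edge i j" by auto
    with alive_same_edge[OF c(4,1,2,3)] show False by blast
  qed
  have V: "cell_edge i j \<notin> V" using assms(2) c(1,2) by blast
  have verts: "ra i j < N" "rb i j < N" "ra i j \<noteq> rb i j" using cell_vertex c(1,2) by auto
  have h01: "h = 0 \<or> h = 1" using c(3) by auto
  \<comment> \<open>With \<open>h = 0\<close> the first slot of the cell is just being passed, with
    \<open>h = 1\<close> the second. After the second slot the edge is gone or, with
    \<open>inc\<close>, present in any case.\<close>
  have now: "alive i j q \<longleftrightarrow> gr (M i j) \<and> h = 1"
    "alive i j (Suc q) \<longleftrightarrow> (if h = 0 then gr (M i j) else inc)"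
    using h01 n_pos c(4) by (auto simp: alive_def)
  show ?thesis
    unfolding slot split[of q, simplified] split[of "Suc q", simplified] now
    using notin V verts h01 by (auto simp: cell_edge_def[symmetric])
qed

lemma cols_Suc: "cols v J (Suc k) = cols v J k \<union> (if k \<in> J \<and> gv (vbit v k) then {col_edge v k} else {})"
  by (auto simp: cols_def less_Suc_eq)

lemma graph_before_col: "k \<le> Suc n \<Longrightarrow> graph_before (slot v J p) k = cols v J k"
  by (induction k) (auto simp: cols_Suc slot_def col_edge_def cols_def[of v J 0])

lemma cell_notin_cols: "i < n \<Longrightarrow> j < n \<Longrightarrow> cell_edge i j \<notin> cols v J (Suc n)"
  using col_cell[of _ i j] by (auto simp: cols_def cell_edge_def col_edge_def less_Suc_eq_le)

lemma graph_before_cell: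
  assumes "q \<le> p" "p \<le> 2 * (n * n)"
  shows "graph_before (slot v J p) (Suc n + q) = cols v J (Suc n) \<union> cells q"
  using assms(1)
proof (induction q)
  case 0
  have "cells 0 = {}" by (auto simp: cells_def alive_def)
  then show ?case using graph_before_col[of "Suc n"] by simp
next
  case (Suc q)
  have "slot v J p (Suc n + q) = row_slot q" using Suc by (simp add: slot_def)
  moreover have "q < 2 * (n * n)" using Suc assms(2) by simp
  note cells_step[OF this cell_notin_cols[of _ _ v J]]
  ultimately show ?case using Suc by (auto split: option.splits)
qed

text \<open>The set \<open>J\<close> is arbitrary: column edges differ from each other and from all
  cells, so no update depends on which of them are present. This is what allows them to be created
  and cancelled before existing updates.\<close>

lemma legal_timeline_slots:
  assumes "p \<le> 2 * (n * n)"
  shows "legal_timeline N (slot_timeline v J p)"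
  unfolding slot_timeline_def
proof (rule legal_of_slots)
  show "slot v J p k = None" if "Suc n + p \<le> k" for k using that by (auto simp: slot_def)
  fix k u assume k: "slot v J p k = Some u"
  show "legal_update N u (graph_before (slot v J p) k)"
  proof (cases "k \<le> n")
    case True
    with k have u: "u = Insert (va (vbit v k) k) (vb (vbit v k) k)" by (auto simp: slot_def split: if_splits)
    have "{va (vbit v k) k, vb (vbit v k) k} \<notin> cols v J k"
    proof
      assume "{va (vbit v k) k, vb (vbit v k) k} \<in> cols v J k"
      then obtain l where "l < k" "{va (vbit v k) k, vb (vbit v k) k} = {va (vbit v l) l, vb (vbit v l) l}"
        unfolding cols_def col_edge_def by blast
      with col_inj[OF True, of l "vbit v k" "vbit v l"] True show False by simp
    qed
    then show ?thesis using col_vertex[OF True] True u by (simp add: graph_before_col)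
  next
    case False
    then obtain q where q: "k = Suc n + q" by (metis not_less_eq_eq le_Suc_ex)
    with k have "q < p" "row_slot q = Some u" by (auto simp: slot_def split: if_splits)
    with assms cells_step[OF _ cell_notin_cols, of q] show ?thesis
      by (auto simp: q graph_before_cell simp del: add_Suc)
  qed
qed

text \<open>The times up to \<open>2 * n * Suc i\<close> comprise the \<open>n + 1\<close> column
  slots and the first \<open>2 * n * i + n\<close> row slots. The query thus comes exactly after the
  first half of row \<open>i\<close>, before anything of this row is deleted or completed.\<close>

lemma graph_at_timeline:
  assumes "i < n"
  shows "graph_at (slot_timeline v {..<Suc n} (2 * (n * n))) (real (2 * n * Suc i)) = query_graph v i"
proof -
  have "Suc (2 * n * Suc i) = Suc n + (2 * n * i + n)" by simp
  moreover have "2 * n * i + n \<le> 2 * (n * n)"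
  proof -
    have "2 * n * i + n \<le> 2 * n * Suc i" by simp
    also have "\<dots> \<le> 2 * n * n" using assms by (intro mult_le_mono2) simp
    finally show ?thesis by simp
  qed
  ultimately have *: "graph_at (slot_timeline v {..<Suc n} (2 * (n * n))) (real (2 * n * Suc i))
     = cols v {..<Suc n} (Suc n) \<union> cells (2 * n * i + n)"
    unfolding slot_timeline_def graph_at_of_slots by (simp only: graph_before_cell order_refl)
  have "cols v {..<Suc n} (Suc n) = {col_edge v j | j. j \<le> n \<and> gv (vbit v j)}"
    by (auto simp: cols_def less_Suc_eq_le)
  moreover have "i' < n \<and> j < n \<and> alive i' j (2 * n * i + n) \<longleftrightarrow>
    j < n \<and> (i' = i \<and> gr (M i j) \<or> inc \<and> i' < i)" for i' j
  proof (cases "j < n")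
    case True
    consider "i' < i" | "i' = i" | "i < i'" by linarith
    then show ?thesis
    proof cases
      case 1
      then have "2 * n * Suc i' \<le> 2 * n * i" by (intro mult_le_mono2) simp
      then show ?thesis using 1 True assms n_pos by (auto simp: alive_def)
    next
      case 2
      then show ?thesis using True assms by (auto simp: alive_def)
    next
      case 3
      then have "2 * n * Suc i \<le> 2 * n * i'" by (intro mult_le_mono2) simp
      then show ?thesis using 3 True n_pos by (auto simp: alive_def)
    qed
  qed simp
  then have "cells (2 * n * i + n) =
    {cell_edge i' j | i' j. j < n \<and> (i' = i \<and> gr (M i j) \<or> inc \<and> i' < i)}"
    unfolding cells_def by simp
  ultimately show ?thesis unfolding * query_graph_def by simp
qed

end

section \<open>Operations\<close>

context layout
begin

definition row_op :: "nat \<Rightarrow> operation list" where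
  "row_op q = (case row_slot q of None \<Rightarrow> [] | Some u \<Rightarrow> [Create u (real (Suc n + q))])"

definition col_op :: "(nat \<Rightarrow> bool) \<Rightarrow> nat \<Rightarrow> operation list" where
  "col_op v j =
     (if gv (vbit v j) then [Create (Insert (va (vbit v j) j) (vb (vbit v j) j)) (real j)] else [])"

definition uncol_op :: "(nat \<Rightarrow> bool) \<Rightarrow> nat \<Rightarrow> operation list" where
  "uncol_op v j = (if gv (vbit v j) then [Cancel (real j)] else [])"

definition query_op :: "nat list \<Rightarrow> nat \<Rightarrow> operation list" where
  "query_op as i = [Query as (real (2 * n * Suc i))]"

definition matrix_ops :: "operation list" where
  "matrix_ops = concat (map row_op [0..<2 * (n * n)])"

definition round_ops :: "nat list \<Rightarrow> (nat \<Rightarrow> bool) \<Rightarrow> operation list" where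
  "round_ops as v = concat (map (col_op v) [0..<Suc n]) @ concat (map (query_op as) [0..<n]) @
     concat (map (uncol_op v) [0..<Suc n])"

definition matrix_timeline :: timeline where
  "matrix_timeline = slot_timeline (\<lambda>_. False) {} (2 * (n * n))"

lemma slot_timeline_empty: "slot_timeline v {} p = slot_timeline v' {} p"
proof -
  have "slot v {} p = slot v' {} p" by (auto simp: slot_def fun_eq_iff)
  then show ?thesis by (simp add: slot_timeline_def)
qed

lemma slot_timeline_0: "slot_timeline v {} 0 = Map.empty"
proof -
  have "slot v {} 0 = (\<lambda>_. None)" by (auto simp: slot_def fun_eq_iff)
  then show ?thesis by (simp add: slot_timeline_def of_slots_def fun_eq_iff)
qed

lemma slot_timeline_cong:
  "(\<And>j. j \<le> n \<Longrightarrow> j \<in> J \<longleftrightarrow> j \<in> J') \<Longrightarrow> slot_timeline v J p = slot_timeline v J' p"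
proof -
  assume "\<And>j. j \<le> n \<Longrightarrow> j \<in> J \<longleftrightarrow> j \<in> J'"
  then have "slot v J p = slot v J' p" by (simp add: slot_def fun_eq_iff)
  then show ?thesis by (simp add: slot_timeline_def)
qed

lemma slot_timeline_all: "slot_timeline v {0..} p = slot_timeline v {..<Suc n} p"
  by (rule slot_timeline_cong) auto

lemma slot_timeline_none: "slot_timeline v {Suc n..} p = slot_timeline v' {} p"
  using slot_timeline_cong[of "{Suc n..}" "{}" v p] slot_timeline_empty by auto

lemma perform_row_op:
  "fold perform (row_op q) (slot_timeline v {} q) = slot_timeline v {} (Suc q)"
proof -
  have "slot v {} (Suc q) = (slot v {} q)(Suc n + q := row_slot q)"
    by (auto simp: slot_def fun_eq_iff)
  then have "slot_timeline v {} (Suc q) = (slot_timeline v {} q)(real (Suc n + q) := row_slot q)"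
    by (simp only: slot_timeline_def of_slots_upd)
  moreover have "slot_timeline v {} q (real (Suc n + q)) = None"
    unfolding slot_timeline_def of_slots_real by (simp add: slot_def)
  ultimately show ?thesis by (auto simp: row_op_def fun_upd_idem split: option.split)
qed

lemma perform_col_op:
  assumes "j \<le> n"
  shows "fold perform (col_op v j) (slot_timeline v {..<j} p) = slot_timeline v {..<Suc j} p"
proof -
  have "slot v {..<Suc j} p = (slot v {..<j} p)(j := slot v UNIV p j)"
    using assms by (auto simp: slot_def fun_eq_iff)
  then have "slot_timeline v {..<Suc j} p = (slot_timeline v {..<j} p)(real j := slot v UNIV p j)"
    by (simp only: slot_timeline_def of_slots_upd)
  moreover have "slot_timeline v {..<j} p (real j) = None"
    unfolding slot_timeline_def of_slots_real using assms by (simp add: slot_def)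
  ultimately show ?thesis using assms by (simp add: col_op_def slot_def fun_upd_idem)
qed

lemma perform_uncol_op:
  assumes "j \<le> n"
  shows "fold perform (uncol_op v j) (slot_timeline v {j..} p) = slot_timeline v {Suc j..} p"
proof -
  have "slot v {Suc j..} p = (slot v {j..} p)(j := None)"
    using assms by (auto simp: slot_def fun_eq_iff)
  then have "slot_timeline v {Suc j..} p = (slot_timeline v {j..} p)(real j := None)"
    by (simp only: slot_timeline_def of_slots_upd)
  moreover have "slot_timeline v {j..} p (real j) = None" if "\<not> gv (vbit v j)"
    unfolding slot_timeline_def of_slots_real using assms that by (simp add: slot_def)
  ultimately show ?thesis by (simp add: uncol_op_def fun_upd_idem)
qed

lemma length_matrix_ops: "length matrix_ops \<le> 2 * (n * n)"
proof -
  have "length (concat (map row_op [0..<k])) \<le> k" for k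
    by (induction k) (auto simp: row_op_def split: option.split)
  then show ?thesis by (simp add: matrix_ops_def)
qed

lemma length_round_ops: "length (round_ops as v) \<le> 3 * n + 2"
proof -
  have "length (concat (map (col_op v) [0..<k])) \<le> k" for k
    by (induction k) (auto simp: col_op_def)
  note 1 = this[of "Suc n"]
  have "length (concat (map (uncol_op v) [0..<k])) \<le> k" for k
    by (induction k) (auto simp: uncol_op_def)
  note 2 = this[of "Suc n"]
  have "length (concat (map (query_op as) [0..<k])) \<le> k" for k
    by (induction k) (auto simp: query_op_def)
  note 3 = this[of n]
  show ?thesis unfolding round_ops_def length_append using 1 2 3 by linarith
qed

lemma length_rounds:
  "length (concat (map (round_ops as) vs)) \<le> length vs * (3 * n + 2)"
proof (induction vs)
  case (Cons v vs)
  with length_round_ops[of as v] show ?case by simp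
qed simp

end

section \<open>Legality of the complete operation sequence\<close>

context legal_layout
begin

lemma legal_matrix_ops:
  assumes "inc \<or> deletions_allowed P"
  shows "legal_operations P N Map.empty matrix_ops \<and>
    fold perform matrix_ops Map.empty = matrix_timeline"
proof -
  have "legal_operations P N (slot_timeline (\<lambda>_. False) {} q) (row_op q) \<and>
    fold perform (row_op q) (slot_timeline (\<lambda>_. False) {} q) = slot_timeline (\<lambda>_. False) {} (Suc q)"
    if "q < 2 * (n * n)" for q
  proof -
    have "legal_operations P N (slot_timeline (\<lambda>_. False) {} q) (row_op q)"
    proof (cases "row_slot q")
      case (Some u)
      then have op: "row_op q = [Create u (real (Suc n + q))]" by (simp add: row_op_def)
      have "deletions_allowed P \<or> (\<exists>x y. u = Insert x y)"
        using assms Some by (auto simp: row_slot_def Let_def split: if_splits)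
      moreover have "slot_timeline (\<lambda>_. False) {} q (real (Suc n + q)) = None"
        unfolding slot_timeline_def of_slots_real by (simp add: slot_def)
      moreover have "legal_timeline N (slot_timeline (\<lambda>_. False) {} (Suc q))"
        using that by (intro legal_timeline_slots) simp
      ultimately show ?thesis
        using perform_row_op[of q "\<lambda>_. False"] unfolding op by (simp del: of_nat_add of_nat_Suc)
    qed (simp add: row_op_def)
    then show ?thesis using perform_row_op by blast
  qed
  from legal_operations_concat[of "2 * (n * n)" P N "\<lambda>q. slot_timeline (\<lambda>_. False) {} q" row_op, OF this]
  show ?thesis by (simp only: matrix_ops_def matrix_timeline_def slot_timeline_0)
qed

text \<open>Creation and cancellation both go through the columns upwards, so \<open>J\<close> runs
  through the initial segments \<open>{..<j}\<close> and then through the final segments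
  \<open>{j..}\<close>. The round ends in the timeline in which it began and can be
  repeated.\<close>

lemma legal_round_ops:
  assumes "as \<in> arguments P N"
  shows "legal_operations P N matrix_timeline (round_ops as v) \<and>
    fold perform (round_ops as v) matrix_timeline = matrix_timeline"
proof -
  let ?L = "2 * (n * n)"
  have col: "legal_operations P N (slot_timeline v {..<j} ?L) (col_op v j) \<and>
    fold perform (col_op v j) (slot_timeline v {..<j} ?L) = slot_timeline v {..<Suc j} ?L"
    if "j < Suc n" for j
  proof -
    have "slot_timeline v {..<j} ?L (real j) = None"
      unfolding slot_timeline_def of_slots_real using that by (simp add: slot_def)
    then have "legal_operations P N (slot_timeline v {..<j} ?L) (col_op v j)"
      using perform_col_op[of j v ?L] that legal_timeline_slots[of ?L v "{..<Suc j}"]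
      by (auto simp: col_op_def)
    then show ?thesis using perform_col_op that by simp
  qed
  have query: "legal_operations P N (slot_timeline v {..<Suc n} ?L) (query_op as i) \<and>
    fold perform (query_op as i) (slot_timeline v {..<Suc n} ?L) = slot_timeline v {..<Suc n} ?L" for i
    using assms by (simp add: query_op_def)
  have uncol: "legal_operations P N (slot_timeline v {j..} ?L) (uncol_op v j) \<and>
    fold perform (uncol_op v j) (slot_timeline v {j..} ?L) = slot_timeline v {Suc j..} ?L"
    if "j < Suc n" for j
  proof -
    have "slot_timeline v {j..} ?L (real j) \<noteq> None" if "gv (vbit v j)"
      unfolding slot_timeline_def of_slots_real using \<open>j < Suc n\<close> that by (simp add: slot_def)
    then have "legal_operations P N (slot_timeline v {j..} ?L) (uncol_op v j)"
      using perform_uncol_op[of j v ?L] that legal_timeline_slots[of ?L v "{Suc j..}"]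
      by (auto simp: uncol_op_def)
    then show ?thesis using perform_uncol_op that by simp
  qed
  have start: "slot_timeline v {..<0} ?L = matrix_timeline"
    unfolding matrix_timeline_def using slot_timeline_empty by simp
  have final: "slot_timeline v {Suc n..} ?L = matrix_timeline"
    unfolding matrix_timeline_def by (rule slot_timeline_none)
  show ?thesis
    using legal_operations_concat[of "Suc n" P N "\<lambda>j. slot_timeline v {..<j} ?L" "col_op v", OF col]
      legal_operations_concat[of n P N "\<lambda>j. slot_timeline v {..<Suc n} ?L" "query_op as", OF query]
      legal_operations_concat[of "Suc n" P N "\<lambda>j. slot_timeline v {j..} ?L" "uncol_op v", OF uncol]
    unfolding round_ops_def legal_operations_append fold_append o_apply start final slot_timeline_all
    by simp
qed

lemma legal_rounds:
  assumes "as \<in> arguments P N"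
  shows "legal_operations P N matrix_timeline (concat (map (round_ops as) vs))"
  using legal_round_ops[OF assms] by (induction vs) (auto simp: legal_operations_append)

lemma op_args_matrix_ops:
  assumes "opn \<in> set matrix_ops" "w \<in> set (op_args opn)"
  shows "w < N"
proof -
  obtain q where q: "q < 2 * (n * n)" "opn \<in> set (row_op q)"
    using assms(1) by (auto simp: matrix_ops_def)
  then obtain i h j where "i < n" "j < n" "q div (2 * n) = i" "q mod n = j"
    using slot_coordinates[OF q(1)] by metis
  with q(2) assms(2) cell_vertex[of i j] show ?thesis
    by (auto simp: row_op_def row_slot_def Let_def split: if_splits)
qed

lemma op_args_round_ops:
  assumes "opn \<in> set (round_ops as v)" "w \<in> set (op_args opn)" "\<forall>w\<in>set as. w < N"
  shows "w < N"
  using assms col_vertex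
  by (auto simp: round_ops_def col_op_def query_op_def uncol_op_def less_Suc_eq_le split: if_splits)

end

section \<open>The algorithm for matrix-vector multiplication\<close>

text \<open>Nothing here depends on \<open>n\<close>: one program has to serve all instances, so
  sizes and vertices are given by expressions that are evaluated at run time.\<close>

locale code =
  fixes gr gv :: "bool \<Rightarrow> bool" and inc :: bool
    and size_e ra_e rb_e va_e vb_e out_e :: exp and args_e :: "exp list"
begin

text \<open>Compiles one of the four functions on \<open>bool\<close> into an expression over a
  bit.\<close>

definition test :: "(bool \<Rightarrow> bool) \<Rightarrow> exp \<Rightarrow> exp" where
  "test g e = (if g True then (if g False then Const 1 else e)
     else if g False then Bin Equal e (Const 0) else Const 0)"

abbreviation cell_bit :: exp where
  "cell_bit \<equiv> Arr 0 (Bin Add (Bin Mul (Reg 2) (Reg 0)) (Reg 3))"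

abbreviation col_bit :: exp where
  "col_bit \<equiv> Arr 1 (Reg 3)"

definition row_com :: "data_structure \<Rightarrow> com" where
  "row_com D =
     (let t = Bin Add (Bin Add (Reg 0) (Const 1)) (Reg 1);
          create = op_com (create_insertion D) [ra_e, rb_e] t in
      Seq (Seq (Assign 2 (Bin Div (Reg 1) (Bin Mul (Const 2) (Reg 0))))
               (Assign 3 (Bin Mod (Reg 1) (Reg 0))))
        (If (Bin Equal (Bin Mod (Bin Div (Reg 1) (Reg 0)) (Const 2)) (Const 0))
           (If (test gr cell_bit) create Skip)
           (if inc then If (test gr cell_bit) Skip create
            else If (test gr cell_bit) (op_com (create_deletion D) [ra_e, rb_e] t) Skip)))"

definition preprocess_com :: "data_structure \<Rightarrow> com" where
  "preprocess_com D = Seq (Assign 4 size_e) (Seq (shift_com (initialise D))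
     (for_com 1 (Bin Mul (Const 2) (Bin Mul (Reg 0) (Reg 0))) (row_com D)))"

definition multiply_com :: "data_structure \<Rightarrow> com" where
  "multiply_com D =
     Seq (for_com 3 (Bin Add (Reg 0) (Const 1))
            (If (test gv col_bit) (op_com (create_insertion D) [va_e, vb_e] (Reg 3)) Skip))
    (Seq (for_com 2 (Reg 0)
            (Seq (op_com (answer_query D) args_e
                    (Bin Mul (Bin Mul (Const 2) (Reg 0)) (Bin Add (Reg 2) (Const 1))))
               (Store 2 (Reg 2) out_e)))
         (for_com 3 (Bin Add (Reg 0) (Const 1))
            (If (test gv col_bit) (op_com (cancel D) [] (Reg 3)) Skip)))"

lemma computes_test:
  assumes "computes B r a e (of_bool b)" "1 \<le> B"
  shows "computes B r a (test g e) (of_bool (g b))"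
  using assms by (cases b) (auto simp: test_def computes_def)

end

text \<open>Enough room for the sizes, indices and times that the simulating code computes, of which
  the times of row slots are the largest, being of order \<open>2 * (n * n)\<close>. The factor 16
  is generous.\<close>

definition large :: "nat \<Rightarrow> nat \<Rightarrow> bool" where
  "large n B \<longleftrightarrow> 16 * ((n + 2) * (n + 2)) \<le> B"

lemma large_le: "large n B \<Longrightarrow> m \<le> 16 * ((n + 2) * (n + 2)) \<Longrightarrow> m \<le> B"
  unfolding large_def by linarith

text \<open>The interface of a single reduction. Its combinatorial content is
  \<open>out_val\<close>; the bounds on twice the answer registers are there because comparing a
  fraction with 1/2 doubles its numerator.\<close>

locale gadget = legal_layout n N M ra rb va vb gr gv inc +
    code gr gv inc size_e ra_e rb_e va_e vb_e out_e args_e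
  for n N M ra rb va vb gr gv inc size_e ra_e rb_e va_e vb_e out_e args_e +
  fixes P :: problem and as :: "nat list"
  assumes size: "n + 3 \<le> N" "N \<le> 3 * n + 3"
    and perms: "inc \<or> deletions_allowed P"
    and as_legal: "as \<in> arguments P N"
    and as_vertex: "\<forall>w\<in>set as. w < N"
    and as_length: "length args_e \<le> 2"
    and size_val: "\<And>B r a. large n B \<Longrightarrow> r 0 = n \<Longrightarrow> computes B r a size_e N"
    and cell_val: "\<And>B r a i j. large n B \<Longrightarrow> r 0 = n \<Longrightarrow> r 2 = i \<Longrightarrow> r 3 = j \<Longrightarrow> i < n \<Longrightarrow> j < n \<Longrightarrow>
      computes B r a ra_e (ra i j) \<and> computes B r a rb_e (rb i j)"
    and col_val: "\<And>B r a b j. large n B \<Longrightarrow> r 0 = n \<Longrightarrow> r 3 = j \<Longrightarrow> j \<le> n \<Longrightarrow> a 1 j = of_bool b \<Longrightarrow>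
      computes B r a va_e (va b j) \<and> computes B r a vb_e (vb b j)"
    and args_val: "\<And>B r a. large n B \<Longrightarrow> r 0 = n \<Longrightarrow> list_all2 (computes B r a) args_e as"
    and out_val: "\<And>B r a v i s. large n B \<Longrightarrow> r 0 = n \<Longrightarrow> r 2 = i \<Longrightarrow> i < n \<Longrightarrow>
      answers P N (query_graph v i) as (reg s 0) (reg s 1) \<Longrightarrow>
      2 * reg s 0 \<le> B \<Longrightarrow> 2 * reg s 1 \<le> B \<Longrightarrow>
      fits B (embed r a s) out_e \<and> val (embed r a s) out_e = of_bool (bool_product n M v i)"

locale gadget_simulation = gadget + sim: simulation B Bd D "bounded_answers Bd P" N for B Bd D +
  assumes B_large: "large n B" and Bd_double: "2 * Bd \<le> B"
begin

text \<open>The last conjunct gives column \<open>n\<close> the bit \<open>False\<close> at run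
  time: arrays start with zeros, and a vector fills only the indices below \<open>n\<close>.\<close>

definition own :: "(nat \<Rightarrow> nat) \<Rightarrow> (nat \<Rightarrow> nat \<Rightarrow> nat) \<Rightarrow> bool" where
  "own r a \<longleftrightarrow> r 0 = n \<and> (\<forall>i<n. \<forall>j<n. a 0 (i * n + j) = of_bool (M i j)) \<and> a 1 n = 0"

definition loaded :: "(nat \<Rightarrow> bool) \<Rightarrow> (nat \<Rightarrow> nat \<Rightarrow> nat) \<Rightarrow> bool" where
  "loaded v a \<longleftrightarrow> (\<forall>j<n. a 1 j = of_bool (v j))"

lemma cell_index_le: "i < n \<Longrightarrow> j < n \<Longrightarrow> i * n + j < n * n"
proof -
  assume "i < n" "j < n"
  then have "i * n + j < Suc i * n" "Suc i * n \<le> n * n" by (simp, intro mult_le_mono1, simp)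
  then show ?thesis by (rule less_le_trans)
qed

text \<open>The cost 8 consists of two assignments, two tests and the 4 steps that prepare an
  operation with two arguments.\<close>

lemma sim_row:
  assumes q: "q < 2 * (n * n)"
  shows "sim.sim (row_com D)
     (\<lambda>r a S. (own r a \<and> S = slot_timeline (\<lambda>_. False) {} q) \<and> r 1 = q) (row_op q) 8
     (\<lambda>r a S. (own r a \<and> S = slot_timeline (\<lambda>_. False) {} (Suc q)) \<and> r 1 = q)"
proof -
  obtain i h j where c: "i < n" "j < n" "h < 2" "q = 2 * n * i + n * h + j"
    "q div (2 * n) = i" "q div n mod 2 = h" "q mod n = j"
    by (rule slot_coordinates[OF q])
  have h: "even (q div n) \<longleftrightarrow> h = 0" using c(6) by (simp add: even_iff_mod_2_eq_zero)
  let ?S = "slot_timeline (\<lambda>_. False) {}"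
  let ?m = "\<lambda>r a S. own r a \<and> S = ?S q \<and> r 1 = q \<and> r 2 = i \<and> r 3 = j"
  let ?post = "\<lambda>r a S. (own r a \<and> S = ?S (Suc q)) \<and> r 1 = q"
  let ?t = "Bin Add (Bin Add (Reg 0) (Const 1)) (Reg 1)"
  have le: "n \<le> B" "2 * n \<le> B" "q + n + 1 \<le> B" "2 \<le> B" "n * n \<le> B"
    by (rule large_le[OF B_large], use q in \<open>simp add: algebra_simps\<close>)+
  have qd: "q div n \<le> B" using le(3) div_le_dividend[of q n] by linarith
  have qd2: "q div (2 * n) \<le> B" using le(3) div_le_dividend[of q "2 * n"] by linarith
  have t: "computes B r a ?t (Suc n + q)" if "?m r a S" for r a S
    using that le by (simp add: computes_def own_def)
  have cell: "computes B r a cell_bit (of_bool (M i j))" if "?m r a S" for r a S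
  proof -
    have "i * n + j \<le> B" "i * n \<le> B" using cell_index_le[OF c(1,2)] le(5) by auto
    then show ?thesis using that c(1,2) by (simp add: computes_def own_def)
  qed
  have op: "sim.sim (op_com (op_program D (Create u (real (Suc n + q)))) [ra_e, rb_e] ?t) ?m
      (row_op q) 4 ?post"
    if "row_op q = [Create u (real (Suc n + q))]" "u = Insert (ra i j) (rb i j) \<or> u = Delete (ra i j) (rb i j)" for u
    unfolding that(1)
  proof (rule sim.sim_mono[OF sim.sim_op[where Pre = ?m and Post = ?post and \<tau> = "Suc n + q"]])
    fix r a S assume m: "?m r a S"
    have "perform (Create u (real (Suc n + q))) (?S q) = ?S (Suc q)"
      using perform_row_op[of q "\<lambda>_. False"] that(1) by simp
    moreover have "list_all2 (computes B r a) [ra_e, rb_e] (op_args (Create u (real (Suc n + q))))"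
      using that(2) cell_val[OF B_large, of r i j a] m c(1,2) by (auto simp: own_def)
    ultimately show "list_all2 (computes B r a) [ra_e, rb_e] (op_args (Create u (real (Suc n + q)))) \<and>
      computes B r a ?t (Suc n + q) \<and> ?post r a (perform (Create u (real (Suc n + q))) S)"
      using t m by simp
  qed auto
  let ?create = "op_com (create_insertion D) [ra_e, rb_e] ?t"
  let ?delete = "op_com (create_deletion D) [ra_e, rb_e] ?t"
  have create: "sim.sim ?create ?m (row_op q) 4 ?post"
    if "row_op q = [Create (Insert (ra i j) (rb i j)) (real (Suc n + q))]"
    using op[OF that] by (simp only: op_program.simps simp_thms)
  have delete: "sim.sim ?delete ?m (row_op q) 4 ?post"
    if "row_op q = [Create (Delete (ra i j) (rb i j)) (real (Suc n + q))]"
    using op[OF that] by (simp only: op_program.simps simp_thms)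
  have skip: "sim.sim Skip ?m (row_op q) 4 ?post" if "row_op q = []"
    unfolding that
    by (rule sim.sim_mono[OF sim.sim_skip]) (use perform_row_op[of q "\<lambda>_. False"] that in auto)
  have test: "computes B r a (test gr cell_bit) (of_bool (gr (M i j)))" if "?m r a S" for r a S
    using cell[OF that] sim.B_pos by (rule computes_test)
  have row: "row_op q = (if h = 0 then (if gr (M i j) then [Create (Insert (ra i j) (rb i j)) (real (Suc n + q))] else [])
     else if inc then (if gr (M i j) then [] else [Create (Insert (ra i j) (rb i j)) (real (Suc n + q))])
     else (if gr (M i j) then [Create (Delete (ra i j) (rb i j)) (real (Suc n + q))] else []))"
    by (simp add: row_op_def row_slot_def h c(5,7))
  have branch: "sim.sim (If (test gr cell_bit) c1 c2) ?m (row_op q) 5 ?post"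
    if "gr (M i j) \<Longrightarrow> sim.sim c1 ?m (row_op q) 4 ?post" "\<not> gr (M i j) \<Longrightarrow> sim.sim c2 ?m (row_op q) 4 ?post"
    for c1 c2
    using sim.sim_if[OF test that] by simp
  have even: "sim.sim (If (test gr cell_bit) ?create Skip) ?m (row_op q) 5 ?post" if "h = 0"
  proof (rule branch)
    show "sim.sim ?create ?m (row_op q) 4 ?post" if "gr (M i j)"
      by (rule create) (subst row, simp add: that \<open>h = 0\<close>)
    show "sim.sim Skip ?m (row_op q) 4 ?post" if "\<not> gr (M i j)"
      by (rule skip) (subst row, simp add: that \<open>h = 0\<close>)
  qed
  have odd: "sim.sim (if inc then If (test gr cell_bit) Skip ?create else If (test gr cell_bit) ?delete Skip)
      ?m (row_op q) 5 ?post" if "h \<noteq> 0"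
  proof (cases inc)
    case True
    have "sim.sim (If (test gr cell_bit) Skip ?create) ?m (row_op q) 5 ?post"
    proof (rule branch)
      show "sim.sim Skip ?m (row_op q) 4 ?post" if "gr (M i j)"
        by (rule skip) (subst row, simp add: that \<open>h \<noteq> 0\<close> True)
      show "sim.sim ?create ?m (row_op q) 4 ?post" if "\<not> gr (M i j)"
        by (rule create) (subst row, simp add: that \<open>h \<noteq> 0\<close> True)
    qed
    then show ?thesis by (simp only: True if_True simp_thms)
  next
    case False
    have "sim.sim (If (test gr cell_bit) ?delete Skip) ?m (row_op q) 5 ?post"
    proof (rule branch)
      show "sim.sim ?delete ?m (row_op q) 4 ?post" if "gr (M i j)"
        by (rule delete) (subst row, simp add: that \<open>h \<noteq> 0\<close> False)
      show "sim.sim Skip ?m (row_op q) 4 ?post" if "\<not> gr (M i j)"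
        by (rule skip) (subst row, simp add: that \<open>h \<noteq> 0\<close> False)
    qed
    then show ?thesis by (simp only: False if_False)
  qed
  have "computes B r a (Bin Equal (Bin Mod (Bin Div (Reg 1) (Reg 0)) (Const 2)) (Const 0)) (of_bool (h = 0))"
    if "?m r a S" for r a S
    using that qd le c(6) \<open>h < 2\<close> sim.B_pos by (auto simp: computes_def own_def)
  from sim.sim_if[OF this even odd]
  have body: "sim.sim (If (Bin Equal (Bin Mod (Bin Div (Reg 1) (Reg 0)) (Const 2)) (Const 0))
      (If (test gr cell_bit) ?create Skip)
      (if inc then If (test gr cell_bit) Skip ?create else If (test gr cell_bit) ?delete Skip))
      ?m (row_op q) 6 ?post" by simp
  have a2: "sim.sim (Assign 2 (Bin Div (Reg 1) (Bin Mul (Const 2) (Reg 0))))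
      (\<lambda>r a S. (own r a \<and> S = ?S q) \<and> r 1 = q) [] 1 (\<lambda>r a S. own r a \<and> S = ?S q \<and> r 1 = q \<and> r 2 = i)"
    using qd2 le c(5) by (intro sim.sim_assign) (auto simp: computes_def own_def)
  have "q mod n \<le> B" using c(2,7) le(1) by simp
  then have a3: "sim.sim (Assign 3 (Bin Mod (Reg 1) (Reg 0)))
      (\<lambda>r a S. own r a \<and> S = ?S q \<and> r 1 = q \<and> r 2 = i) [] 1 ?m"
    using c(7) by (intro sim.sim_assign) (auto simp: computes_def own_def)
  show ?thesis
    using sim.sim_seq[OF sim.sim_seq[OF a2 a3] body] unfolding row_com_def Let_def append_Nil
    by (rule sim.sim_mono) simp
qed

lemma sim_col:
  assumes "j < Suc n"
  shows "sim.sim (If (test gv col_bit) (op_com (create_insertion D) [va_e, vb_e] (Reg 3)) Skip)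
     (\<lambda>r a S. (own r a \<and> loaded v a \<and> S = slot_timeline v {..<j} (2 * (n * n))) \<and> r 3 = j) (col_op v j) 5
     (\<lambda>r a S. (own r a \<and> loaded v a \<and> S = slot_timeline v {..<Suc j} (2 * (n * n))) \<and> r 3 = j)"
    (is "sim.sim _ ?pre _ _ ?post")
proof -
  let ?op = "Create (Insert (va (vbit v j) j) (vb (vbit v j) j)) (real j)"
  have bit: "a 1 j = of_bool (vbit v j)" if "?pre r a S" for r a S
    using that assms by (cases "j = n") (auto simp: own_def loaded_def vbit_def)
  have test: "computes B r a (test gv col_bit) (of_bool (gv (vbit v j)))" if "?pre r a S" for r a S
    by (rule computes_test[OF _ sim.B_pos]) (use bit[OF that] that in \<open>simp add: computes_def\<close>)
  have "sim.sim (op_com (create_insertion D) [va_e, vb_e] (Reg 3)) ?pre [?op] 4 ?post"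
    if "gv (vbit v j)"
  proof (rule sim.sim_mono[OF sim.sim_op[where Pre = ?pre and Post = ?post and \<tau> = j]])
    fix r a S assume m: "?pre r a S"
    then show "list_all2 (computes B r a) [va_e, vb_e] (op_args ?op) \<and>
      computes B r a (Reg 3) j \<and> ?post r a (perform ?op S)"
      using col_val[OF B_large, of r j a "vbit v j"] bit[OF m] assms perform_col_op[of j v "2 * (n * n)"] that
      by (simp add: own_def computes_def col_op_def)
  qed auto
  moreover have "sim.sim Skip ?pre [] 4 ?post" if "\<not> gv (vbit v j)"
    by (rule sim.sim_mono[OF sim.sim_skip])
      (use perform_col_op[of j v "2 * (n * n)"] that assms in \<open>auto simp: col_op_def\<close>)
  ultimately have "sim.sim (If (test gv col_bit) (op_com (create_insertion D) [va_e, vb_e] (Reg 3)) Skip)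
     ?pre (if gv (vbit v j) then [?op] else []) (4 + 1) ?post"
    by (intro sim.sim_if test)
  then show ?thesis by (simp add: col_op_def)
qed

lemma sim_uncol:
  assumes "j < Suc n"
  shows "sim.sim (If (test gv col_bit) (op_com (cancel D) [] (Reg 3)) Skip)
     (\<lambda>r a S. (own r a \<and> loaded v a \<and> Q a \<and> S = slot_timeline v {j..} (2 * (n * n))) \<and> r 3 = j) (uncol_op v j) 3
     (\<lambda>r a S. (own r a \<and> loaded v a \<and> Q a \<and> S = slot_timeline v {Suc j..} (2 * (n * n))) \<and> r 3 = j)"
    (is "sim.sim _ ?pre _ _ ?post")
proof -
  let ?op = "Cancel (real j)"
  have bit: "a 1 j = of_bool (vbit v j)" if "?pre r a S" for r a S
    using that assms by (cases "j = n") (auto simp: own_def loaded_def vbit_def)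
  have test: "computes B r a (test gv col_bit) (of_bool (gv (vbit v j)))" if "?pre r a S" for r a S
    by (rule computes_test[OF _ sim.B_pos]) (use bit[OF that] that in \<open>simp add: computes_def\<close>)
  have "sim.sim (op_com (cancel D) [] (Reg 3)) ?pre [?op] 2 ?post"
    if "gv (vbit v j)"
  proof (rule sim.sim_mono[OF sim.sim_op[where Pre = ?pre and Post = ?post and \<tau> = j]])
    fix r a S assume m: "?pre r a S"
    then show "list_all2 (computes B r a) [] (op_args ?op) \<and>
      computes B r a (Reg 3) j \<and> ?post r a (perform ?op S)"
      using assms perform_uncol_op[of j v "2 * (n * n)"] that
      by (simp add: computes_def uncol_op_def)
  qed auto
  moreover have "sim.sim Skip ?pre [] 2 ?post" if "\<not> gv (vbit v j)"
    by (rule sim.sim_mono[OF sim.sim_skip])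
      (use perform_uncol_op[of j v "2 * (n * n)"] that assms in \<open>auto simp: uncol_op_def\<close>)
  ultimately have "sim.sim (If (test gv col_bit) (op_com (cancel D) [] (Reg 3)) Skip)
     ?pre (if gv (vbit v j) then [?op] else []) (2 + 1) ?post"
    by (intro sim.sim_if test)
  then show ?thesis by (simp add: uncol_op_def)
qed

definition answered :: "(nat \<Rightarrow> bool) \<Rightarrow> nat \<Rightarrow> (nat \<Rightarrow> nat \<Rightarrow> nat) \<Rightarrow> bool" where
  "answered v i a \<longleftrightarrow> (\<forall>i'<i. a 2 i' = of_bool (bool_product n M v i'))"

lemma sim_queries:
  assumes "i < n"
  shows "sim.sim (Seq (op_com (answer_query D) args_e
        (Bin Mul (Bin Mul (Const 2) (Reg 0)) (Bin Add (Reg 2) (Const 1)))) (Store 2 (Reg 2) out_e))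
     (\<lambda>r a S. (own r a \<and> loaded v a \<and> answered v i a \<and>
        S = slot_timeline v {..<Suc n} (2 * (n * n))) \<and> r 2 = i) (query_op as i) 5
     (\<lambda>r a S. (own r a \<and> loaded v a \<and> answered v (Suc i) a \<and>
        S = slot_timeline v {..<Suc n} (2 * (n * n))) \<and> r 2 = i)"
    (is "sim.sim _ ?pre _ _ ?post")
  unfolding query_op_def
proof (rule sim.sim_mono[OF sim.sim_query[where Pre = ?pre and Post = ?post and j = i
      and w = "of_bool (bool_product n M v i)"]])
  fix r a S assume m: "?pre r a S"
  have "2 * n * Suc i \<le> 2 * n * n" using assms by (intro mult_le_mono2) simp
  then have "2 * n * Suc i \<le> 2 * (n * n)" by simp
  moreover have "2 * (n * n) \<le> B" "n \<le> B" "2 * n \<le> B" "2 \<le> B"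
    by (rule large_le[OF B_large], simp add: algebra_simps)+
  ultimately have "computes B r a (Bin Mul (Bin Mul (Const 2) (Reg 0)) (Bin Add (Reg 2) (Const 1)))
    (2 * n * Suc i)" using m assms by (simp add: computes_def own_def)
  moreover have "fits B (embed r a s) out_e \<and> val (embed r a s) out_e = of_bool (bool_product n M v i)"
    if "answers (bounded_answers Bd P) N (graph_at S (real (2 * n * Suc i))) as (reg s 0) (reg s 1)" for s
  proof (rule out_val[OF B_large _ _ assms])
    show "answers P N (query_graph v i) as (reg s 0) (reg s 1)" "2 * reg s 0 \<le> B" "2 * reg s 1 \<le> B"
      using that Bd_double m graph_at_timeline[OF assms, of v] by (simp_all add: bounded_answers_def)
  qed (use m in \<open>auto simp: own_def\<close>)
  ultimately show "list_all2 (computes B r a) args_e as \<and>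
      computes B r a (Bin Mul (Bin Mul (Const 2) (Reg 0)) (Bin Add (Reg 2) (Const 1))) (2 * n * Suc i) \<and>
      computes B r a (Reg 2) i \<and>
      ?post r (a(2 := (a 2)(i := of_bool (bool_product n M v i)))) S \<and>
      (\<forall>s. answers (bounded_answers Bd P) N (graph_at S (real (2 * n * Suc i))) as (reg s 0) (reg s 1) \<longrightarrow>
         fits B (embed r a s) out_e \<and> val (embed r a s) out_e = of_bool (bool_product n M v i))"
    using m args_val[OF B_large]
    by (auto simp: own_def loaded_def answered_def less_Suc_eq computes_def)
qed (use as_length in simp)

end

section \<open>The lower bound\<close>

lemma run_operations_mono:
  "run_operations B D P n S s ops k \<Longrightarrow> B \<le> B' \<Longrightarrow> run_operations B' D P n S s ops k"
  by (induction rule: run_operations.induct)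
    (auto intro!: run_operations.intros intro: exec_mono simp: run_operation_iff)

context gadget_simulation
begin

lemma sim_matrix:
  "sim.sim (for_com 1 (Bin Mul (Const 2) (Bin Mul (Reg 0) (Reg 0))) (row_com D))
     (\<lambda>r a S. own r a \<and> S = Map.empty) matrix_ops (20 * (n * n) + 2)
     (\<lambda>r a S. own r a \<and> S = matrix_timeline)"
proof -
  let ?Inv = "\<lambda>q r a S. own r a \<and> S = slot_timeline (\<lambda>_. False) {} q"
  have le: "2 * (n * n) \<le> B" "n * n \<le> B" "2 \<le> B"
    by (rule large_le[OF B_large], simp add: algebra_simps)+
  have "sim.sim (for_com 1 (Bin Mul (Const 2) (Bin Mul (Reg 0) (Reg 0))) (row_com D))
     (?Inv 0) (concat (map row_op [0..<2 * (n * n)])) (2 * (n * n) * (8 + 2) + 2) (?Inv (2 * (n * n)))"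
  proof (rule sim.sim_for)
    show "sim.sim (row_com D) (\<lambda>r a S. ?Inv q r a S \<and> r 1 = q) (row_op q) 8
        (\<lambda>r a S. ?Inv (Suc q) r a S \<and> r 1 = q)" if "q < 2 * (n * n)" for q
      by (rule sim_row[OF that])
  qed (use le in \<open>auto simp: own_def computes_def\<close>)
  then show ?thesis
    unfolding matrix_ops_def[symmetric] matrix_timeline_def[symmetric] slot_timeline_0
    by (rule sim.sim_mono) simp
qed

lemma sim_round:
  "sim.sim (multiply_com D) (\<lambda>r a S. own r a \<and> loaded v a \<and> S = matrix_timeline)
     (round_ops as v) (37 * n) (\<lambda>r a S. own r a \<and> answered v n a \<and> S = matrix_timeline)"
proof -
  let ?L = "2 * (n * n)"
  let ?I1 = "\<lambda>j r a S. own r a \<and> loaded v a \<and> S = slot_timeline v {..<j} ?L"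
  let ?I2 = "\<lambda>i r a S. own r a \<and> loaded v a \<and> answered v i a \<and> S = slot_timeline v {..<Suc n} ?L"
  let ?I3 = "\<lambda>j r a S. own r a \<and> loaded v a \<and> answered v n a \<and> S = slot_timeline v {j..} ?L"
  have le: "Suc n \<le> B" "n \<le> B" "1 \<le> B"
    by (rule large_le[OF B_large], simp)+
  have col: "sim.sim (for_com 3 (Bin Add (Reg 0) (Const 1))
      (If (test gv col_bit) (op_com (create_insertion D) [va_e, vb_e] (Reg 3)) Skip))
      (?I1 0) (concat (map (col_op v) [0..<Suc n])) (Suc n * (5 + 2) + 2) (?I1 (Suc n))"
    by (rule sim.sim_for[where Inv = ?I1, OF sim_col])
      (use le in \<open>auto simp: own_def computes_def\<close>)
  have query: "sim.sim (for_com 2 (Reg 0) (Seq (op_com (answer_query D) args_e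
        (Bin Mul (Bin Mul (Const 2) (Reg 0)) (Bin Add (Reg 2) (Const 1)))) (Store 2 (Reg 2) out_e)))
      (?I2 0) (concat (map (query_op as) [0..<n])) (n * (5 + 2) + 2) (?I2 n)"
    by (rule sim.sim_for[where Inv = ?I2, OF sim_queries])
      (use le in \<open>auto simp: own_def computes_def\<close>)
  have uncol: "sim.sim (for_com 3 (Bin Add (Reg 0) (Const 1))
      (If (test gv col_bit) (op_com (cancel D) [] (Reg 3)) Skip))
      (?I3 0) (concat (map (uncol_op v) [0..<Suc n])) (Suc n * (3 + 2) + 2) (?I3 (Suc n))"
    by (rule sim.sim_for[where Inv = ?I3, OF sim_uncol])
      (use le in \<open>auto simp: own_def computes_def\<close>)
  have start: "?I1 0 = (\<lambda>r a S. own r a \<and> loaded v a \<and> S = matrix_timeline)"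
    using slot_timeline_empty[of v _ "\<lambda>_. False"] by (simp add: matrix_timeline_def)
  have mid1: "?I1 (Suc n) = ?I2 0" by (simp add: answered_def)
  have mid2: "?I2 n = ?I3 0" by (simp only: slot_timeline_all)
  have final: "?I3 (Suc n) = (\<lambda>r a S. own r a \<and> loaded v a \<and> answered v n a \<and> S = matrix_timeline)"
    using slot_timeline_none[of v _ "\<lambda>_. False"] by (simp add: matrix_timeline_def)
  have drop: "sim.sim c Pre ops C (\<lambda>r a S. own r a \<and> answered v n a \<and> S = matrix_timeline)"
    if "sim.sim c Pre ops C (\<lambda>r a S. own r a \<and> loaded v a \<and> answered v n a \<and> S = matrix_timeline)"
    for c Pre ops C
    using that unfolding sim.sim_def by meson
  \<comment> \<open>The left-hand side is \<open>19 * n + 18\<close>, and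
    \<open>1 \<le> n\<close>.\<close>
  have cost: "Suc n * (5 + 2) + 2 + (n * (5 + 2) + 2 + (Suc n * (3 + 2) + 2)) \<le> 37 * n"
    using n_pos by simp
  show ?thesis
    unfolding multiply_com_def round_ops_def
    by (rule drop, rule sim.sim_mono[OF sim.sim_seq[OF col[unfolded start mid1]
        sim.sim_seq[OF query[unfolded mid2] uncol[unfolded final]]] cost])
qed

text \<open>Each round passes the unconsumed part of the run on to the next one, so the times of the
  data structure telescope to \<open>q\<close> and only the overhead is multiplied by the number of
  rounds.\<close>

lemma run_rounds:
  assumes "own r a"
    "run_operations Bd D (bounded_answers Bd P) N matrix_timeline s (concat (map (round_ops as) vs)) q"
  shows "\<exists>k. omv_rounds B (multiply_com D) n M (embed r a s) vs k \<and> k \<le> 37 * n * length vs + q"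
  using assms
proof (induction vs arbitrary: r a s q)
  case Nil
  show ?case using omv_rounds.Nil by fastforce
next
  case (Cons v vs)
  let ?a = "a(1 := (\<lambda>j. if j < n then of_bool (v j) else a 1 j))"
  have load: "load_vector n v (embed r a s) = embed r ?a s"
    by (auto simp: load_vector_def embed_def fun_eq_iff)
  have pre: "own r ?a \<and> loaded v ?a \<and> matrix_timeline = matrix_timeline"
    using Cons.prems(1) by (simp add: own_def loaded_def)
  have run: "run_operations Bd D (bounded_answers Bd P) N matrix_timeline s
      (round_ops as v @ concat (map (round_ops as) vs)) q"
    using Cons.prems(2) by simp
  obtain k r' a' s' q' where 1: "exec B (multiply_com D) (embed r ?a s) k (embed r' a' s')"
    "own r' a'" "answered v n a'"
    "run_operations Bd D (bounded_answers Bd P) N matrix_timeline s' (concat (map (round_ops as) vs)) q'"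
    "k + q' \<le> 37 * n + q"
    using sim.simD[OF sim_round, OF pre run] by blast
  from Cons.IH[OF 1(2,4)] obtain l where 2:
    "omv_rounds B (multiply_com D) n M (embed r' a' s') vs l" "l \<le> 37 * n * length vs + q'" by blast
  have "omv_rounds B (multiply_com D) n M (embed r a s) (v # vs) (k + l)"
    using 1(1,3) 2(1) by (intro omv_rounds.Cons[of _ _ _ _ _ _ "embed r' a' s'"]) (simp_all add: load answered_def)
  moreover have "k + l \<le> 37 * n * length (v # vs) + q" using 1(5) 2(2) by (simp add: algebra_simps)
  ultimately show ?case by blast
qed

lemma run_omv:
  assumes "exec Bd (initialise D) (initial_state N) k0 s"
    "run_operations Bd D P N Map.empty s (matrix_ops @ concat (map (round_ops as) vs)) q"
    "1 \<le> Bd" "N \<le> Bd"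
  shows "\<exists>k s' k'. exec B (preprocess_com D) (omv_input n M) k s' \<and>
    omv_rounds B (multiply_com D) n M s' vs k' \<and>
    k + k' \<le> 20 * (n * n) + 3 + 37 * n * length vs + (k0 + q)"
proof -
  let ?r = "(\<lambda>_. 0)(0 := n) :: nat \<Rightarrow> nat"
  let ?a = "(\<lambda>_ _. 0)(0 := (\<lambda>p. if p < n * n then of_bool (M (p div n) (p mod n)) else 0)) :: nat \<Rightarrow> nat \<Rightarrow> nat"
  \<comment> \<open>The simulated memory is blank at the start, so all that is missing for
    \<open>initial_state N\<close> is the number \<open>N\<close> in its register 0, which is
    register 4.\<close>
  have input: "omv_input n M = embed ?r ?a blank"
    by (auto simp: omv_input_def embed_def blank_def fun_eq_iff)
  have own: "own ?r ?a" using n_pos cell_index_le by (auto simp: own_def)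
  have "words_le Bd (initial_state N)"
    using assms(4) by (auto simp: words_le_def initial_state_def blank_def)
  then have "words_le Bd s" using exec_words_le[OF assms(1,3)] by blast
  moreover have "\<forall>opn\<in>set (matrix_ops @ concat (map (round_ops as) vs)). \<forall>w\<in>set (op_args opn). w \<le> Bd"
  proof (intro ballI)
    fix opn w assume "opn \<in> set (matrix_ops @ concat (map (round_ops as) vs))" "w \<in> set (op_args opn)"
    then have "w < N" using op_args_matrix_ops op_args_round_ops as_vertex by (auto; blast)
    then show "w \<le> Bd" using assms(4) by simp
  qed
  ultimately have run: "run_operations Bd D (bounded_answers Bd P) N Map.empty s
      (matrix_ops @ concat (map (round_ops as) vs)) q"
    using run_operations_bounded_answers[OF assms(2) _ assms(3)] by blast
  have pre: "own ?r ?a \<and> Map.empty = Map.empty" using own by simp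
  obtain k1 r' a' s' q' where 1: "exec B (for_com 1 (Bin Mul (Const 2) (Bin Mul (Reg 0) (Reg 0))) (row_com D))
     (embed ?r ?a s) k1 (embed r' a' s')" "own r' a'"
    "run_operations Bd D (bounded_answers Bd P) N matrix_timeline s' (concat (map (round_ops as) vs)) q'"
    "k1 + q' \<le> 20 * (n * n) + 2 + q"
    using sim.simD[OF sim_matrix, OF pre run] by blast
  from run_rounds[OF 1(2,3)] obtain k' where 2:
    "omv_rounds B (multiply_com D) n M (embed r' a' s') vs k'" "k' \<le> 37 * n * length vs + q'" by blast
  have N_val: "fits B (embed ?r ?a blank) size_e" "val (embed ?r ?a blank) size_e = N"
    using size_val[OF B_large, of ?r ?a] by (auto simp: computes_def)
  have "(embed ?r ?a blank)\<lparr>reg := (reg (embed ?r ?a blank))(0 + 4 := N)\<rparr> = embed ?r ?a (initial_state N)"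
    unfolding embed_reg_shift initial_state_def ..
  then have 3: "exec B (Assign 4 size_e) (embed ?r ?a blank) 1 (embed ?r ?a (initial_state N))"
    using exec.Assign[OF N_val(1), of 4] unfolding N_val(2) by (simp only: add_0)
  have 4: "exec B (shift_com (initialise D)) (embed ?r ?a (initial_state N)) k0 (embed ?r ?a s)"
    by (rule exec_shift[OF exec_mono[OF assms(1) sim.Bd_le]])
  have "exec B (preprocess_com D) (omv_input n M) (1 + (k0 + k1)) (embed r' a' s')"
    unfolding input preprocess_com_def by (rule exec.Seq[OF 3 exec.Seq[OF 4 1(1)]])
  moreover have "1 + (k0 + k1) + k' \<le> 20 * (n * n) + 3 + 37 * n * length vs + (k0 + q)"
    using 1(4) 2(2) by simp
  ultimately show ?thesis using 2(1) by blast
qed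

end

text \<open>The exponent \<open>a\<close> may be negative, where powers are not increasing in the
  base. So it is first raised to \<open>b\<close>, using only that the base \<open>N n\<close> is at
  least 1, and then \<open>N n\<close> is replaced by \<open>6 * n\<close>.\<close>

lemma bigo_powr_comp:
  fixes f :: "nat \<Rightarrow> real" and N :: "nat \<Rightarrow> nat"
  assumes "f \<in> O(\<lambda>n. real n powr a)" "a \<le> b" "0 \<le> b"
    "\<And>n. 1 \<le> n \<Longrightarrow> n \<le> N n" "\<And>n. 1 \<le> n \<Longrightarrow> N n \<le> 6 * n"
  shows "(\<lambda>n. f (N n)) \<in> O(\<lambda>n. real n powr b)"
proof -
  obtain C where C: "C > 0" "eventually (\<lambda>n. norm (f n) \<le> C * norm (real n powr a)) at_top"
    using assms(1) by (rule landau_o.bigE)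
  then obtain n0 where n0: "\<And>n. n \<ge> n0 \<Longrightarrow> \<bar>f n\<bar> \<le> C * real n powr a"
    by (auto simp: eventually_at_top_linorder)
  have "norm (f (N n)) \<le> (C * 6 powr b) * norm (real n powr b)" if "n \<ge> max 1 n0" for n
  proof -
    have n: "1 \<le> n" "n \<le> N n" "N n \<le> 6 * n" using assms(4,5) that by auto
    have "\<bar>f (N n)\<bar> \<le> C * real (N n) powr a" using n0 n that by simp
    also have "\<dots> \<le> C * real (N n) powr b"
      using C(1) n assms(2) by (intro mult_left_mono powr_mono) auto
    also have "\<dots> \<le> C * real (6 * n) powr b"
      using C(1) n assms(3) by (intro mult_left_mono powr_mono2) (auto simp flip: of_nat_le_iff)
    also have "\<dots> = C * 6 powr b * real n powr b" by (simp add: powr_mult)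
    finally show ?thesis by simp
  qed
  then show ?thesis
    by (rule bigoI[of _ "C * 6 powr b", OF eventually_at_top_linorderI[of "max 1 n0"]])
qed

text \<open>The summands are the overhead, the start-up and the at most \<open>7 * (n * n)\<close>
  operations; absolute values appear because \<open>I\<close> and \<open>T\<close> may be negative.
  The cap \<open>e \<le> 1\<close> makes \<open>n powr 2\<close> admissible and keeps
  \<open>1 - e\<close> nonnegative.\<close>

lemma algorithm_time:
  fixes I T :: "nat \<Rightarrow> real" and N :: "nat \<Rightarrow> nat"
  assumes I: "I \<in> O(\<lambda>n. real n powr (3 - \<delta>))" and T: "T \<in> O(\<lambda>n. real n powr (1 - \<epsilon>))"
    and e: "e \<le> 1" "e \<le> \<delta>" "e \<le> \<epsilon>"
    and N: "\<And>n. 1 \<le> n \<Longrightarrow> n \<le> N n" "\<And>n. 1 \<le> n \<Longrightarrow> N n \<le> 6 * n"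
  shows "(\<lambda>n. 60 * real (n * n) + \<bar>I (N n)\<bar> + 7 * real (n * n) * \<bar>T (N n)\<bar>) \<in>
    O(\<lambda>n. real n powr (3 - e))"
proof (intro sum_in_bigo)
  have sq: "(\<lambda>n::nat. real (n * n)) \<in> O(\<lambda>n. real n powr 2)"
    by (intro bigoI[of _ 1] always_eventually) (auto simp: powr_numeral power2_eq_square)
  have le: "(\<lambda>n::nat. real n powr 2) \<in> O(\<lambda>n. real n powr (3 - e))"
  proof (rule bigoI[of _ 1, OF eventually_at_top_linorderI[of 1]])
    fix n :: nat assume "1 \<le> n"
    then have "real n powr 2 \<le> real n powr (3 - e)" using e(1) by (intro powr_mono) auto
    then show "norm (real n powr 2) \<le> 1 * norm (real n powr (3 - e))" by (simp only: real_norm_def abs_of_nonneg[OF powr_ge_zero] mult_1)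
  qed
  show "(\<lambda>n::nat. 60 * real (n * n)) \<in> O(\<lambda>n. real n powr (3 - e))"
    using landau_o.big_trans[OF sq le] by simp
  show "(\<lambda>n. \<bar>I (N n)\<bar>) \<in> O(\<lambda>n. real n powr (3 - e))"
    using bigo_powr_comp[OF I _ _ N, of "3 - e"] e by simp
  have "(\<lambda>n. \<bar>T (N n)\<bar>) \<in> O(\<lambda>n. real n powr (1 - e))"
    using bigo_powr_comp[OF T _ _ N, of "1 - e"] e by simp
  from landau_o.big.mult[OF sq this]
  have "(\<lambda>n. real (n * n) * \<bar>T (N n)\<bar>) \<in> O(\<lambda>n. real n powr (3 - e))"
    by (simp only: powr_add[symmetric]) simp
  then show "(\<lambda>n. 7 * real (n * n) * \<bar>T (N n)\<bar>) \<in> O(\<lambda>n. real n powr (3 - e))"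
    by (simp add: mult.assoc)
qed

text \<open>From \<open>N + l + 2 \<le> (n + 2) ^ 4\<close> the power \<open>c + 1\<close> costs the
  exponent \<open>4 * (c + 1)\<close>. The six powers left over absorb the factors 2 and 16.\<close>

lemma large_word_size:
  fixes n N l c :: nat
  assumes "1 \<le> n" "N \<le> 3 * n + 3" "l \<le> 7 * (n * n)"
  shows "large n ((n + 2) ^ (4 * c + 10))" "2 * (N + l + 2) ^ (c + 1) \<le> (n + 2) ^ (4 * c + 10)"
proof -
  have sq: "9 \<le> (n + 2)\<^sup>2" using power_mono[of 3 "n + 2" 2] assms(1) by simp
  have four: "(n + 2) ^ 4 = (n + 2)\<^sup>2 * (n + 2)\<^sup>2" by (simp flip: power_add)
  have ten: "(n + 2) ^ (4 * c + 10) = (n + 2) ^ (4 * (c + 1)) * ((n + 2)\<^sup>2 * (n + 2) ^ 4)"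
    by (simp flip: power_add)
  have "9 * 9 \<le> (n + 2) ^ 4" unfolding four by (intro mult_le_mono sq)
  moreover have "(n + 2)\<^sup>2 * 16 \<le> (n + 2)\<^sup>2 * (n + 2) ^ 4"
    using calculation by (intro mult_le_mono2) simp
  moreover have "1 * ((n + 2)\<^sup>2 * (n + 2) ^ 4) \<le> (n + 2) ^ (4 * c + 10)"
    unfolding ten by (intro mult_le_mono1) simp
  ultimately show "large n ((n + 2) ^ (4 * c + 10))"
    by (simp add: large_def power2_eq_square)
  have "9 * (n + 2)\<^sup>2 \<le> (n + 2) ^ 4" unfolding four by (intro mult_le_mono1 sq)
  then have "N + l + 2 \<le> (n + 2) ^ 4"
    using assms by (simp add: power2_eq_square algebra_simps)
  then have "(N + l + 2) ^ (c + 1) \<le> ((n + 2) ^ 4) ^ (c + 1)" by (rule power_mono) simp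
  also have "\<dots> = (n + 2) ^ (4 * (c + 1))" by (rule power_mult[symmetric])
  finally have "2 * (N + l + 2) ^ (c + 1) \<le> ((n + 2)\<^sup>2 * (n + 2) ^ 4) * (n + 2) ^ (4 * (c + 1))"
    using sq \<open>9 * 9 \<le> (n + 2) ^ 4\<close> mult_le_mono[OF sq \<open>9 * 9 \<le> (n + 2) ^ 4\<close>] by (intro mult_le_mono) auto
  then show "2 * (N + l + 2) ^ (c + 1) \<le> (n + 2) ^ (4 * c + 10)"
    unfolding ten by (simp only: mult.commute)
qed

lemma le_power4:
  fixes n N :: nat
  assumes "1 \<le> n" "n + 3 \<le> N"
  shows "7 * (n * n) \<le> N ^ 4"
proof -
  have "16 \<le> N\<^sup>2" using power_mono[of 4 N 2] assms by simp
  moreover have "n * n \<le> N\<^sup>2" using power_mono[of n N 2] assms by (simp add: power2_eq_square)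
  ultimately have "16 * (n * n) \<le> N\<^sup>2 * N\<^sup>2" by (rule mult_le_mono)
  then show ?thesis by (simp flip: power_add)
qed

theorem omv_lower_bound:
  fixes \<epsilon> :: real and N :: "nat \<Rightarrow> nat"
  assumes gadget: "\<And>n M. 1 \<le> n \<Longrightarrow> gadget n (N n) M (ra n) (rb n) (va n) (vb n) gr gv inc
      size_e ra_e rb_e va_e vb_e out_e args_e P (as n)"
    and "OMv_conjecture" "\<epsilon> > 0"
  shows "\<not> has_data_structure P (\<lambda>n. real n powr (1 - \<epsilon>))"
proof
  assume "has_data_structure P (\<lambda>n. real n powr (1 - \<epsilon>))"
  then obtain D c \<delta> where "\<delta> > 0" and D: "\<And>d. \<exists>I T.
     I \<in> O(\<lambda>n. real n powr (3 - \<delta>)) \<and> T \<in> O(\<lambda>n. real n powr (1 - \<epsilon>)) \<and>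
     (\<forall>n\<ge>1. \<forall>ops. legal_operations P n Map.empty ops \<and> length ops \<le> n ^ d \<longrightarrow>
        (\<exists>k s k'. exec ((n + length ops + 2) ^ c) (initialise D) (initial_state n) k s \<and>
           run_operations ((n + length ops + 2) ^ c) D P n Map.empty s ops k' \<and>
           real (k + k') \<le> I n + real (length ops) * T n))"
    unfolding has_data_structure_def by blast
  obtain I T where I: "I \<in> O(\<lambda>n. real n powr (3 - \<delta>))" and T: "T \<in> O(\<lambda>n. real n powr (1 - \<epsilon>))"
    and run: "\<And>n ops. 1 \<le> n \<Longrightarrow> legal_operations P n Map.empty ops \<Longrightarrow> length ops \<le> n ^ 4 \<Longrightarrow>
        \<exists>k s k'. exec ((n + length ops + 2) ^ c) (initialise D) (initial_state n) k s \<and>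
           run_operations ((n + length ops + 2) ^ c) D P n Map.empty s ops k' \<and>
           real (k + k') \<le> I n + real (length ops) * T n"
    \<comment> \<open>Exponent 4 admits the whole sequence, by \<open>le_power4\<close>.\<close>
    using D[of 4] by blast
  define A where "A = \<lparr>preprocess = code.preprocess_com gr inc size_e ra_e rb_e D,
    multiply = code.multiply_com gv va_e vb_e out_e args_e D\<rparr>"
  define e where "e = min 1 (min \<delta> \<epsilon>)"
  define time where "time = (\<lambda>n. 60 * real (n * n) + \<bar>I (N n)\<bar> + 7 * real (n * n) * \<bar>T (N n)\<bar>)"
  have N: "n + 3 \<le> N n" "N n \<le> 3 * n + 3" if "1 \<le> n" for n
    using gadget.size[OF gadget[OF that]] by auto
  have "time \<in> O(\<lambda>n. real n powr (3 - e))"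
    unfolding time_def
  proof (rule algorithm_time[OF I T])
    show "n \<le> N n" "N n \<le> 6 * n" if "1 \<le> n" for n
      using N[OF that] that by auto
  qed (auto simp: e_def)
  moreover have "e > 0" using \<open>\<epsilon> > 0\<close> \<open>\<delta> > 0\<close> by (simp add: e_def)
  moreover have "solves_omv A time"
    unfolding solves_omv_def
  proof (rule exI[of _ "4 * c + 10"], intro allI impI)
    fix n :: nat and M :: "nat \<Rightarrow> nat \<Rightarrow> bool" and vs :: "(nat \<Rightarrow> bool) list"
    assume "1 \<le> n" and vs: "length vs = n"
    interpret gadget n "N n" M "ra n" "rb n" "va n" "vb n" gr gv inc
      size_e ra_e rb_e va_e vb_e out_e args_e P "as n"
      by (rule gadget[OF \<open>1 \<le> n\<close>])
    let ?ops = "matrix_ops @ concat (map (round_ops (as n)) vs)"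
    have legal: "legal_operations P (N n) Map.empty ?ops"
      using legal_matrix_ops[OF perms] legal_rounds[OF as_legal] by (simp add: legal_operations_append)
    have "length ?ops \<le> 2 * (n * n) + n * (3 * n + 2)"
      using length_matrix_ops length_rounds[of "as n" vs] vs by simp
    also have "\<dots> \<le> 7 * (n * n)"
    proof -
      have "n * 1 \<le> n * n" using \<open>1 \<le> n\<close> by (intro mult_le_mono2)
      then show ?thesis by (simp add: algebra_simps)
    qed
    finally have len: "length ?ops \<le> 7 * (n * n)" .
    then have "length ?ops \<le> N n ^ 4" using le_power4[OF \<open>1 \<le> n\<close> N(1)[OF \<open>1 \<le> n\<close>]] by simp
    moreover have "1 \<le> N n" using N(1)[OF \<open>1 \<le> n\<close>] by simp
    ultimately obtain k0 s q where ex: "exec ((N n + length ?ops + 2) ^ c) (initialise D) (initial_state (N n)) k0 s"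
      "run_operations ((N n + length ?ops + 2) ^ c) D P (N n) Map.empty s ?ops q"
      and k0: "real (k0 + q) \<le> I (N n) + real (length ?ops) * T (N n)"
      using run[OF _ legal] by blast
    \<comment> \<open>The exponent is \<open>c + 1\<close> because for \<open>c = 0\<close> the
      bound given by the data structure is 1, whereas the arguments, which are vertices below
      \<open>N n\<close>, have to fit as well.\<close>
    define Bd where "Bd = (N n + length ?ops + 2) ^ (c + 1)"
    have Bd: "(N n + length ?ops + 2) ^ c \<le> Bd"
      unfolding Bd_def by (rule power_increasing) simp_all
    have "N n + length ?ops + 2 \<le> Bd"
      unfolding Bd_def by (rule self_le_power) simp_all
    then have Bd': "1 \<le> Bd" "N n \<le> Bd" by simp_all
    note large = large_word_size[OF \<open>1 \<le> n\<close> size(2) len, of c, folded Bd_def]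
    interpret sim: simulation "(n + 2) ^ (4 * c + 10)" Bd D "bounded_answers Bd P" "N n"
      using large(2) by unfold_locales auto
    interpret gadget_simulation n "N n" M "ra n" "rb n" "va n" "vb n" gr gv inc
      size_e ra_e rb_e va_e vb_e out_e args_e P "as n" "(n + 2) ^ (4 * c + 10)" Bd D
      using large by unfold_locales
    from run_omv[OF exec_mono[OF ex(1) Bd] run_operations_mono[OF ex(2) Bd] Bd']
    obtain k s' k' where 1: "exec ((n + 2) ^ (4 * c + 10)) (preprocess_com D) (omv_input n M) k s'"
      "omv_rounds ((n + 2) ^ (4 * c + 10)) (multiply_com D) n M s' vs k'"
      "k + k' \<le> 20 * (n * n) + 3 + 37 * n * length vs + (k0 + q)" by blast
    have "k + k' \<le> 60 * (n * n) + (k0 + q)"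
    proof -
      have "1 * 1 \<le> n * n" using \<open>1 \<le> n\<close> by (intro mult_le_mono)
      moreover have "k + k' \<le> 57 * (n * n) + 3 + (k0 + q)" using 1(3) vs by (simp add: mult.assoc)
      ultimately show ?thesis by linarith
    qed
    then have "real (k + k') \<le> real (60 * (n * n) + (k0 + q))"
      by (simp only: of_nat_le_iff)
    then have "real (k + k') \<le> 60 * real (n * n) + real (k0 + q)" by simp
    moreover have "real (length ?ops) * T (N n) \<le> real (length ?ops) * \<bar>T (N n)\<bar>"
      by (intro mult_left_mono) auto
    moreover have "real (length ?ops) \<le> real (7 * (n * n))" using len by (simp only: of_nat_le_iff)
    then have "real (length ?ops) * \<bar>T (N n)\<bar> \<le> 7 * real (n * n) * \<bar>T (N n)\<bar>"
      by (intro mult_right_mono) auto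
    ultimately have "real (k + k') \<le> time n" using k0 unfolding time_def by linarith
    with 1 show "\<exists>k s k'. exec ((n + 2) ^ (4 * c + 10)) (preprocess A) (omv_input n M) k s \<and>
        omv_rounds ((n + 2) ^ (4 * c + 10)) (multiply A) n M s vs k' \<and> real (k + k') \<le> time n"
      by (auto simp: A_def)
  qed
  ultimately show False using \<open>OMv_conjecture\<close> unfolding OMv_conjecture_def by blast
qed

section \<open>Connectivity and spanning forests\<close>

lemma connected_in_refl: "connected_in E u u"
  by (simp add: connected_in_def)

lemma connected_in_edge: "{u, v} \<in> E \<Longrightarrow> connected_in E u v"
  by (auto simp: connected_in_def)

lemma connected_in_trans: "connected_in E u v \<Longrightarrow> connected_in E v w \<Longrightarrow> connected_in E u w"
  unfolding connected_in_def by (rule rtrancl_trans)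

lemma connected_in_sym: "connected_in E u v \<Longrightarrow> connected_in E v u"
proof -
  have "sym ({(x, y). {x, y} \<in> E}\<^sup>*)"
    by (rule sym_rtrancl) (auto simp: sym_def insert_commute)
  then show "connected_in E u v \<Longrightarrow> connected_in E v u"
    by (auto simp: connected_in_def dest: symD)
qed

lemma connected_in_induct [consumes 1, case_names refl edge]:
  assumes "connected_in E u v" "Q u" "\<And>x y. {x, y} \<in> E \<Longrightarrow> Q x \<Longrightarrow> Q y"
  shows "Q v"
  using assms(1) unfolding connected_in_def
  by (induction rule: rtrancl_induct) (use assms(2,3) in auto)

lemma connected_in_mono:
  assumes "connected_in E u v" "\<And>x y. {x, y} \<in> E \<Longrightarrow> connected_in F x y"
  shows "connected_in F u v"
  using assms(1)
  by (induction rule: connected_in_induct) (auto intro: connected_in_refl connected_in_trans assms(2))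

text \<open>\<open>f\<close> labels the components. A new edge merges at most two labels, so their
  number drops by at most one per edge; elements of \<open>F\<close> that are not of the form
  \<open>{a, b}\<close> leave the labelling as it is.\<close>

lemma components_card:
  fixes F :: "nat set set"
  assumes "finite F"
  shows "\<exists>f :: nat \<Rightarrow> nat. (\<forall>x y. {x, y} \<in> F \<longrightarrow> f x = f y) \<and> N \<le> card (f ` {..<N}) + card F"
  using assms
proof (induction F rule: finite_induct)
  case empty
  show ?case by (intro exI[of _ id]) simp
next
  case (insert e F)
  then obtain f :: "nat \<Rightarrow> nat" where f: "\<forall>x y. {x, y} \<in> F \<longrightarrow> f x = f y"
    "N \<le> card (f ` {..<N}) + card F" by blast
  show ?case
  proof (cases "\<exists>a b. e = {a, b}")
    case True
    then obtain a b where e: "e = {a, b}" by blast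
    let ?g = "\<lambda>x. if f x = f a then f b else f x"
    have "f ` {..<N} \<subseteq> insert (f a) (?g ` {..<N})" by auto
    then have "card (f ` {..<N}) \<le> card (insert (f a) (?g ` {..<N}))"
      by (intro card_mono) auto
    also have "\<dots> \<le> Suc (card (?g ` {..<N}))" by (rule card_insert_le_m1) auto
    finally have card: "N \<le> card (?g ` {..<N}) + card (insert e F)" using f(2) insert by simp
    have const: "?g x = ?g y" if xy: "{x, y} \<in> insert e F" for x y
    proof -
      consider "x = a" "y = b" | "x = b" "y = a" | "{x, y} \<in> F"
        using xy e by (auto simp: doubleton_eq_iff)
      then show ?thesis
      proof cases
        case 3
        with f(1) have "f x = f y" by blast
        then show ?thesis by simp
      qed simp_all
    qed
    show ?thesis
      by (rule exI[of _ ?g], intro conjI allI impI, erule const, rule card)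
  next
    case False
    with f(1) have "\<forall>x y. {x, y} \<in> insert e F \<longrightarrow> f x = f y" by blast
    moreover have "N \<le> card (f ` {..<N}) + card (insert e F)" using f(2) insert by simp
    ultimately show ?thesis by (intro exI[of _ f] conjI)
  qed
qed

lemma connected_card:
  assumes "finite F" "\<And>u v. u < N \<Longrightarrow> v < N \<Longrightarrow> connected_in F u v"
  shows "N \<le> card F + 1"
proof -
  obtain f :: "nat \<Rightarrow> nat" where f: "\<forall>x y. {x, y} \<in> F \<longrightarrow> f x = f y"
    "N \<le> card (f ` {..<N}) + card F" using components_card[OF assms(1)] by blast
  have eq: "f u = f v" if "u < N" "v < N" for u v
    using assms(2)[OF that] by (induction rule: connected_in_induct) (use f(1) in auto)
  have "f ` {..<N} \<subseteq> {f 0}"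
  proof (rule image_subsetI)
    fix u assume "u \<in> {..<N}"
    then show "f u \<in> {f 0}" using eq[of u 0] by simp
  qed
  then have "card (f ` {..<N}) \<le> 1" using card_mono[of "{f 0}"] by simp
  with f(2) show ?thesis by simp
qed

text \<open>
  The vertex \<open>n\<close> is reached from column \<open>j\<close> of the row, and \<open>n + 1\<close> from \<open>j\<close> if the vector has a 1
  there.  The other columns are tied to \<open>n + 2\<close>, which column \<open>n\<close> joins to \<open>n\<close>, so that there
  are never more than two components.
\<close>

definition spokes :: "nat \<Rightarrow> (nat \<Rightarrow> bool) \<Rightarrow> nat set set" where
  "spokes n b = (\<lambda>j. {j, if b j then n + 1 else n + 2}) ` {..n}"

definition two_stars :: "nat \<Rightarrow> (nat \<Rightarrow> bool) \<Rightarrow> (nat \<Rightarrow> bool) \<Rightarrow> nat set set" where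
  "two_stars n b m = spokes n b \<union> (\<lambda>j. {j, n}) ` {j \<in> {..<n}. m j}"

lemma spokes_edge: "j \<le> n \<Longrightarrow> {j, if b j then n + 1 else n + 2} \<in> spokes n b"
  by (auto simp: spokes_def)

text \<open>Everything is joined to \<open>n\<close>: the hub \<open>n + 2\<close> through column
  \<open>n\<close>, the hub \<open>n + 1\<close> through the common column \<open>j0\<close>, and
  any other column through its spoke.\<close>

lemma two_stars_connected:
  assumes "\<not> b n" "j0 < n" "b j0" "m j0" "u < n + 3" "v < n + 3"
  shows "connected_in (two_stars n b m) u v"
proof -
  have "connected_in (two_stars n b m) w n" if "w < n + 3" for w
  proof -
    have spoke: "connected_in (two_stars n b m) j (if b j then n + 1 else n + 2)" if "j \<le> n" for j
      by (rule connected_in_edge) (use spokes_edge[OF that, of b] in \<open>simp add: two_stars_def\<close>)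
    have "connected_in (two_stars n b m) j0 n"
      by (rule connected_in_edge) (use assms in \<open>auto simp: two_stars_def\<close>)
    with spoke[of j0] assms have 1: "connected_in (two_stars n b m) (n + 1) n"
      by (auto intro: connected_in_trans connected_in_sym)
    have 2: "connected_in (two_stars n b m) (n + 2) n"
      using spoke[of n] assms(1) by (auto intro: connected_in_sym)
    consider "w \<le> n" | "w = n + 1" | "w = n + 2" using \<open>w < n + 3\<close> by linarith
    then show ?thesis
    proof cases
      case 1
      with spoke[of w] 2 \<open>connected_in (two_stars n b m) (n + 1) n\<close> show ?thesis
        by (auto intro: connected_in_trans split: if_splits)
    qed (use 1 2 in auto)
  qed
  from this[OF assms(5)] this[OF assms(6)] show ?thesis
    by (blast intro: connected_in_trans connected_in_sym)
qed

text \<open>The vertex \<open>n + 1\<close> together with the columns where \<open>b\<close> holds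
  is closed under edges, since no such column has a row edge; and \<open>n\<close> is not among
  them.\<close>

lemma two_stars_disconnected:
  assumes "\<not> b n" "\<And>j. j < n \<Longrightarrow> b j \<Longrightarrow> \<not> m j"
  shows "\<not> connected_in (two_stars n b m) (n + 1) n"
proof
  assume "connected_in (two_stars n b m) (n + 1) n"
  then have "n = n + 1 \<or> n < n \<and> b n"
  proof (induction rule: connected_in_induct[where Q = "\<lambda>x. x = n + 1 \<or> x < n \<and> b x"])
    case (edge x y)
    from edge(1) assms show ?case
    proof (unfold two_stars_def spokes_def, elim UnE imageE)
      fix j assume "{x, y} = {j, if b j then n + 1 else n + 2}" "j \<in> {..n}"
      with edge(2) assms(1) show ?thesis
        by (cases "j = n") (auto simp: doubleton_eq_iff split: if_splits)
    next
      fix j assume "{x, y} = {j, n}" "j \<in> {j \<in> {..<n}. m j}"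
      with edge(2) assms(2) show ?thesis by (auto simp: doubleton_eq_iff)
    qed
  qed simp
  then show False by simp
qed

text \<open>Each \<open>j \<le> n\<close> is a leaf of \<open>spokes\<close>, which excludes cycles.
  Row edges \<open>{j, n}\<close> are redundant, because \<open>b j\<close> is false there and both
  ends hang on \<open>n + 2\<close>.\<close>

lemma spokes_spanning_forest:
  assumes "\<not> b n" "\<And>j. j < n \<Longrightarrow> b j \<Longrightarrow> \<not> m j"
  shows "spanning_forest (two_stars n b m) (spokes n b)"
  unfolding spanning_forest_def
proof (intro conjI allI impI)
  show "spokes n b \<subseteq> two_stars n b m" by (simp add: two_stars_def)
  show "forest (spokes n b)"
    unfolding forest_def
  proof (intro allI impI notI)
    fix u v assume uv: "{u, v} \<in> spokes n b" and con: "connected_in (spokes n b - {{u, v}}) u v"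
    then obtain j where j: "j \<le> n" "{u, v} = {j, if b j then n + 1 else n + 2}"
      by (auto simp: spokes_def)
    \<comment> \<open>The end \<open>w\<close> is one of the two hubs; \<open>n < w\<close>
      distinguishes it from the leaf \<open>j\<close>.\<close>
    then obtain w where w: "{u, v} = {j, w}" "n < w" by (metis less_add_one add_2_eq_Suc' less_SucI add.commute Suc_eq_plus1)
    have leaf: "x = j" if "connected_in (spokes n b - {{u, v}}) j x" for x
      using that
    proof (induction rule: connected_in_induct)
      case (edge x y)
      then obtain l where l: "l \<le> n" "{x, y} = {l, if b l then n + 1 else n + 2}" by (auto simp: spokes_def)
      with edge(2) j(1) have "l = j" by (auto simp: doubleton_eq_iff split: if_splits)
      with l(2) j(2) edge(1) show ?case by simp
    qed simp
    have "connected_in (spokes n b - {{u, v}}) j w"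
      using con connected_in_sym[OF con] w(1) unfolding doubleton_eq_iff by auto
    from leaf[OF this] w(2) j(1) show False by simp
  qed
  fix u v assume "connected_in (two_stars n b m) u v"
  then show "connected_in (spokes n b) u v"
  proof (rule connected_in_mono)
    fix x y assume "{x, y} \<in> two_stars n b m"
    then consider "{x, y} \<in> spokes n b" | j where "{x, y} = {j, n}" "j < n" "m j"
      by (auto simp: two_stars_def)
    then show "connected_in (spokes n b) x y"
    proof cases
      case 2
      then have "\<not> b j" using assms(2) by blast
      with 2 have "connected_in (spokes n b) j (n + 2)" "connected_in (spokes n b) n (n + 2)"
        using connected_in_edge[OF spokes_edge[of j n b]] connected_in_edge[OF spokes_edge[of n n b]]
          assms(1) by auto
      then have "connected_in (spokes n b) j n" "connected_in (spokes n b) n j"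
        by (blast intro: connected_in_trans connected_in_sym)+
      with 2(1) show ?thesis by (auto simp: doubleton_eq_iff)
    qed (rule connected_in_edge)
  qed
qed

text \<open>With a common 1 all \<open>n + 3\<close> vertices are connected, which takes
  \<open>n + 2\<close> edges; otherwise the at most \<open>n + 1\<close> spokes suffice.\<close>

lemma card_minimum_spanning_forest_two_stars:
  assumes "\<not> b n" "minimum_spanning_forest_of (two_stars n b m) F"
  shows "n + 1 < card F \<longleftrightarrow> (\<exists>j<n. b j \<and> m j)"
proof
  assume "\<exists>j<n. b j \<and> m j"
  then obtain j0 where "j0 < n" "b j0" "m j0" by blast
  then have con: "connected_in (two_stars n b m) u v" if "u < n + 3" "v < n + 3" for u v
    using two_stars_connected[of b n j0 m u v] assms(1) that by simp
  have "finite (two_stars n b m)" by (simp add: two_stars_def spokes_def)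
  then have "finite F"
    using assms(2) by (auto simp: minimum_spanning_forest_of_def spanning_forest_def intro: finite_subset)
  moreover have "connected_in F u v" if "u < n + 3" "v < n + 3" for u v
    using assms(2) con[OF that] by (auto simp: minimum_spanning_forest_of_def spanning_forest_def)
  ultimately have "n + 3 \<le> card F + 1" by (rule connected_card)
  then show "n + 1 < card F" by simp
next
  assume "n + 1 < card F"
  show "\<exists>j<n. b j \<and> m j"
  proof (rule ccontr)
    assume "\<not> (\<exists>j<n. b j \<and> m j)"
    then have "spanning_forest (two_stars n b m) (spokes n b)"
      using assms(1) by (intro spokes_spanning_forest) auto
    then have "card F \<le> card (spokes n b)" using assms(2) by (simp add: minimum_spanning_forest_of_def)
    also have "\<dots> \<le> card {..n}" unfolding spokes_def by (rule card_image_le) simp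
    finally show False using \<open>n + 1 < card F\<close> by simp
  qed
qed

lemma query_graph_two_stars:
  "layout.query_graph n M (\<lambda>i j. j) (\<lambda>i j. n) (\<lambda>b j. j) (\<lambda>b j. n + 2 - of_bool b)
     (\<lambda>b. b) (\<lambda>_. True) False v i = two_stars n (\<lambda>j. j < n \<and> v j) (M i)"
proof -
  have eq: "{j, n + 2 - of_bool b} = {j, if b then n + 1 else n + 2}" for j and b :: bool by simp
  have "{f j | j :: nat. j \<le> n} = f ` {..n}" "{f j | j :: nat. j < n \<and> M i j} = f ` {j \<in> {..<n}. M i j}"
    for f :: "nat \<Rightarrow> nat set" by auto
  then show ?thesis
    unfolding layout.query_graph_def layout.col_edge_def layout.cell_edge_def layout.vbit_def
      two_stars_def spokes_def eq by simp
qed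

text \<open>Serves both connectivity problems and spanning forests, which differ only in the query
  arguments and in the reading of the answer. Subtracting the bit from \<open>n + 2\<close> selects
  the hub.\<close>

lemma two_stars_gadget:
  assumes "1 \<le> n" "deletions_allowed P" "as \<in> arguments P (n + 3)" "\<forall>w\<in>set as. w < n + 3"
    "length args_e \<le> 2"
    "\<And>B r a. large n B \<Longrightarrow> r 0 = n \<Longrightarrow> list_all2 (computes B r a) args_e as"
    "\<And>B r a b m s. large n B \<Longrightarrow> r 0 = n \<Longrightarrow> \<not> b n \<Longrightarrow>
      answers P (n + 3) (two_stars n b m) as (reg s 0) (reg s 1) \<Longrightarrow>
      fits B (embed r a s) out_e \<and> val (embed r a s) out_e = of_bool (\<exists>j<n. b j \<and> m j)"
  shows "gadget n (n + 3) M (\<lambda>i j. j) (\<lambda>i j. n) (\<lambda>b j. j) (\<lambda>b j. n + 2 - of_bool b)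
     (\<lambda>b. b) (\<lambda>_. True) False (Bin Add (Reg 0) (Const 3)) (Reg 3) (Reg 0) (Reg 3)
     (Bin Sub (Bin Add (Reg 0) (Const 2)) (Arr 1 (Reg 3))) out_e args_e P as"
proof unfold_locales
  have le: "4 * n + 8 \<le> B" if "large n B" for B
    by (rule large_le[OF that]) simp
  show "computes B r a (Bin Add (Reg 0) (Const 3)) (n + 3)" if "large n B" "r 0 = n" for B r a
    using le[OF that(1)] that(2) by (simp add: computes_def)
  show "computes B r a (Reg 3) j \<and> computes B r a (Bin Sub (Bin Add (Reg 0) (Const 2)) (Arr 1 (Reg 3))) (n + 2 - of_bool b)"
    if "large n B" "r 0 = n" "r 3 = j" "j \<le> n" "a 1 j = of_bool b" for B r a b j
    using le[OF that(1)] that(2-) by (simp add: computes_def)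
  show "fits B (embed r a s) out_e \<and> val (embed r a s) out_e = of_bool (bool_product n M v i)"
    if "large n B" "r 0 = n" "answers P (n + 3) (layout.query_graph n M (\<lambda>i j. j) (\<lambda>i j. n) (\<lambda>b j. j)
     (\<lambda>b j. n + 2 - of_bool b) (\<lambda>b. b) (\<lambda>_. True) False v i) as (reg s 0) (reg s 1)" for B r a v i s
  proof -
    let ?b = "\<lambda>j. j < n \<and> v j"
    have "answers P (n + 3) (two_stars n ?b (M i)) as (reg s 0) (reg s 1)"
      using that(3) unfolding query_graph_two_stars .
    moreover have "\<not> ?b n" by simp
    moreover have "bool_product n M v i \<longleftrightarrow> (\<exists>j<n. ?b j \<and> M i j)" by (auto simp: bool_product_def)
    ultimately show ?thesis
      using assms(7)[where B = B and r = r and a = a and b = ?b and m = "M i" and s = s] that(1,2)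
      by (simp only: simp_thms)
  qed
qed (use assms(1-6) in \<open>auto simp: doubleton_eq_iff computes_def of_bool_def split: if_splits\<close>)

text \<open>The output \<open>Reg 4\<close> is register 0 of the data structure, so the answer is
  passed on unchanged.\<close>

lemma pairwise_connectivity_gadget:
  assumes "1 \<le> n"
  shows "gadget n (n + 3) M (\<lambda>i j. j) (\<lambda>i j. n) (\<lambda>b j. j) (\<lambda>b j. n + 2 - of_bool b)
     (\<lambda>b. b) (\<lambda>_. True) False (Bin Add (Reg 0) (Const 3)) (Reg 3) (Reg 0) (Reg 3)
     (Bin Sub (Bin Add (Reg 0) (Const 2)) (Arr 1 (Reg 3))) (Reg 4) [Bin Add (Reg 0) (Const 1), Reg 0]
     pairwise_connectivity [n + 1, n]"
proof (rule two_stars_gadget[OF assms])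
  fix B a and s :: state and r :: "nat \<Rightarrow> nat" and b m :: "nat \<Rightarrow> bool"
  assume "\<not> b n" and "answers pairwise_connectivity (n + 3) (two_stars n b m) [n + 1, n] (reg s 0) (reg s 1)"
  moreover have "connected_in (two_stars n b m) (n + 1) n \<longleftrightarrow> (\<exists>j<n. b j \<and> m j)"
    using two_stars_connected[of b n _ m "n + 1" n] two_stars_disconnected[of b n m] \<open>\<not> b n\<close> by auto
  ultimately show "fits B (embed r a s) (Reg 4) \<and> val (embed r a s) (Reg 4) = of_bool (\<exists>j<n. b j \<and> m j)"
    by (simp add: pairwise_connectivity_def)
next
  fix B a and r :: "nat \<Rightarrow> nat" assume "large n B" "r 0 = n"
  then show "list_all2 (computes B r a) [Bin Add (Reg 0) (Const 1), Reg 0] [n + 1, n]"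
    using large_le[of n B "n + 1"] by (simp add: computes_def)
qed (auto simp: pairwise_connectivity_def)

lemma global_connectivity_gadget:
  assumes "1 \<le> n"
  shows "gadget n (n + 3) M (\<lambda>i j. j) (\<lambda>i j. n) (\<lambda>b j. j) (\<lambda>b j. n + 2 - of_bool b)
     (\<lambda>b. b) (\<lambda>_. True) False (Bin Add (Reg 0) (Const 3)) (Reg 3) (Reg 0) (Reg 3)
     (Bin Sub (Bin Add (Reg 0) (Const 2)) (Arr 1 (Reg 3))) (Reg 4) [] global_connectivity []"
proof (rule two_stars_gadget[OF assms])
  fix B a and s :: state and r :: "nat \<Rightarrow> nat" and b m :: "nat \<Rightarrow> bool"
  assume "\<not> b n" and "answers global_connectivity (n + 3) (two_stars n b m) [] (reg s 0) (reg s 1)"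
  moreover have "(\<forall>u<n + 3. \<forall>v<n + 3. connected_in (two_stars n b m) u v) \<longleftrightarrow> (\<exists>j<n. b j \<and> m j)"
  proof
    assume "\<forall>u<n + 3. \<forall>v<n + 3. connected_in (two_stars n b m) u v"
    then have "connected_in (two_stars n b m) (n + 1) n" by simp
    then show "\<exists>j<n. b j \<and> m j" using two_stars_disconnected[of b n m] \<open>\<not> b n\<close> by auto
  qed (use two_stars_connected[of b n _ m] \<open>\<not> b n\<close> in blast)
  ultimately show "fits B (embed r a s) (Reg 4) \<and> val (embed r a s) (Reg 4) = of_bool (\<exists>j<n. b j \<and> m j)"
    by (simp add: global_connectivity_def)
qed (auto simp: global_connectivity_def)

lemma minimum_spanning_forest_gadget:
  assumes "1 \<le> n"
  shows "gadget n (n + 3) M (\<lambda>i j. j) (\<lambda>i j. n) (\<lambda>b j. j) (\<lambda>b j. n + 2 - of_bool b)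
     (\<lambda>b. b) (\<lambda>_. True) False (Bin Add (Reg 0) (Const 3)) (Reg 3) (Reg 0) (Reg 3)
     (Bin Sub (Bin Add (Reg 0) (Const 2)) (Arr 1 (Reg 3)))
     (Bin Less (Bin Add (Reg 0) (Const 1)) (Reg 4)) [] minimum_spanning_forest []"
proof (rule two_stars_gadget[OF assms])
  fix B a and s :: state and r :: "nat \<Rightarrow> nat" and b m :: "nat \<Rightarrow> bool"
  assume "large n B" "r 0 = n" "\<not> b n"
    and "answers minimum_spanning_forest (n + 3) (two_stars n b m) [] (reg s 0) (reg s 1)"
  then have "n + 1 < reg s 0 \<longleftrightarrow> (\<exists>j<n. b j \<and> m j)"
    using card_minimum_spanning_forest_two_stars[of b n m] by (auto simp: minimum_spanning_forest_def)
  then show "fits B (embed r a s) (Bin Less (Bin Add (Reg 0) (Const 1)) (Reg 4)) \<and>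
      val (embed r a s) (Bin Less (Bin Add (Reg 0) (Const 1)) (Reg 4)) = of_bool (\<exists>j<n. b j \<and> m j)"
    using \<open>r 0 = n\<close> large_le[OF \<open>large n B\<close>, of "n + 1"] by simp
qed (auto simp: minimum_spanning_forest_def)

section \<open>Matchings and density\<close>

text \<open>Column \<open>j\<close> owns the path \<open>j, n + 1 + j, 2 * n + 2 + j\<close>, with one edge for the row and one for the vector.\<close>

definition col_path :: "nat \<Rightarrow> nat \<Rightarrow> nat set" where
  "col_path n j = {n + 1 + j, 2 * n + 2 + j}"

definition row_path :: "nat \<Rightarrow> nat \<Rightarrow> nat set" where
  "row_path n j = {j, n + 1 + j}"

definition path_graph :: "nat \<Rightarrow> (nat \<Rightarrow> bool) \<Rightarrow> (nat \<Rightarrow> bool) \<Rightarrow> nat set set" where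
  "path_graph n b m = col_path n ` {j \<in> {..n}. b j} \<union> row_path n ` {j \<in> {..<n}. m j}"

lemma path_graph_cases:
  assumes "e \<in> path_graph n b m"
  obtains j where "j \<le> n" "b j" "e = col_path n j" | j where "j < n" "m j" "e = row_path n j"
  using assms by (auto simp: path_graph_def)

lemma path_disjoint:
  assumes "i \<le> n" "j \<le> n" "i \<noteq> j" "e \<in> {col_path n i, row_path n i}" "f \<in> {col_path n j, row_path n j}"
  shows "e \<inter> f = {}"
  using assms by (auto simp: col_path_def row_path_def)

lemma finite_path_graph: "finite (path_graph n b m)"
  by (simp add: path_graph_def)

lemma path_center:
  assumes "e \<in> path_graph n b m" "j \<le> n" "n + 1 + j \<in> e"
  shows "e \<in> {col_path n j, row_path n j}" "b j \<or> j < n \<and> m j"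
  using assms by (auto elim!: path_graph_cases simp: col_path_def row_path_def)

lemma path_has_center:
  assumes "e \<in> path_graph n b m"
  obtains j where "j \<le> n" "n + 1 + j \<in> e"
  using assms by (auto elim!: path_graph_cases simp: col_path_def row_path_def)

text \<open>Each path is a star around its middle vertex \<open>n + 1 + j\<close>, so a maximal
  matching takes exactly one edge from every path that has any. This is why the size does not depend
  on the choice of the maximal matching.\<close>

lemma card_maximal_matching_path_graph:
  assumes "maximal_matching_in (path_graph n b m) X"
  shows "card X = card {j. j \<le> n \<and> (b j \<or> j < n \<and> m j)}" (is "_ = card ?J")
proof -
  have sub: "X \<subseteq> path_graph n b m" and mat: "\<And>e f. e \<in> X \<Longrightarrow> f \<in> X \<Longrightarrow> e \<noteq> f \<Longrightarrow> e \<inter> f = {}"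
    and max: "\<And>Y. X \<subset> Y \<Longrightarrow> Y \<subseteq> path_graph n b m \<Longrightarrow> \<not> matching Y"
    using assms by (auto simp: maximal_matching_in_def matching_def)
  have ex: "\<exists>e\<in>X. n + 1 + j \<in> e" if j: "j \<in> ?J" for j
  proof (rule ccontr)
    assume no: "\<not> (\<exists>e\<in>X. n + 1 + j \<in> e)"
    obtain e where e: "e \<in> path_graph n b m" "e \<in> {col_path n j, row_path n j}"
      using j by (auto simp: path_graph_def)
    have "n + 1 + j \<in> e" using e(2) by (auto simp: col_path_def row_path_def)
    with no have "e \<notin> X" by blast
    have "f \<inter> e = {}" if "f \<in> X" for f
    proof -
      have f: "f \<in> path_graph n b m" using sub that by blast
      obtain i where i: "i \<le> n" "n + 1 + i \<in> f" by (rule path_has_center[OF f])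
      have "i \<noteq> j" using no that i(2) by blast
      with path_disjoint[OF i(1) _ _ path_center(1)[OF f i] e(2)] j show ?thesis by simp
    qed
    then have "matching (insert e X)" using mat by (auto simp: matching_def)
    with max[of "insert e X"] \<open>e \<notin> X\<close> e(1) sub show False by blast
  qed
  define h where "h j = (SOME e. e \<in> X \<and> n + 1 + j \<in> e)" for j
  have h: "h j \<in> X" "n + 1 + j \<in> h j" if "j \<in> ?J" for j
    using someI_ex[of "\<lambda>e. e \<in> X \<and> n + 1 + j \<in> e"] ex[OF that] by (auto simp: h_def)
  have "bij_betw h ?J X"
  proof (rule bij_betwI')
    fix i j assume ij: "i \<in> ?J" "j \<in> ?J"
    show "h i = h j \<longleftrightarrow> i = j"
    proof
      assume eq: "h i = h j"
      have 1: "h i \<in> {col_path n i, row_path n i}" "h j \<in> {col_path n j, row_path n j}"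
        using path_center(1)[of "h i" n b m i] path_center(1)[of "h j" n b m j] h ij sub by blast+
      show "i = j"
      proof (rule ccontr)
        assume "i \<noteq> j"
        with path_disjoint[OF _ _ _ 1] ij have "h i \<inter> h j = {}" by simp
        with h(2)[OF ij(1)] eq show False by auto
      qed
    qed simp
  next
    fix j assume "j \<in> ?J"
    then show "h j \<in> X" by (rule h(1))
  next
    fix e assume e: "e \<in> X"
    then have eg: "e \<in> path_graph n b m" using sub by blast
    obtain j where j: "j \<le> n" "n + 1 + j \<in> e" by (rule path_has_center[OF eg])
    then have J: "j \<in> ?J" using path_center(2)[OF eg j] by simp
    have "e = h j" using mat[OF e h(1)[OF J]] j(2) h(2)[OF J] by blast
    then show "\<exists>j\<in>?J. e = h j" using J by blast
  qed
  then show ?thesis by (metis bij_betw_same_card)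
qed

text \<open>The bits are negated: a path loses both of its edges exactly at a common 1, and only
  then does the matching miss an edge. Column \<open>n\<close> always contributes one.\<close>

lemma card_maximal_matching_less_iff:
  assumes "\<not> b n" "maximal_matching_in (path_graph n (\<lambda>j. \<not> b j) (\<lambda>j. \<not> m j)) X"
  shows "card X < n + 1 \<longleftrightarrow> (\<exists>j<n. b j \<and> m j)"
proof -
  let ?J = "{j. j \<le> n \<and> (\<not> b j \<or> j < n \<and> \<not> m j)}"
  have card: "card X = card ?J" by (rule card_maximal_matching_path_graph[OF assms(2)])
  show ?thesis
  proof
    assume "\<exists>j<n. b j \<and> m j"
    then obtain j where "j < n" "b j" "m j" by blast
    then have "j \<notin> ?J" "j \<in> {..n}" by simp_all
    then have "?J \<subset> {..n}" by blast
    then have "card ?J < card {..n}" by (rule psubset_card_mono[rotated]) simp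
    then show "card X < n + 1" using card by simp
  next
    assume less: "card X < n + 1"
    show "\<exists>j<n. b j \<and> m j"
    proof (rule ccontr)
      assume none: "\<not> (\<exists>j<n. b j \<and> m j)"
      have "\<not> b j \<or> j < n \<and> \<not> m j" if "j \<le> n" for j
        using none assms(1) that by (cases "j = n") simp_all
      then have "?J = {..n}" by blast
      then show False using card less by simp
    qed
  qed
qed

text \<open>A path with both edges has density 2/3. If there is none, all edges are pairwise
  disjoint, so the edges inside \<open>U\<close> use up two vertices each and 1/2 is not
  exceeded.\<close>

lemma max_density_path_graph:
  assumes "\<not> b n"
  shows "1 / 2 < max_density (3 * n + 3) (path_graph n b m) \<longleftrightarrow> (\<exists>j<n. b j \<and> m j)"
proof -
  let ?E = "path_graph n b m"
  let ?\<U> = "{U. U \<noteq> {} \<and> U \<subseteq> {..<3 * n + 3}}"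
  let ?d = "\<lambda>U. real (card {e \<in> ?E. e \<subseteq> U}) / real (card U)"
  have "?\<U> \<subseteq> Pow {..<3 * n + 3}" by auto
  moreover have "finite (Pow {..<3 * n + 3})" unfolding finite_Pow_iff by (rule finite_lessThan)
  ultimately have fin: "finite (?d ` ?\<U>)" by (intro finite_imageI) (rule finite_subset)
  have "{0} \<in> ?\<U>" by simp
  then have ne: "?d ` ?\<U> \<noteq> {}" by blast
  have eq: "1 / 2 < max_density (3 * n + 3) ?E \<longleftrightarrow> (\<exists>U\<in>?\<U>. 1 / 2 < ?d U)"
    unfolding max_density_def using Max_gr_iff[OF fin ne, of "1 / 2"] by auto
  have "\<exists>U\<in>?\<U>. 1 / 2 < ?d U" if "j < n" "b j" "m j" for j
  proof
    let ?U = "{j, n + 1 + j, 2 * n + 2 + j}"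
    show "?U \<in> ?\<U>" using that by auto
    have "{col_path n j, row_path n j} \<subseteq> {e \<in> ?E. e \<subseteq> ?U}"
      using that by (auto simp: path_graph_def col_path_def row_path_def)
    then have "card {col_path n j, row_path n j} \<le> card {e \<in> ?E. e \<subseteq> ?U}"
      using finite_path_graph by (intro card_mono) auto
    moreover have "col_path n j \<noteq> row_path n j"
      by (auto simp: col_path_def row_path_def doubleton_eq_iff)
    ultimately have "2 \<le> card {e \<in> ?E. e \<subseteq> ?U}" by simp
    moreover have "card ?U = 3" by simp
    ultimately show "1 / 2 < ?d ?U" by simp
  qed
  moreover have "?d U \<le> 1 / 2" if none: "\<not> (\<exists>j<n. b j \<and> m j)" and U: "U \<in> ?\<U>" for U
  proof -
    have finU: "finite U" using U finite_subset[of U "{..<3 * n + 3}"] by auto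
    let ?F = "{e \<in> ?E. e \<subseteq> U}"
    have "2 * card ?F = card (\<Union>?F)"
    proof (rule card_partition)
      show "finite ?F" using finite_path_graph by simp
      show "finite (\<Union>?F)" by (rule finite_subset[OF _ finU]) auto
      show "card e = 2" if "e \<in> ?F" for e
        using that by (auto elim!: path_graph_cases simp: col_path_def row_path_def)
      show "e \<inter> f = {}" if "e \<in> ?F" "f \<in> ?F" "e \<noteq> f" for e f
      proof -
        have e: "e \<in> ?E" and f: "f \<in> ?E" using that by auto
        obtain i where i: "i \<le> n" "n + 1 + i \<in> e" by (rule path_has_center[OF e])
        obtain j where j: "j \<le> n" "n + 1 + j \<in> f" by (rule path_has_center[OF f])
        have "i \<noteq> j"
        proof
          assume "i = j"
          have "e \<in> {col_path n i, row_path n i}" "f \<in> {col_path n i, row_path n i}"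
            using path_center(1)[OF e i] path_center(1)[OF f j] \<open>i = j\<close> by auto
          moreover have "\<not> (col_path n i \<in> ?E \<and> row_path n i \<in> ?E)"
            using none assms
            by (auto elim!: path_graph_cases simp: col_path_def row_path_def doubleton_eq_iff)
          ultimately show False using e f \<open>e \<noteq> f\<close> by auto
        qed
        then show ?thesis
          by (rule path_disjoint[OF i(1) j(1) _ path_center(1)[OF e i] path_center(1)[OF f j]])
      qed
    qed
    also have "\<dots> \<le> card U" by (rule card_mono[OF finU]) auto
    finally have "real (2 * card ?F) \<le> real (card U)" by (simp only: of_nat_le_iff)
    moreover have "0 < card U" using U finU by (simp add: card_gt_0_iff)
    ultimately show ?thesis by (simp add: field_simps)
  qed
  ultimately show ?thesis unfolding eq by (meson not_le)
qed

lemma query_graph_path_graph: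
  "layout.query_graph n M (\<lambda>i j. j) (\<lambda>i j. n + 1 + j) (\<lambda>b j. n + 1 + j) (\<lambda>b j. 2 * n + 2 + j)
     g g False v i = path_graph n (\<lambda>j. g (j < n \<and> v j)) (\<lambda>j. g (M i j))"
proof -
  have "{f j | j :: nat. j \<le> n \<and> Q j} = f ` {j \<in> {..n}. Q j}"
    "{f j | j :: nat. j < n \<and> Q j} = f ` {j \<in> {..<n}. Q j}" for f :: "nat \<Rightarrow> nat set" and Q by auto
  then show ?thesis
    unfolding layout.query_graph_def layout.col_edge_def layout.cell_edge_def layout.vbit_def
      path_graph_def col_path_def row_path_def by simp
qed

text \<open>The function \<open>g\<close> is negation for matchings and the identity for
  density.\<close>

lemma path_graph_gadget:
  assumes "1 \<le> n" "deletions_allowed P" "[] \<in> arguments P (3 * n + 3)"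
    "\<And>B r a b m s. large n B \<Longrightarrow> r 0 = n \<Longrightarrow> \<not> b n \<Longrightarrow>
      answers P (3 * n + 3) (path_graph n (\<lambda>j. g (b j)) (\<lambda>j. g (m j))) [] (reg s 0) (reg s 1) \<Longrightarrow>
      2 * reg s 0 \<le> B \<Longrightarrow>
      fits B (embed r a s) out_e \<and> val (embed r a s) out_e = of_bool (\<exists>j<n. b j \<and> m j)"
  shows "gadget n (3 * n + 3) M (\<lambda>i j. j) (\<lambda>i j. n + 1 + j) (\<lambda>b j. n + 1 + j) (\<lambda>b j. 2 * n + 2 + j)
     g g False (Bin Add (Bin Mul (Const 3) (Reg 0)) (Const 3))
     (Reg 3) (Bin Add (Bin Add (Reg 0) (Const 1)) (Reg 3))
     (Bin Add (Bin Add (Reg 0) (Const 1)) (Reg 3))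
     (Bin Add (Bin Add (Bin Mul (Const 2) (Reg 0)) (Const 2)) (Reg 3)) out_e [] P []"
proof unfold_locales
  have le: "4 * n + 8 \<le> B" if "large n B" for B
    by (rule large_le[OF that]) simp
  show "computes B r a (Bin Add (Bin Mul (Const 3) (Reg 0)) (Const 3)) (3 * n + 3)"
    if "large n B" "r 0 = n" for B r a
    using le[OF that(1)] that(2) by (simp add: computes_def)
  show "computes B r a (Reg 3) j \<and> computes B r a (Bin Add (Bin Add (Reg 0) (Const 1)) (Reg 3)) (n + 1 + j)"
    if "large n B" "r 0 = n" "r 2 = i" "r 3 = j" "i < n" "j < n" for B r a i j
    using le[OF that(1)] that(2-) by (simp add: computes_def)
  show "computes B r a (Bin Add (Bin Add (Reg 0) (Const 1)) (Reg 3)) (n + 1 + j) \<and>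
     computes B r a (Bin Add (Bin Add (Bin Mul (Const 2) (Reg 0)) (Const 2)) (Reg 3)) (2 * n + 2 + j)"
    if "large n B" "r 0 = n" "r 3 = j" "j \<le> n" "a 1 j = of_bool b" for B r a b j
    using le[OF that(1)] that(2-) by (simp add: computes_def)
  show "fits B (embed r a s) out_e \<and> val (embed r a s) out_e = of_bool (bool_product n M v i)"
    if "large n B" "r 0 = n" "2 * reg s 0 \<le> B" "answers P (3 * n + 3) (layout.query_graph n M (\<lambda>i j. j)
      (\<lambda>i j. n + 1 + j) (\<lambda>b j. n + 1 + j) (\<lambda>b j. 2 * n + 2 + j) g g False v i) [] (reg s 0) (reg s 1)"
    for B r a v i s
  proof -
    let ?b = "\<lambda>j. j < n \<and> v j"
    have "answers P (3 * n + 3) (path_graph n (\<lambda>j. g (?b j)) (\<lambda>j. g (M i j))) [] (reg s 0) (reg s 1)"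
      using that(4) unfolding query_graph_path_graph .
    moreover have "\<not> ?b n" by simp
    moreover have "bool_product n M v i \<longleftrightarrow> (\<exists>j<n. ?b j \<and> M i j)" by (auto simp: bool_product_def)
    ultimately show ?thesis
      using assms(4)[where B = B and r = r and a = a and b = ?b and m = "M i" and s = s] that(1-3)
      by (simp only: simp_thms)
  qed
qed (use assms(1-3) in \<open>auto simp: doubleton_eq_iff\<close>)

lemma maximal_matching_gadget:
  assumes "1 \<le> n"
  shows "gadget n (3 * n + 3) M (\<lambda>i j. j) (\<lambda>i j. n + 1 + j) (\<lambda>b j. n + 1 + j) (\<lambda>b j. 2 * n + 2 + j)
     Not Not False (Bin Add (Bin Mul (Const 3) (Reg 0)) (Const 3))
     (Reg 3) (Bin Add (Bin Add (Reg 0) (Const 1)) (Reg 3))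
     (Bin Add (Bin Add (Reg 0) (Const 1)) (Reg 3))
     (Bin Add (Bin Add (Bin Mul (Const 2) (Reg 0)) (Const 2)) (Reg 3))
     (Bin Less (Reg 4) (Bin Add (Reg 0) (Const 1))) [] maximal_matching []"
proof (rule path_graph_gadget[OF assms])
  fix B a and s :: state and r :: "nat \<Rightarrow> nat" and b m :: "nat \<Rightarrow> bool"
  assume "large n B" "r 0 = n" "\<not> b n"
    and "answers maximal_matching (3 * n + 3) (path_graph n (\<lambda>j. \<not> b j) (\<lambda>j. \<not> m j)) [] (reg s 0) (reg s 1)"
  then have "reg s 0 < n + 1 \<longleftrightarrow> (\<exists>j<n. b j \<and> m j)"
    using card_maximal_matching_less_iff[of b n m] by (auto simp: maximal_matching_def)
  then show "fits B (embed r a s) (Bin Less (Reg 4) (Bin Add (Reg 0) (Const 1))) \<and>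
      val (embed r a s) (Bin Less (Reg 4) (Bin Add (Reg 0) (Const 1))) = of_bool (\<exists>j<n. b j \<and> m j)"
    using \<open>r 0 = n\<close> large_le[OF \<open>large n B\<close>, of "n + 1"] by simp
qed (auto simp: maximal_matching_def)

text \<open>The output test is \<open>x / y > 1 / 2\<close> without division; \<open>Reg 4\<close>
  and \<open>Reg 5\<close> are the two answer registers.\<close>

lemma maximum_density_gadget:
  assumes "1 \<le> n"
  shows "gadget n (3 * n + 3) M (\<lambda>i j. j) (\<lambda>i j. n + 1 + j) (\<lambda>b j. n + 1 + j) (\<lambda>b j. 2 * n + 2 + j)
     (\<lambda>b. b) (\<lambda>b. b) False (Bin Add (Bin Mul (Const 3) (Reg 0)) (Const 3))
     (Reg 3) (Bin Add (Bin Add (Reg 0) (Const 1)) (Reg 3))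
     (Bin Add (Bin Add (Reg 0) (Const 1)) (Reg 3))
     (Bin Add (Bin Add (Bin Mul (Const 2) (Reg 0)) (Const 2)) (Reg 3))
     (Bin Less (Reg 5) (Bin Mul (Const 2) (Reg 4))) [] maximum_density []"
proof (rule path_graph_gadget[OF assms])
  fix B a and s :: state and r :: "nat \<Rightarrow> nat" and b m :: "nat \<Rightarrow> bool"
  assume "large n B" "r 0 = n" "\<not> b n" and "2 * reg s 0 \<le> B"
    and "answers maximum_density (3 * n + 3) (path_graph n (\<lambda>j. b j) (\<lambda>j. m j)) [] (reg s 0) (reg s 1)"
  then have "reg s 1 \<noteq> 0" "real (reg s 0) / real (reg s 1) = max_density (3 * n + 3) (path_graph n b m)"
    by (simp_all add: maximum_density_def)
  moreover from this(1) have "1 / 2 < real (reg s 0) / real (reg s 1) \<longleftrightarrow> reg s 1 < 2 * reg s 0"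
    using of_nat_less_iff[of "reg s 1" "2 * reg s 0", where 'a = real] by (simp add: field_simps)
  ultimately have "reg s 1 < 2 * reg s 0 \<longleftrightarrow> (\<exists>j<n. b j \<and> m j)"
    using max_density_path_graph[of b n m] \<open>\<not> b n\<close> by simp
  then show "fits B (embed r a s) (Bin Less (Reg 5) (Bin Mul (Const 2) (Reg 4))) \<and>
      val (embed r a s) (Bin Less (Reg 5) (Bin Mul (Const 2) (Reg 4))) = of_bool (\<exists>j<n. b j \<and> m j)"
    using \<open>2 * reg s 0 \<le> B\<close> large_le[OF \<open>large n B\<close>, of 2] by simp
qed (auto simp: maximum_density_def)

section \<open>Maximum degree\<close>

lemma add_mod_cancel:
  fixes i i' j n :: nat
  assumes "(i + j) mod n = (i' + j) mod n" "i < n" "i' < n"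
  shows "i = i'"
proof -
  have le: "k' \<le> k" if "(k + j) mod n = (k' + j) mod n" "k < n" "k' < n" for k k'
  proof (rule ccontr)
    assume "\<not> k' \<le> k"
    then have "n dvd k' - k"
      using that(1) mod_eq_dvd_iff_nat[of "k + j" "k' + j" n] by simp
    with \<open>\<not> k' \<le> k\<close> \<open>k' < n\<close> show False by (auto dest: dvd_imp_le)
  qed
  from le[of i i'] le[of i' i] assms show ?thesis by simp
qed

text \<open>The cells are spread like the entries of a Latin square, so that a vertex other than the
  vertices \<open>n + 1 + j\<close> gets at most one edge for every row.\<close>

definition latin_edge :: "nat \<Rightarrow> nat \<Rightarrow> nat \<Rightarrow> nat set" where
  "latin_edge n i j = {n + 1 + j, (i + j) mod n}"

definition latin_graph :: "nat \<Rightarrow> (nat \<Rightarrow> bool) \<Rightarrow> (nat \<Rightarrow> bool) \<Rightarrow> nat \<Rightarrow> nat set set" where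
  "latin_graph n b m i = col_path n ` {j \<in> {..n}. b j} \<union>
     {latin_edge n i' j | i' j. j < n \<and> (i' = i \<and> m j \<or> i' < i)}"

lemma latin_edge_inj:
  assumes "latin_edge n i j = latin_edge n i' j'" "i < n" "i' < n"
  shows "i = i' \<and> j = j'"
proof -
  have "(i + j) mod n < n" "(i' + j') mod n < n" using assms(2) by simp_all
  then have *: "j = j'" "(i + j) mod n = (i' + j') mod n"
    using assms(1) by (auto simp: latin_edge_def doubleton_eq_iff)
  then show ?thesis using add_mod_cancel[of i j n i'] assms(2,3) by simp
qed

lemma finite_latin_graph: "finite (latin_graph n b m i)"
proof -
  have "latin_graph n b m i \<subseteq>
      col_path n ` {..n} \<union> (\<lambda>(i', j). latin_edge n i' j) ` ({..i} \<times> {..<n})"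
    by (auto simp: latin_graph_def)
  then show ?thesis by (rule finite_subset) auto
qed

text \<open>A vertex up to \<open>n\<close> meets at most one edge of each row up to
  \<open>i\<close>. A vertex \<open>n + 1 + j\<close> meets at most one edge of each earlier row
  and, without a common 1, at most one of its row edge and its vector edge. The remaining vertices
  are ends of a single vector edge.\<close>

lemma degree_latin_graph_le:
  assumes "i < n" "\<not> (\<exists>j<n. b j \<and> m j)" "v < 3 * n + 3"
  shows "card {e \<in> latin_graph n b m i. v \<in> e} \<le> i + 1" (is "card ?D \<le> _")
proof -
  consider "v < n + 1" | "n + 1 \<le> v" "v < 2 * n + 2" | "2 * n + 2 \<le> v" by linarith
  then show ?thesis
  proof cases
    case 1
    \<comment> \<open>The only edge that row \<open>i'\<close> can have at \<open>v\<close>, since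
      \<open>(i' + j) mod n = v\<close> determines \<open>j\<close>.\<close>
    define f where "f i' = {n + 1 + (SOME j. j < n \<and> (i' + j) mod n = v), v}" for i'
    have "?D \<subseteq> f ` {..i}"
    proof
      fix e assume "e \<in> ?D"
      then obtain i' j where e: "e = latin_edge n i' j" "j < n" "i' \<le> i" "(i' + j) mod n = v"
        using 1 by (auto simp: latin_graph_def latin_edge_def col_path_def le_less)
      let ?j = "SOME j. j < n \<and> (i' + j) mod n = v"
      have "?j < n \<and> (i' + ?j) mod n = v" by (rule someI[of _ j]) (use e in simp)
      then have "?j = j"
        using add_mod_cancel[of ?j i' n j] e by (simp add: add.commute)
      then show "e \<in> f ` {..i}" using e by (auto simp: f_def latin_edge_def)
    qed
    then have "card ?D \<le> card (f ` {..i})" by (intro card_mono) auto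
    also have "\<dots> \<le> card {..i}" by (rule card_image_le) simp
    finally show ?thesis by simp
  next
    case 2
    define j where "j = v - (n + 1)"
    with 2 have v: "v = n + 1 + j" "j \<le> n" by auto
    have mod: "(i' + j') mod n \<noteq> n + 1 + j" for i' j'
      using mod_less_divisor[of n "i' + j'"] assms(1) by linarith
    have sub: "?D \<subseteq> {e. e = col_path n j \<and> b j} \<union> {e. e = latin_edge n i j \<and> j < n \<and> m j} \<union>
        (\<lambda>i'. latin_edge n i' j) ` {..<i}"
    proof
      fix e assume "e \<in> ?D"
      then have "e \<in> latin_graph n b m i" "n + 1 + j \<in> e" using v by auto
      then consider l where "e = col_path n l" "l \<le> n" "b l"
        | i' l where "e = latin_edge n i' l" "l < n" "i' = i \<and> m l \<or> i' < i"
        by (auto simp: latin_graph_def)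
      then show "e \<in> {e. e = col_path n j \<and> b j} \<union> {e. e = latin_edge n i j \<and> j < n \<and> m j} \<union>
        (\<lambda>i'. latin_edge n i' j) ` {..<i}"
      proof cases
        case 1
        with \<open>n + 1 + j \<in> e\<close> v(2) show ?thesis by (auto simp: col_path_def)
      next
        case 2
        moreover from 2(1) \<open>n + 1 + j \<in> e\<close> mod[of i' l] have "l = j" by (auto simp: latin_edge_def)
        ultimately show ?thesis by auto
      qed
    qed
    \<comment> \<open>At least one of the two sets is empty, as the two bits of column
      \<open>j\<close> are not both set.\<close>
    obtain e0 where "{e. e = col_path n j \<and> b j} \<union> {e. e = latin_edge n i j \<and> j < n \<and> m j} \<subseteq> {e0}"
    proof (cases "b j")
      case True
      with assms(2) that[of "col_path n j"] show ?thesis by auto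
    next
      case False
      with that[of "latin_edge n i j"] show ?thesis by auto
    qed
    with sub have "?D \<subseteq> insert e0 ((\<lambda>i'. latin_edge n i' j) ` {..<i})" by blast
    then have "card ?D \<le> card (insert e0 ((\<lambda>i'. latin_edge n i' j) ` {..<i}))" by (intro card_mono) auto
    also have "\<dots> \<le> Suc (card ((\<lambda>i'. latin_edge n i' j) ` {..<i}))" by (rule card_insert_le_m1) auto
    also have "\<dots> \<le> Suc (card {..<i})" by (intro Suc_le_mono[THEN iffD2] card_image_le) simp
    finally show ?thesis by simp
  next
    case 3
    have "(i' + j') mod n < v" for i' j'
      using mod_less_divisor[of n "i' + j'"] assms(1) 3 by linarith
    then have "?D \<subseteq> {col_path n (v - (2 * n + 2))}"
      using 3 by (auto simp: latin_graph_def latin_edge_def col_path_def)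
    then have "card ?D \<le> card {col_path n (v - (2 * n + 2))}" by (rule card_mono[rotated]) simp
    then show ?thesis by simp
  qed
qed

text \<open>The \<open>i\<close> completed rows and row \<open>i\<close> itself give
  \<open>i + 1\<close> different edges at \<open>n + 1 + j\<close>, and the vector edge is one
  more.\<close>

lemma degree_latin_graph_ge:
  assumes "i < n" "j < n" "b j" "m j"
  shows "i + 2 \<le> card {e \<in> latin_graph n b m i. n + 1 + j \<in> e}" (is "_ \<le> card ?D")
proof -
  have inj: "inj_on (\<lambda>i'. latin_edge n i' j) {..i}"
    by (rule inj_onI) (use latin_edge_inj[of n _ j _ j] assms(1) in auto)
  have notin: "col_path n j \<notin> (\<lambda>i'. latin_edge n i' j) ` {..i}"
  proof
    assume "col_path n j \<in> (\<lambda>i'. latin_edge n i' j) ` {..i}"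
    then obtain i' where "col_path n j = latin_edge n i' j" by blast
    moreover have "(i' + j) mod n < n" using assms(1) by simp
    ultimately show False by (auto simp: col_path_def latin_edge_def doubleton_eq_iff)
  qed
  have "insert (col_path n j) ((\<lambda>i'. latin_edge n i' j) ` {..i}) \<subseteq> ?D"
    using assms by (auto simp: latin_graph_def col_path_def latin_edge_def le_less)
  then have "card (insert (col_path n j) ((\<lambda>i'. latin_edge n i' j) ` {..i})) \<le> card ?D"
    using finite_latin_graph by (intro card_mono) auto
  then show ?thesis using notin by (simp add: card_image[OF inj])
qed

lemma max_degree_latin_graph:
  assumes "i < n"
  shows "i + 1 < max_degree (3 * n + 3) (latin_graph n b m i) \<longleftrightarrow> (\<exists>j<n. b j \<and> m j)"
proof -
  have "i + 1 < max_degree (3 * n + 3) (latin_graph n b m i) \<longleftrightarrow>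
    (\<exists>v<3 * n + 3. i + 1 < card {e \<in> latin_graph n b m i. v \<in> e})"
    unfolding max_degree_def by (subst Max_gr_iff) (auto simp: lessThan_empty_iff)
  also have "\<dots> \<longleftrightarrow> (\<exists>j<n. b j \<and> m j)"
  proof
    assume "\<exists>v<3 * n + 3. i + 1 < card {e \<in> latin_graph n b m i. v \<in> e}"
    then obtain v where "v < 3 * n + 3" "i + 1 < card {e \<in> latin_graph n b m i. v \<in> e}" by blast
    then show "\<exists>j<n. b j \<and> m j"
      using degree_latin_graph_le[OF assms, of b m v] by (meson not_le)
  next
    assume "\<exists>j<n. b j \<and> m j"
    then obtain j where "j < n" "b j" "m j" by blast
    then show "\<exists>v<3 * n + 3. i + 1 < card {e \<in> latin_graph n b m i. v \<in> e}"
      using degree_latin_graph_ge[OF assms, of j b m] by (intro exI[of _ "n + 1 + j"]) simp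
  qed
  finally show ?thesis .
qed

lemma query_graph_latin_graph:
  "layout.query_graph n M (\<lambda>i j. n + 1 + j) (\<lambda>i j. (i + j) mod n) (\<lambda>b j. n + 1 + j) (\<lambda>b j. 2 * n + 2 + j)
     (\<lambda>b. b) (\<lambda>b. b) True v i = latin_graph n (\<lambda>j. j < n \<and> v j) (M i) i"
proof -
  have "{f j | j :: nat. j \<le> n \<and> Q j} = f ` {j \<in> {..n}. Q j}" for f :: "nat \<Rightarrow> nat set" and Q by auto
  then show ?thesis
    unfolding layout.query_graph_def layout.col_edge_def layout.cell_edge_def layout.vbit_def
      latin_graph_def col_path_def latin_edge_def by simp
qed

text \<open>The output compares the answer with the row number in \<open>Reg 2\<close>, because the
  threshold grows with every completed row.\<close>

lemma maximum_degree_gadget: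
  assumes "1 \<le> n"
  shows "gadget n (3 * n + 3) M (\<lambda>i j. n + 1 + j) (\<lambda>i j. (i + j) mod n)
     (\<lambda>b j. n + 1 + j) (\<lambda>b j. 2 * n + 2 + j)
     (\<lambda>b. b) (\<lambda>b. b) True (Bin Add (Bin Mul (Const 3) (Reg 0)) (Const 3))
     (Bin Add (Bin Add (Reg 0) (Const 1)) (Reg 3)) (Bin Mod (Bin Add (Reg 2) (Reg 3)) (Reg 0))
     (Bin Add (Bin Add (Reg 0) (Const 1)) (Reg 3))
     (Bin Add (Bin Add (Bin Mul (Const 2) (Reg 0)) (Const 2)) (Reg 3))
     (Bin Less (Bin Add (Reg 2) (Const 1)) (Reg 4)) [] incremental_maximum_degree []"
proof unfold_locales
  have le: "4 * n + 8 \<le> B" if "large n B" for B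
    by (rule large_le[OF that]) simp
  have mod: "(i + j) mod n < n" for i j using assms by simp
  show "1 \<le> n" by (rule assms)
  show "n + 1 + j < 3 * n + 3 \<and> (i + j) mod n < 3 * n + 3 \<and> n + 1 + j \<noteq> (i + j) mod n"
    if "i < n" "j < n" for i j
    using mod[of i j] that by linarith
  show "n + 1 + j < 3 * n + 3 \<and> 2 * n + 2 + j < 3 * n + 3 \<and> n + 1 + j \<noteq> 2 * n + 2 + j"
    if "j \<le> n" for j
    using that by simp
  show "i = i' \<and> j = j'"
    if "i < n" "i' < n" "{n + 1 + j, (i + j) mod n} = {n + 1 + j', (i' + j') mod n}" for i j i' j'
    using latin_edge_inj[of n i j i' j'] that by (simp add: latin_edge_def)
  show "j = j'" if "j \<le> n" "j' \<le> n" "{n + 1 + j, 2 * n + 2 + j} = {n + 1 + j', 2 * n + 2 + j'}" for j j'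
    using that by (auto simp: doubleton_eq_iff)
  show "{n + 1 + l, 2 * n + 2 + l} \<noteq> {n + 1 + j, (i + j) mod n}" for l i j
    using mod[of i j] unfolding doubleton_eq_iff by linarith
  show "computes B r a (Bin Add (Bin Mul (Const 3) (Reg 0)) (Const 3)) (3 * n + 3)"
    if "large n B" "r 0 = n" for B r a
    using le[OF that(1)] that(2) by (simp add: computes_def)
  show "computes B r a (Bin Add (Bin Add (Reg 0) (Const 1)) (Reg 3)) (n + 1 + j) \<and>
      computes B r a (Bin Mod (Bin Add (Reg 2) (Reg 3)) (Reg 0)) ((i + j) mod n)"
    if "large n B" "r 0 = n" "r 2 = i" "r 3 = j" "i < n" "j < n" for B r a i j
  proof -
    have "(i + j) mod n \<le> B" using le[OF that(1)] mod[of i j] by linarith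
    then show ?thesis using le[OF that(1)] that(2-) by (simp add: computes_def)
  qed
  show "computes B r a (Bin Add (Bin Add (Reg 0) (Const 1)) (Reg 3)) (n + 1 + j) \<and>
     computes B r a (Bin Add (Bin Add (Bin Mul (Const 2) (Reg 0)) (Const 2)) (Reg 3)) (2 * n + 2 + j)"
    if "large n B" "r 0 = n" "r 3 = j" "j \<le> n" "a 1 j = of_bool b" for B r a b j
    using le[OF that(1)] that(2-) by (simp add: computes_def)
  show "fits B (embed r a s) (Bin Less (Bin Add (Reg 2) (Const 1)) (Reg 4)) \<and>
      val (embed r a s) (Bin Less (Bin Add (Reg 2) (Const 1)) (Reg 4)) = of_bool (bool_product n M v i)"
    if "large n B" "r 2 = i" "i < n" "answers incremental_maximum_degree (3 * n + 3)
      (layout.query_graph n M (\<lambda>i j. n + 1 + j) (\<lambda>i j. (i + j) mod n) (\<lambda>b j. n + 1 + j) (\<lambda>b j. 2 * n + 2 + j)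
       (\<lambda>b. b) (\<lambda>b. b) True v i) [] (reg s 0) (reg s 1)" for B r a v i s
  proof -
    have "reg s 0 = max_degree (3 * n + 3) (latin_graph n (\<lambda>j. j < n \<and> v j) (M i) i)"
      using that(4) unfolding query_graph_latin_graph by (simp add: incremental_maximum_degree_def)
    then have "i + 1 < reg s 0 \<longleftrightarrow> bool_product n M v i"
      using max_degree_latin_graph[OF that(3), of "\<lambda>j. j < n \<and> v j" "M i"]
      by (auto simp: bool_product_def)
    then show ?thesis using le[OF that(1)] that(2,3) by simp
  qed
qed (auto simp: incremental_maximum_degree_def)

theorem theorem3:
  fixes \<epsilon> :: real
  assumes "OMv_conjecture" and "\<epsilon> > 0"
  shows "\<not> has_data_structure pairwise_connectivity (\<lambda>n. real n powr (1 - \<epsilon>))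
       \<and> \<not> has_data_structure global_connectivity (\<lambda>n. real n powr (1 - \<epsilon>))
       \<and> \<not> has_data_structure maximal_matching (\<lambda>n. real n powr (1 - \<epsilon>))
       \<and> \<not> has_data_structure minimum_spanning_forest (\<lambda>n. real n powr (1 - \<epsilon>))
       \<and> \<not> has_data_structure maximum_density (\<lambda>n. real n powr (1 - \<epsilon>))
       \<and> \<not> has_data_structure incremental_maximum_degree (\<lambda>n. real n powr (1 - \<epsilon>))"
  by (intro conjI omv_lower_bound[OF pairwise_connectivity_gadget assms]
      omv_lower_bound[OF global_connectivity_gadget assms]
      omv_lower_bound[OF maximal_matching_gadget assms]
      omv_lower_bound[OF minimum_spanning_forest_gadget assms]
      omv_lower_bound[OF maximum_density_gadget assms]
      omv_lower_bound[OF maximum_degree_gadget assms])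

end
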